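(* Assume that a finite full-dimensional point configuration $\mathcal A$ in $\mathbb R^d$ admits a regular triangulation $\Gamma$ which is balanced, or equivalently, whose dual graph is bipartite. Then there exists a real polynomial system of $d$ equations in $d$ variables with support $\mathcal A$ whose number of positive solutions is at least the number of $d$-simplices of $\Gamma$. If furthermore $\mathcal A\subset\mathbb Z^d$ and the triangulation $\Gamma$ is unimodular, then there exists a real polynomial system of $d$ equations in $d$ variables with support $\mathcal A$ which is maximally positive.
   Context: A point configuration is full-dimensional if its convex hull $Q$ has dimension $d$. A triangulation of $\mathcal A$ is a triangulation of $Q$ with vertices in $\mathcal A$; it is regular if there is a convex function on $Q$ which is affine on each simplex of $\Gamma$ but not affine on the union of any two different maximal simplices. $\Gamma$ is balanced if there is a map $\gamma:\mathcal A\to\{1,\ldots,d+1\}$ with $\gamma(\mathbf a)\neq\gamma(\mathbf a')$ for each edge $\{\mathbf a,\mathbf a'\}$ of $\Gamma$. The dual graph of $\Gamma$ has the $d$-simplices of $\Gamma$ as vertices, two being adjacent when they share a facet. A system $f_1=\cdots=f_d=0$ has support $\mathcal A$ if $\mathcal A$ is the set of exponent vectors $\mathbf a$ of the monomials $X^{\mathbf a}=X_1^{a_1}\cdots X_d^{a_d}$ appearing in each equation (real exponents are allowed when only positive solutions are considered). A positive solution is a solution all of whose coordinates are real and positive. $\Gamma$ is unimodular if $\mathcal A\subset\mathbb Z^d$ and every $d$-simplex of $\Gamma$ has normalized volume ($d!$ times Euclidean volume) equal to $1$. A solution is non-degenerate if the Jacobian matrix of the system is invertible at it. A polynomial system is maximally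 positive if all its non-degenerate solutions with non-zero complex coordinates are contained in the positive orthant. *)

theory Defs
  imports "HOL-Analysis.Analysis" "HOL-Library.Poly_Mapping"
begin

subsection \<open>Triangulations of point configurations\<close>

text \<open>The ambient space $\mathbf{R}^d$ is \<^typ>\<open>real^'n\<close> with $d$ = \<^term>\<open>CARD('n)\<close>.\<close>

definition full_dimensional :: "(real^'n) set \<Rightarrow> bool" where
  "full_dimensional A \<longleftrightarrow> aff_dim (convex hull A) = int CARD('n)"

text \<open>A simplicial complex consists of geometric simplices (as point sets), is closed under faces,
  and hence contains the empty face as soon as it is non-empty.\<close>

definition triangulation_of :: "(real^'n) set \<Rightarrow> (real^'n) set set \<Rightarrow> bool" where
  "triangulation_of A \<Gamma> \<longleftrightarrow>
     simplicial_complex \<Gamma> \<and> \<Union>\<Gamma> = convex hull A \<and>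
     (\<forall>S\<in>\<Gamma>. {v. v extreme_point_of S} \<subseteq> A)"

definition d_simplices :: "(real^'n) set set \<Rightarrow> (real^'n) set set" where
  "d_simplices \<Gamma> = {S\<in>\<Gamma>. int CARD('n) simplex S}"

definition maximal_simplices :: "(real^'n) set set \<Rightarrow> (real^'n) set set" where
  "maximal_simplices \<Gamma> = {S\<in>\<Gamma>. \<forall>T\<in>\<Gamma>. S \<subseteq> T \<longrightarrow> S = T}"

text \<open>The set \<open>S\<close> need not be convex: a function is affine on \<open>S\<close> if it agrees there with an
  affine function on the whole space.\<close>

definition affine_function_on :: "(real^'n) set \<Rightarrow> (real^'n \<Rightarrow> real) \<Rightarrow> bool" where
  "affine_function_on S h \<longleftrightarrow> (\<exists>u c. \<forall>x\<in>S. h x = u \<bullet> x + c)"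

definition regular_triangulation :: "(real^'n) set \<Rightarrow> (real^'n) set set \<Rightarrow> bool" where
  "regular_triangulation A \<Gamma> \<longleftrightarrow>
     triangulation_of A \<Gamma> \<and>
     (\<exists>h. convex_on (convex hull A) h \<and>
          (\<forall>S\<in>\<Gamma>. affine_function_on S h) \<and>
          (\<forall>S\<in>maximal_simplices \<Gamma>. \<forall>T\<in>maximal_simplices \<Gamma>.
             S \<noteq> T \<longrightarrow> \<not> affine_function_on (S \<union> T) h))"

definition balanced :: "(real^'n) set \<Rightarrow> (real^'n) set set \<Rightarrow> bool" where
  "balanced A \<Gamma> \<longleftrightarrow>
     (\<exists>\<gamma> :: real^'n \<Rightarrow> nat. \<gamma> ` A \<subseteq> {1..CARD('n) + 1} \<and>
        (\<forall>a\<in>A. \<forall>a'\<in>A. a \<noteq> a' \<and> convex hull {a, a'} \<in> \<Gamma> \<longrightarrow> \<gamma> a \<noteq> \<gamma> a'))"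

definition share_facet :: "(real^'n) set \<Rightarrow> (real^'n) set \<Rightarrow> bool" where
  "share_facet S T \<longleftrightarrow> S \<noteq> T \<and> (\<exists>F. F facet_of S \<and> F facet_of T)"

definition bipartite_graph :: "'v set \<Rightarrow> ('v \<Rightarrow> 'v \<Rightarrow> bool) \<Rightarrow> bool" where
  "bipartite_graph V adj \<longleftrightarrow>
     (\<exists>V1 V2. V1 \<union> V2 = V \<and> V1 \<inter> V2 = {} \<and>
        (\<forall>x\<in>V. \<forall>y\<in>V. adj x y \<longrightarrow> (x \<in> V1 \<and> y \<in> V2) \<or> (x \<in> V2 \<and> y \<in> V1)))"

definition dual_graph_bipartite :: "(real^'n) set set \<Rightarrow> bool" where
  "dual_graph_bipartite \<Gamma> \<longleftrightarrow> bipartite_graph (d_simplices \<Gamma>) share_facet"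

definition integral_configuration :: "(real^'n) set \<Rightarrow> bool" where
  "integral_configuration A \<longleftrightarrow> (\<forall>a\<in>A. \<forall>k. a $ k \<in> \<int>)"

definition normalized_volume :: "(real^'n) set \<Rightarrow> real" where
  "normalized_volume S = fact CARD('n) * measure lborel S"

definition unimodular :: "(real^'n) set \<Rightarrow> (real^'n) set set \<Rightarrow> bool" where
  "unimodular A \<Gamma> \<longleftrightarrow>
     integral_configuration A \<and> (\<forall>S\<in>d_simplices \<Gamma>. normalized_volume S = 1)"


subsection \<open>Polynomial systems\<close>

text \<open>A (generalised, Laurent) polynomial is a finitely supported map from exponent vectors to real
  coefficients. A system is a family of polynomials indexed by \<^typ>\<open>'n\<close>, the type that also indexes
  the variables, so that there are as many equations as variables.\<close>

type_synonym 'n real_poly = "(real^'n) \<Rightarrow>\<^sub>0 real"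
type_synonym 'n real_system = "'n \<Rightarrow> 'n real_poly"

definition has_support :: "'n::finite real_system \<Rightarrow> (real^'n) set \<Rightarrow> bool" where
  "has_support f A \<longleftrightarrow> (\<forall>i. Poly_Mapping.keys (f i) = A)"

text \<open>Evaluation at a point with positive coordinates; the exponents may be arbitrary reals.\<close>

definition eval_pos :: "'n::finite real_poly \<Rightarrow> real^'n \<Rightarrow> real" where
  "eval_pos p x = (\<Sum>a\<in>Poly_Mapping.keys p. Poly_Mapping.lookup p a * (\<Prod>k\<in>UNIV. (x $ k) powr (a $ k)))"

definition positive_solutions :: "'n::finite real_system \<Rightarrow> (real^'n) set" where
  "positive_solutions f = {x. (\<forall>k. 0 < x $ k) \<and> (\<forall>i. eval_pos (f i) x = 0)}"

text \<open>Evaluation at a point with non-zero complex coordinates. It is meaningful only for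
  polynomials with integral exponents, for which the floor merely converts the type.\<close>

definition eval_torus :: "'n::finite real_poly \<Rightarrow> complex^'n \<Rightarrow> complex" where
  "eval_torus p z =
     (\<Sum>a\<in>Poly_Mapping.keys p.
        of_real (Poly_Mapping.lookup p a) * (\<Prod>k\<in>UNIV. (z $ k) powi \<lfloor>a $ k\<rfloor>))"

definition torus_solutions :: "'n::finite real_system \<Rightarrow> (complex^'n) set" where
  "torus_solutions f = {z. (\<forall>k. z $ k \<noteq> 0) \<and> (\<forall>i. eval_torus (f i) z = 0)}"

definition jacobian_matrix :: "'n::finite real_system \<Rightarrow> complex^'n \<Rightarrow> complex^'n^'n" where
  "jacobian_matrix f z =
     (\<chi> i j. deriv (\<lambda>w. eval_torus (f i) (\<chi> k. if k = j then w else z $ k)) (z $ j))"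

definition maximally_positive :: "'n::finite real_system \<Rightarrow> bool" where
  "maximally_positive f \<longleftrightarrow>
     (\<forall>z\<in>torus_solutions f. invertible (jacobian_matrix f z) \<longrightarrow>
        (\<forall>k. z $ k \<in> \<real> \<and> 0 < Re (z $ k)))"

end

theory Submission
  imports Defs
begin

text \<open>Let $Q$ be the convex hull of $A$ and let $h$ be the convex function of a regular triangulation
  $\Gamma$. On a $d$-simplex $S$ the function $h$ agrees with an affine function, its piece, and $h$
  lies strictly above that piece everywhere else in $Q$ (lemmas \<open>piece_le\<close>, \<open>piece_lt\<close>). Both
  halves of the theorem rest on this strict inequality.

  Colourings and the dual graph. Colours are elements of \<open>'n option\<close>, a type with $d+1$ elements.
  A proper colouring orders the vertices of every $d$-simplex, so each simplex gets the sign of a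
  determinant. Two adjacent simplices share all vertices but one, and the two remaining vertices have
  equal colours and lie on opposite sides of the common facet; hence the sign flips along each
  edge of the dual graph, which is therefore bipartite (\<open>balanced_imp_bipartite\<close>). For the converse,
  the simplices are coloured one after the other, in the order of decreasing values at a generic point
  $p$ of their pieces. This is a line shelling: the facets of the new simplex $S$ that are
  visible from $p$ separate it from simplices that are already coloured (\<open>neighbour_across_facet\<close>),
  and every vertex of $S$ that has been met before lies in such a facet (\<open>visible_facet\<close>). Two visible
  facets could impose contradictory colours only if the two neighbours had opposite orientations, but
  they lie in the same class of the bipartition. Keeping the orientation in step with the
  bipartition is the induction hypothesis of \<open>colouring_by_shelling\<close>.

  The polynomial system. Let $\nu = h$ on the vertices of $\Gamma$ and $\nu = h + 1$ on the other points
  of $A$. For a parameter $\tau$ let $P_c$ be the sum of $e^{-\tau\nu(a)}X^a$ over the points $a$ of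
  colour $c$. Requiring $P_c$ to be the same for all $d+1$ colours amounts to $d$ linear equations in the
  $P_c$, and these equations can be chosen such that every coefficient is non-zero, which
  gives a system with support $A$ (\<open>colour_weight_relations\<close>). In logarithmic coordinates
  $X = e^z$ the claim is that, for large $\tau$, the solutions correspond to the $d$-simplices.

  Far from cancelling, the largest terms determine the solution: by an averaging argument at a barycentre
  (\<open>gap\<close>), the terms that are within a fixed exponential factor of the largest one belong to
  the vertices of a single simplex $V$. These have different colours, so each $P_c$ contains at most one of
  them, and equality of all $P_c$ forces the terms at all vertices of $V$ to be nearly equal, as complex
  numbers (\<open>localisation\<close>). If $u_V$ is the slope of the piece over $V$, this says that
  $e^{\langle v - v', z - \tau u_V\rangle}$ is close to $1$ for all vertices $v, v'$. Close to
  $\tau u_V$ the system is a small perturbation of $e^{\langle v - v', \zeta\rangle} = 1$, which has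
  at most one complex solution by a Lipschitz estimate (\<open>local_uniqueness\<close>) and at least one real
  solution by Brouwer's fixed point theorem (\<open>local_existence\<close>).

  For real $z$ it follows that $z$ itself is close to $\tau u_V$, so that there are exactly as many
  positive solutions as simplices. For complex $z$ the numbers $\langle v - v', z - \tau u_V\rangle$ are
  small only modulo $2\pi i$. In the unimodular case the gradients of the barycentric coordinates are
  integral (\<open>unimodular_bary_grad_integral\<close>), and removing the multiples of $2\pi i$ amounts to a change
  of $z$ by a vector in $2\pi i \mathbf{Z}^d$, which does not affect $X$. Since the coefficients are real,
  complex conjugation permutes the solutions near $\tau u_V$; as there is only one, it is real, and $X$ is
  positive.\<close>

section \<open>Barycentric coordinates\<close>

lemma affine_interpolation:
  fixes V :: "(real^'n) set"
  assumes "\<not> affine_dependent V"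
  shows "\<exists>u c. \<forall>v\<in>V. u \<bullet> v + c = \<phi> v"
proof (cases "V = {}")
  case False
  then obtain v0 where v0: "v0 \<in> V" by blast
  let ?B = "(\<lambda>x. - v0 + x) ` (V - {v0})"
  have "independent ?B"
    using assms affine_dependent_iff_dependent2[OF v0] by blast
  then obtain g where g: "linear g" "\<forall>x\<in>?B. g x = \<phi> (v0 + x) - \<phi> v0"
    using linear_independent_extend[of ?B "\<lambda>x. \<phi> (v0 + x) - \<phi> v0"] by blast
  define u where "u = adjoint g 1"
  have gu: "g x = u \<bullet> x" for x
    using adjoint_works[OF g(1), of x 1] by (simp add: u_def inner_commute)
  have *: "u \<bullet> v + (\<phi> v0 - u \<bullet> v0) = \<phi> v" if "v \<in> V" for v
  proof (cases "v = v0")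
    case False
    then have "g (- v0 + v) = \<phi> v - \<phi> v0" using g(2) that by auto
    then show ?thesis using gu[of "- v0 + v"] by (simp add: inner_diff_right)
  qed simp
  then show ?thesis by blast
qed simp

definition spans_simplex :: "(real^'n) set \<Rightarrow> bool" where
  "spans_simplex V \<longleftrightarrow> \<not> affine_dependent V \<and> card V = CARD('n) + 1"

text \<open>The barycentric coordinates are affine functions on the whole space: a coordinate is
  negative exactly on the far side of the facet opposite its vertex. As the pair of its gradient and its
  constant term, a coordinate can be used for inner products with edges.\<close>

definition bary_form :: "(real^'n) set \<Rightarrow> real^'n \<Rightarrow> (real^'n) \<times> real" where
  "bary_form V v = (SOME p. \<forall>w\<in>V. fst p \<bullet> w + snd p = of_bool (w = v))"

definition bary_grad :: "(real^'n) set \<Rightarrow> real^'n \<Rightarrow> real^'n" where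
  "bary_grad V v = fst (bary_form V v)"

definition bary :: "(real^'n) set \<Rightarrow> real^'n \<Rightarrow> real^'n \<Rightarrow> real" where
  "bary V v x = bary_grad V v \<bullet> x + snd (bary_form V v)"

lemma spans_simplex_finite: "spans_simplex V \<Longrightarrow> finite V"
  by (simp add: spans_simplex_def card_ge_0_finite)

lemma spans_simplex_nonempty: "spans_simplex V \<Longrightarrow> V \<noteq> {}"
  by (auto simp add: spans_simplex_def)

lemma bary_vertex:
  assumes "spans_simplex V" "w \<in> V"
  shows "bary V v w = of_bool (w = v)"
proof -
  obtain u c where "\<forall>w\<in>V. u \<bullet> w + c = of_bool (w = v)"
    using affine_interpolation[of V "\<lambda>w. of_bool (w = v)"] assms unfolding spans_simplex_def by blast
  then have "\<exists>p. \<forall>w\<in>V. fst p \<bullet> w + snd p = of_bool (w = v)"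
    by (intro exI[of _ "(u,c)"]) auto
  from someI_ex[OF this] show ?thesis
    using assms(2) unfolding bary_def bary_grad_def bary_form_def by blast
qed

lemma bary_affine_combination:
  assumes "sum u W = 1"
  shows "bary V v (\<Sum>w\<in>W. u w *\<^sub>R w) = (\<Sum>w\<in>W. u w * bary V v w)"
proof -
  have "(\<Sum>w\<in>W. u w * bary V v w) =
      (\<Sum>w\<in>W. u w * (bary_grad V v \<bullet> w)) + (\<Sum>w\<in>W. u w * snd (bary_form V v))"
    unfolding bary_def by (simp only: distrib_left sum.distrib)
  also have "\<dots> = bary_grad V v \<bullet> (\<Sum>w\<in>W. u w *\<^sub>R w) + sum u W * snd (bary_form V v)"
    by (simp only: inner_sum_right inner_scaleR_right sum_distrib_right)
  finally have "(\<Sum>w\<in>W. u w * bary V v w) =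
      bary_grad V v \<bullet> (\<Sum>w\<in>W. u w *\<^sub>R w) + sum u W * snd (bary_form V v)" .
  then show ?thesis using assms by (simp add: bary_def)
qed

lemma affine_hull_spans_simplex:
  fixes V :: "(real^'n) set"
  assumes "spans_simplex V"
  shows "affine hull V = UNIV"
proof -
  have "aff_dim V = int (DIM(real^'n))"
    using assms affine_independent_iff_card[of V] unfolding spans_simplex_def by simp
  then show ?thesis using aff_dim_eq_full by blast
qed

lemma bary_coordinates_unique:
  assumes "spans_simplex V" "sum u V = 1" "v \<in> V"
  shows "bary V v (\<Sum>w\<in>V. u w *\<^sub>R w) = u v"
proof -
  have "bary V v (\<Sum>w\<in>V. u w *\<^sub>R w) = (\<Sum>w\<in>V. u w * of_bool (w = v))"
    using bary_affine_combination[OF assms(2)] bary_vertex[OF assms(1)] by simp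
  also have "\<dots> = u v"
    using spans_simplex_finite[OF assms(1)] assms(3) by (simp add: of_bool_def if_distrib sum.delta cong: if_cong)
  finally show ?thesis .
qed

lemma bary_coordinates:
  assumes "spans_simplex V"
  shows "(\<Sum>v\<in>V. bary V v x) = 1" "(\<Sum>v\<in>V. bary V v x *\<^sub>R v) = x"
proof -
  have "x \<in> affine hull V" using affine_hull_spans_simplex[OF assms] by simp
  then obtain u where u: "sum u V = 1" "(\<Sum>v\<in>V. u v *\<^sub>R v) = x"
    unfolding affine_hull_finite[OF spans_simplex_finite[OF assms]] by blast
  have eq: "bary V v x = u v" if "v \<in> V" for v
    using bary_coordinates_unique[OF assms u(1) that] u(2) by simp
  show "(\<Sum>v\<in>V. bary V v x) = 1" using u(1) eq by simp
  show "(\<Sum>v\<in>V. bary V v x *\<^sub>R v) = x" using u(2) eq by simp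
qed

lemma in_simplex_iff_bary_nonneg:
  assumes "spans_simplex V"
  shows "x \<in> convex hull V \<longleftrightarrow> (\<forall>v\<in>V. 0 \<le> bary V v x)"
proof
  assume "x \<in> convex hull V"
  then obtain u where "\<forall>v\<in>V. 0 \<le> u v" "sum u V = 1" "x = (\<Sum>v\<in>V. u v *\<^sub>R v)"
    unfolding convex_hull_finite[OF spans_simplex_finite[OF assms]] by blast
  then show "\<forall>v\<in>V. 0 \<le> bary V v x"
    using bary_coordinates_unique[OF assms] by simp
next
  assume "\<forall>v\<in>V. 0 \<le> bary V v x"
  then show "x \<in> convex hull V"
    unfolding convex_hull_finite[OF spans_simplex_finite[OF assms]]
    using bary_coordinates[OF assms, of x] by (intro CollectI exI[of _ "\<lambda>v. bary V v x"]) simp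
qed

lemma bary_diff: "bary V v x - bary V v y = bary_grad V v \<bullet> (x - y)"
  by (simp add: bary_def inner_diff_right)

lemma bary_line: "bary V v (x + t *\<^sub>R (y - x)) = (1 - t) * bary V v x + t * bary V v y"
  by (simp add: bary_def inner_add_right inner_diff_right algebra_simps)

lemma bary_grad_sum:
  assumes "spans_simplex V"
  shows "(\<Sum>v\<in>V. bary_grad V v) = 0"
proof -
  have "(\<Sum>v\<in>V. bary_grad V v) \<bullet> x = 0" for x
  proof -
    have "(\<Sum>v\<in>V. bary_grad V v) \<bullet> x = (\<Sum>v\<in>V. bary V v x - bary V v 0)"
      by (simp add: bary_def inner_sum_left)
    also have "\<dots> = 0" using bary_coordinates(1)[OF assms] by (simp add: sum_subtractf)
    finally show ?thesis .
  qed
  then show ?thesis using inner_eq_zero_iff by blast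
qed

text \<open>The gradients of the barycentric coordinates are dual to the edge vectors, so that a vector
  can be recovered from its inner products with the vertices.\<close>

lemma bary_grad_edge:
  assumes "spans_simplex V" "w \<in> V" "w' \<in> V"
  shows "bary_grad V v \<bullet> (w - w') = of_bool (w = v) - of_bool (w' = v)"
  using bary_vertex[OF assms(1,2), of v] bary_vertex[OF assms(1,3), of v] bary_diff[of V v w w'] by simp

lemma bary_grad_expansion:
  assumes "spans_simplex V"
  shows "(\<Sum>v\<in>V. (v \<bullet> z) *\<^sub>R bary_grad V v) = z"
proof -
  have "(\<Sum>v\<in>V. (v \<bullet> z) *\<^sub>R bary_grad V v) \<bullet> w = z \<bullet> w" for w
  proof -
    have "w = (\<Sum>v\<in>V. bary V v w *\<^sub>R v) - (\<Sum>v\<in>V. bary V v 0 *\<^sub>R v)"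
      using bary_coordinates(2)[OF assms] by simp
    also have "\<dots> = (\<Sum>v\<in>V. (bary_grad V v \<bullet> w) *\<^sub>R v)"
      unfolding sum_subtractf[symmetric] by (simp add: bary_def algebra_simps)
    finally have "z \<bullet> w = z \<bullet> (\<Sum>v\<in>V. (bary_grad V v \<bullet> w) *\<^sub>R v)"
      by (rule arg_cong)
    then have "z \<bullet> w = (\<Sum>v\<in>V. (bary_grad V v \<bullet> w) * (z \<bullet> v))"
      by (simp add: inner_sum_right)
    then show ?thesis
      by (simp add: inner_sum_left inner_commute[of _ z] mult.commute)
  qed
  then show ?thesis using vector_eq_rdot by blast
qed

section \<open>Orientation\<close>

text \<open>The index \<open>None\<close> carries the constant coordinate $1$. As a set of colours, the same type
  \<open>'n option\<close> provides exactly as many colours as a $d$-simplex has vertices.\<close>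

definition homogenize :: "real^'n \<Rightarrow> real^('n option)" where
  "homogenize x = (\<chi> i. case i of None \<Rightarrow> 1 | Some k \<Rightarrow> x $ k)"

definition orientation :: "('n option \<Rightarrow> real^'n) \<Rightarrow> real" where
  "orientation f = det (\<chi> i. homogenize (f i))"

lemma homogenize_affine_combination:
  assumes "sum u W = 1"
  shows "homogenize (\<Sum>w\<in>W. u w *\<^sub>R w) = (\<Sum>w\<in>W. u w *\<^sub>R homogenize w)"
  using assms by (auto simp: vec_eq_iff homogenize_def split: option.split)

text \<open>The determinant is linear in each row, and in the expansion of the new vertex in barycentric
  coordinates all summands but one repeat a row. The sign of the determinant thus records the side
  on which the new vertex lies.\<close>

lemma orientation_replace:
  fixes f :: "'n::finite option \<Rightarrow> real^'n"
  assumes "spans_simplex V" "bij_betw f UNIV V"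
  shows "orientation (f(c := x)) = bary V (f c) x * orientation f"
proof -
  have hx: "homogenize x = (\<Sum>i\<in>UNIV. bary V (f i) x *\<^sub>R homogenize (f i))"
  proof -
    have "homogenize x = (\<Sum>v\<in>V. bary V v x *\<^sub>R homogenize v)"
      by (subst bary_coordinates(2)[OF assms(1), of x, symmetric])
         (simp only: homogenize_affine_combination[OF bary_coordinates(1)[OF assms(1)]])
    also have "\<dots> = (\<Sum>i\<in>UNIV. bary V (f i) x *\<^sub>R homogenize (f i))"
      by (rule sum.reindex_bij_betw[OF assms(2), symmetric])
    finally show ?thesis .
  qed
  have "orientation (f(c := x)) = det (\<chi> i. if i = c then homogenize x else homogenize (f i))"
    unfolding orientation_def by (rule arg_cong[of _ _ det]) (auto simp: vec_eq_iff)
  also have "\<dots> = (\<Sum>j\<in>UNIV. det (\<chi> i. if i = c then bary V (f j) x *\<^sub>R homogenize (f j) else homogenize (f i)))"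
    unfolding hx by (rule det_linear_row_sum) simp
  also have "\<dots> = (\<Sum>j\<in>UNIV. if j = c then bary V (f c) x * orientation f else 0)"
  proof (rule sum.cong[OF refl])
    fix j
    have *: "det (\<chi> i. if i = c then bary V (f j) x *\<^sub>R homogenize (f j) else homogenize (f i)) =
       bary V (f j) x * det (\<chi> i. if i = c then homogenize (f j) else homogenize (f i))"
      by (simp only: scalar_mult_eq_scaleR[symmetric] det_row_mul)
    show "det (\<chi> i. if i = c then bary V (f j) x *\<^sub>R homogenize (f j) else homogenize (f i)) =
      (if j = c then bary V (f c) x * orientation f else 0)"
    proof (cases "j = c")
      case True
      have "(\<chi> i. if i = c then homogenize (f c) else homogenize (f i)) = (\<chi> i. homogenize (f i))"
        by (auto simp: vec_eq_iff)
      then show ?thesis using * True by (simp only: orientation_def if_True simp_thms)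
    next
      case False
      then have "det (\<chi> i. if i = c then homogenize (f j) else homogenize (f i)) = 0"
        by (intro det_identical_rows[OF False]) (auto simp: row_def vec_eq_iff)
      then show ?thesis using * False by simp
    qed
  qed
  also have "\<dots> = bary V (f c) x * orientation f" by simp
  finally show ?thesis .
qed

lemma orientation_swap:
  fixes f :: "'n::finite option \<Rightarrow> real^'n"
  assumes "a \<noteq> b"
  shows "orientation (f(a := f b, b := f a)) = - orientation f"
proof -
  have "orientation (f(a := f b, b := f a)) = det (\<chi> i. (\<chi> i. homogenize (f i)) $ Transposition.transpose a b i)"
    unfolding orientation_def by (rule arg_cong[of _ _ det]) (auto simp: vec_eq_iff Transposition.transpose_def)
  also have "\<dots> = - orientation f"
    using assms
    by (subst det_permute_rows) (auto simp: permutes_swap_id sign_swap_id orientation_def)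
  finally show ?thesis .
qed

text \<open>The coefficients of the barycentric coordinates form an inverse of the matrix of homogenised vertices.\<close>

lemma orientation_nonzero:
  fixes f :: "'n::finite option \<Rightarrow> real^'n"
  assumes "spans_simplex V" "bij_betw f UNIV V"
  shows "orientation f \<noteq> 0"
proof -
  let ?M = "\<chi> i. homogenize (f i)"
  let ?N = "(\<chi> k c. case k of None \<Rightarrow> snd (bary_form V (f c)) | Some j \<Rightarrow> bary_grad V (f c) $ j) :: real^('n option)^('n option)"
  have "(?M ** ?N) $ i $ c = mat 1 $ i $ c" for i c
  proof -
    have "(?M ** ?N) $ i $ c = (\<Sum>k\<in>UNIV. homogenize (f i) $ k * ?N $ k $ c)"
      by (simp add: matrix_matrix_mult_def)
    also have "\<dots> = snd (bary_form V (f c)) + (\<Sum>j\<in>UNIV. f i $ j * bary_grad V (f c) $ j)"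
      by (simp add: UNIV_option_conv sum.insert sum.reindex homogenize_def)
    also have "\<dots> = bary V (f c) (f i)"
      by (simp add: bary_def inner_vec_def mult.commute)
    also have "\<dots> = of_bool (f i = f c)"
      by (rule bary_vertex[OF assms(1)]) (use assms(2) in \<open>auto simp: bij_betw_def\<close>)
    also have "\<dots> = mat 1 $ i $ c"
      using assms(2) by (auto simp: mat_def bij_betw_def inj_eq)
    finally show ?thesis .
  qed
  then have "?M ** ?N = mat 1" by (simp add: vec_eq_iff)
  then have "det ?M * det ?N = 1" using det_mul[of ?M ?N] by (simp only: det_I)
  then show ?thesis unfolding orientation_def by auto
qed

section \<open>Geometry of regular triangulations\<close>

definition verts :: "(real^'n) set \<Rightarrow> (real^'n) set" where
  "verts S = {v. v extreme_point_of S}"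

text \<open>A face of a simplex is spanned by vertices, and all coordinates of its points at the other vertices vanish.\<close>

lemma face_contains_supporting_vertex:
  assumes "spans_simplex V" "F face_of (convex hull V)" "x \<in> F" "u \<in> V" "bary V u x > 0"
  shows "u \<in> F"
proof -
  obtain c where c: "c \<subseteq> V" "F = convex hull c"
    using assms(1,2) face_of_convex_hull_affine_independent unfolding spans_simplex_def by blast
  have "finite c" using c(1) spans_simplex_finite[OF assms(1)] finite_subset by blast
  then obtain a where a: "sum a c = 1" "x = (\<Sum>w\<in>c. a w *\<^sub>R w)"
    using assms(3) unfolding c(2) by (auto simp: convex_hull_finite)
  have "u \<in> c"
  proof (rule ccontr)
    assume "u \<notin> c"
    then have "bary V u w = 0" if "w \<in> c" for w
      using bary_vertex[OF assms(1), of w u] that c(1) by auto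
    then have "bary V u x = 0" unfolding a(2) bary_affine_combination[OF a(1)] by simp
    then show False using assms(5) by simp
  qed
  then show ?thesis unfolding c(2) by (rule hull_inc)
qed

lemma verts_convex_hull: "\<not> affine_dependent V \<Longrightarrow> verts (convex hull V) = V"
  unfolding verts_def by (auto simp: extreme_point_of_convex_hull_affine_independent)

lemma facet_barycentre:
  fixes V :: "(real^'n) set"
  assumes V: "spans_simplex V" and v: "v \<in> V"
  obtains x where "x \<in> convex hull (V - {v})"
    "\<And>u. u \<in> V \<Longrightarrow> bary V u x = (if u = v then 0 else 1 / real CARD('n))"
proof -
  let ?G = "V - {v}"
  have finV: "finite V" using spans_simplex_finite[OF V] .
  have cG: "card ?G = CARD('n)" using V v finV unfolding spans_simplex_def by simp
  define x where "x = (\<Sum>w\<in>?G. (1 / real CARD('n)) *\<^sub>R w)"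
  have one: "(\<Sum>w\<in>?G. 1 / real CARD('n)) = 1" using cG by simp
  have bx: "bary V u x = (if u = v then 0 else 1 / real CARD('n))" if "u \<in> V" for u
  proof -
    have "bary V u x = (\<Sum>w\<in>?G. (1 / real CARD('n)) * of_bool (w = u))"
      unfolding x_def bary_affine_combination[OF one] using bary_vertex[OF V] by simp
    also have "\<dots> = (\<Sum>w\<in>?G. if w = u then 1 / real CARD('n) else 0)"
      by (rule sum.cong) auto
    also have "\<dots> = (if u = v then 0 else 1 / real CARD('n))"
      using finV that by (subst sum.delta) auto
    finally show ?thesis .
  qed
  have "x \<in> convex hull ?G"
    unfolding x_def using finV by (intro convex_sum[OF _ convex_convex_hull one]) (auto intro: hull_inc)
  then show ?thesis using that bx by blast
qed

lemma step_into_ball: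
  fixes x y :: "'a::real_normed_vector"
  assumes "0 < e"
  obtains t where "0 < t" "t < 1" "x + t *\<^sub>R (y - x) \<in> ball x e"
proof -
  have "((\<lambda>t. x + t *\<^sub>R (y - x)) \<longlongrightarrow> x + 0 *\<^sub>R (y - x)) (at_right 0)"
    by (intro tendsto_intros)
  then have "\<forall>\<^sub>F t in at_right 0. dist (x + t *\<^sub>R (y - x)) x < e"
    using tendstoD[OF _ assms] by fastforce
  moreover have "\<forall>\<^sub>F t::real in at_right 0. t \<in> {0<..<1}"
    by (rule eventually_at_right_real) simp
  ultimately have "\<forall>\<^sub>F t in at_right 0. dist (x + t *\<^sub>R (y - x)) x < e \<and> t \<in> {0<..<1}"
    by (rule eventually_conj)
  then have "\<exists>t. dist (x + t *\<^sub>R (y - x)) x < e \<and> t \<in> {0<..<1}"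
    by (rule eventually_happens'[OF trivial_limit_at_right_real])
  then show ?thesis using that by (auto simp: dist_commute)
qed

lemma eventually_segment_pos:
  fixes a b :: real
  assumes "0 \<le> a" "a = 0 \<Longrightarrow> 0 < b"
  shows "\<forall>\<^sub>F t in at_right 0. 0 < (1 - t) * a + t * b"
proof (cases "a = 0")
  case True
  have "\<forall>\<^sub>F t::real in at_right 0. 0 < t" by (rule eventually_at_right_less)
  then show ?thesis by eventually_elim (use assms(2)[OF True] True in simp)
next
  case False
  have "((\<lambda>t. (1 - t) * a + t * b) \<longlongrightarrow> (1 - 0) * a + 0 * b) (at_right 0)"
    by (intro tendsto_intros)
  from order_tendstoD(1)[OF this, of 0] show ?thesis using False assms(1) by simp
qed

locale regular_triangulation_by =
  fixes A :: "(real^'n) set" and \<Gamma> :: "(real^'n) set set" and h :: "real^'n \<Rightarrow> real"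
  assumes finite_A: "finite A" and full: "full_dimensional A"
    and tri: "triangulation_of A \<Gamma>"
    and convex_h: "convex_on (convex hull A) h"
    and affine_h: "\<And>S. S \<in> \<Gamma> \<Longrightarrow> affine_function_on S h"
    and breaks: "\<And>S T. S \<in> maximal_simplices \<Gamma> \<Longrightarrow> T \<in> maximal_simplices \<Gamma> \<Longrightarrow> S \<noteq> T
        \<Longrightarrow> \<not> affine_function_on (S \<union> T) h"
begin

lemma complex_facts:
  shows "finite \<Gamma>" and "\<And>S. S \<in> \<Gamma> \<Longrightarrow> \<exists>n. n simplex S"
    and "\<And>S F. S \<in> \<Gamma> \<Longrightarrow> F face_of S \<Longrightarrow> F \<in> \<Gamma>"
    and "\<And>S T. S \<in> \<Gamma> \<Longrightarrow> T \<in> \<Gamma> \<Longrightarrow> (S \<inter> T) face_of S"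
    and "\<And>S T. S \<in> \<Gamma> \<Longrightarrow> T \<in> \<Gamma> \<Longrightarrow> (S \<inter> T) face_of T"
    and "\<Union>\<Gamma> = convex hull A"
    and "\<And>S. S \<in> \<Gamma> \<Longrightarrow> verts S \<subseteq> A"
  using tri unfolding triangulation_of_def simplicial_complex_def verts_def
  by (blast, blast, blast, blast, metis inf_commute, blast, blast)

lemma d_simplices_subset: "S \<in> d_simplices \<Gamma> \<Longrightarrow> S \<in> \<Gamma>"
  by (simp add: d_simplices_def)

lemma finite_d_simplices: "finite (d_simplices \<Gamma>)"
  using complex_facts(1) by (simp add: d_simplices_def)

lemma d_simplex_verts:
  assumes "S \<in> d_simplices \<Gamma>"
  shows "spans_simplex (verts S)" "convex hull (verts S) = S" "verts S \<subseteq> A"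
proof -
  obtain C where C: "\<not> affine_dependent C" "int (card C) = int CARD('n) + 1" "S = convex hull C"
    using assms unfolding d_simplices_def simplex_def by blast
  then have "spans_simplex C" unfolding spans_simplex_def by simp
  moreover have "verts S = C" using verts_convex_hull[OF C(1)] C(3) by simp
  ultimately show "spans_simplex (verts S)" "convex hull (verts S) = S" using C(3) by simp_all
  show "verts S \<subseteq> A" using complex_facts(7) d_simplices_subset[OF assms] by blast
qed

lemma verts_eq_iff:
  "S \<in> d_simplices \<Gamma> \<Longrightarrow> T \<in> d_simplices \<Gamma> \<Longrightarrow> verts S = verts T \<longleftrightarrow> S = T"
  using d_simplex_verts(2) by metis

lemma simplex_in_hull: "S \<in> \<Gamma> \<Longrightarrow> S \<subseteq> convex hull A"
  using complex_facts(6) by blast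

lemma simplex_convex_compact:
  assumes "S \<in> \<Gamma>" shows "convex S" "compact S"
  using complex_facts(2)[OF assms] convex_simplex compact_simplex by blast+

lemma full_dim_simplex_interior:
  assumes "S \<in> \<Gamma>" "interior S \<noteq> {}"
  shows "S \<in> d_simplices \<Gamma>"
proof -
  obtain n where n: "n simplex S" using complex_facts(2)[OF assms(1)] by blast
  have "aff_dim S = int CARD('n)" using aff_dim_nonempty_interior[OF assms(2)] by simp
  then have "n = int CARD('n)" using aff_dim_simplex[OF n] by simp
  then show ?thesis using n assms(1) by (simp add: d_simplices_def)
qed

lemma d_simplex_interior:
  assumes "S \<in> d_simplices \<Gamma>"
  shows "interior S \<noteq> {}"
proof -
  have "affine hull S = UNIV"
    using affine_hull_spans_simplex[OF d_simplex_verts(1)[OF assms]] d_simplex_verts(2)[OF assms]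
    by (metis affine_hull_convex_hull)
  then have "rel_interior S = interior S" by (rule rel_interior_interior)
  moreover have "S \<noteq> {}" using \<open>affine hull S = UNIV\<close> by auto
  ultimately show ?thesis
    using rel_interior_eq_empty simplex_convex_compact(1) d_simplices_subset[OF assms] by metis
qed

text \<open>The boundaries of finitely many convex sets form a null set, so an open set has a point that is interior to
  each simplex that contains it.\<close>

lemma open_meets_d_simplex:
  assumes "open U" "U \<noteq> {}" "U \<subseteq> convex hull A"
  obtains T where "T \<in> d_simplices \<Gamma>" "U \<inter> interior T \<noteq> {}"
proof -
  have "negligible (\<Union>S\<in>\<Gamma>. frontier S)"
    using complex_facts(1) simplex_convex_compact(1)
    by (auto intro!: negligible_Union simp: negligible_convex_frontier)
  then have "\<not> U \<subseteq> (\<Union>S\<in>\<Gamma>. frontier S)"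
    using open_not_negligible[OF assms(1,2)] negligible_subset by blast
  then obtain x where x: "x \<in> U" "\<And>S. S \<in> \<Gamma> \<Longrightarrow> x \<notin> frontier S" by blast
  obtain S where S: "S \<in> \<Gamma>" "x \<in> S" using x(1) assms(3) complex_facts(6) by blast
  have "x \<in> interior S"
    using x(2)[OF S(1)] S(2) closure_subset[of S] unfolding frontier_def by blast
  then show ?thesis using that[OF full_dim_simplex_interior[OF S(1)]] x(1) by blast
qed

lemma hull_interior: "interior (convex hull A) \<noteq> {}"
proof -
  have "affine hull (convex hull A) = UNIV"
    using full unfolding full_dimensional_def using aff_dim_eq_full[of "convex hull A"] by simp
  then have "rel_interior (convex hull A) = interior (convex hull A)" by (rule rel_interior_interior)
  moreover have "convex hull A \<noteq> {}" using full unfolding full_dimensional_def by auto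
  ultimately show ?thesis using rel_interior_eq_empty convex_convex_hull by metis
qed

text \<open>The union of the $d$-simplices is closed, so an uncovered point would have a whole open set of uncovered points nearby.\<close>

lemma d_simplices_cover:
  assumes "x \<in> convex hull A"
  obtains T where "T \<in> d_simplices \<Gamma>" "x \<in> T"
proof -
  have cl: "closed (\<Union>(d_simplices \<Gamma>))"
    using finite_d_simplices simplex_convex_compact(2) d_simplices_subset compact_imp_closed
    by (intro closed_Union) auto
  have "x \<in> \<Union>(d_simplices \<Gamma>)"
  proof (rule ccontr)
    assume "x \<notin> \<Union>(d_simplices \<Gamma>)"
    moreover have "x \<in> closure (interior (convex hull A))"
      using assms convex_closure_interior[OF convex_convex_hull hull_interior] closure_subset by blast
    ultimately have "- \<Union>(d_simplices \<Gamma>) \<inter> interior (convex hull A) \<noteq> {}" (is "?U \<noteq> {}")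
      using open_Int_closure_eq_empty[of "- \<Union>(d_simplices \<Gamma>)"] cl by blast
    moreover have "open ?U" using cl by blast
    moreover have "?U \<subseteq> convex hull A" using interior_subset by blast
    ultimately obtain T where "T \<in> d_simplices \<Gamma>" "?U \<inter> interior T \<noteq> {}"
      using open_meets_d_simplex by blast
    then show False using interior_subset by blast
  qed
  then show ?thesis using that by blast
qed

text \<open>The triangulation is pure: a relatively interior point of a simplex $S$ lies in some $d$-simplex,
  and a face of $S$ that contains such a point is all of $S$.\<close>

lemma face_of_d_simplex:
  assumes "S \<in> \<Gamma>" "S \<noteq> {}"
  obtains T where "T \<in> d_simplices \<Gamma>" "S face_of T"
proof -
  obtain x where x: "x \<in> rel_interior S"
    using assms(2) rel_interior_eq_empty[OF simplex_convex_compact(1)[OF assms(1)]] by blast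
  then have "x \<in> convex hull A" using rel_interior_subset simplex_in_hull[OF assms(1)] by blast
  then obtain T where T: "T \<in> d_simplices \<Gamma>" "x \<in> T" using d_simplices_cover by blast
  have "S \<subseteq> S \<inter> T"
    using subset_of_face_of[OF complex_facts(4)[OF assms(1) d_simplices_subset[OF T(1)]], of S] x T(2)
      rel_interior_subset by blast
  then have "S \<inter> T = S" by blast
  then have "S face_of T" using complex_facts(5)[OF assms(1) d_simplices_subset[OF T(1)]] by simp
  then show ?thesis using that T(1) by blast
qed

lemma d_simplex_subset_eq:
  assumes "S \<in> d_simplices \<Gamma>" "T \<in> \<Gamma>" "S \<subseteq> T"
  shows "S = T"
proof (rule ccontr)
  assume "S \<noteq> T"
  have "S \<inter> T = S" using assms(3) by blast
  then have "S face_of T" using complex_facts(5)[OF d_simplices_subset[OF assms(1)] assms(2)] by simp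
  then have "aff_dim S < aff_dim T"
    using face_of_aff_dim_lt simplex_convex_compact(1)[OF assms(2)] \<open>S \<noteq> T\<close> by blast
  moreover have "aff_dim S = int CARD('n)" using d_simplex_interior[OF assms(1)] aff_dim_nonempty_interior by force
  moreover have "aff_dim T \<le> int CARD('n)" using aff_dim_le_DIM[of T] by simp
  ultimately show False by simp
qed

lemma d_simplex_maximal: "S \<in> d_simplices \<Gamma> \<Longrightarrow> S \<in> maximal_simplices \<Gamma>"
  using d_simplex_subset_eq d_simplices_subset unfolding maximal_simplices_def by blast

definition piece_form :: "(real^'n) set \<Rightarrow> (real^'n) \<times> real" where
  "piece_form S = (SOME p. \<forall>x\<in>S. h x = fst p \<bullet> x + snd p)"

definition slope :: "(real^'n) set \<Rightarrow> real^'n" where "slope S = fst (piece_form S)"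

definition offset :: "(real^'n) set \<Rightarrow> real" where "offset S = snd (piece_form S)"

definition piece :: "(real^'n) set \<Rightarrow> real^'n \<Rightarrow> real" where
  "piece S x = slope S \<bullet> x + offset S"

lemma piece_eq:
  assumes "S \<in> d_simplices \<Gamma>" "x \<in> S"
  shows "h x = piece S x"
proof -
  obtain u c where "\<forall>x\<in>S. h x = u \<bullet> x + c"
    using affine_h[OF d_simplices_subset[OF assms(1)]] unfolding affine_function_on_def by blast
  then have "\<exists>p. \<forall>x\<in>S. h x = fst p \<bullet> x + snd p" by (intro exI[of _ "(u,c)"]) auto
  from someI_ex[OF this] show ?thesis
    using assms(2) unfolding piece_def slope_def offset_def piece_form_def by blast
qed

lemma piece_line: "piece S (x + t *\<^sub>R (y - x)) = (1 - t) * piece S x + t * piece S y"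
  by (simp add: piece_def inner_add_right inner_diff_right algebra_simps)

lemma piece_distinct:
  assumes "S \<in> d_simplices \<Gamma>" "T \<in> d_simplices \<Gamma>" "S \<noteq> T"
  shows "slope S \<noteq> slope T \<or> offset S \<noteq> offset T"
proof (rule ccontr)
  assume "\<not> ?thesis"
  then have "\<forall>x\<in>S \<union> T. h x = slope S \<bullet> x + offset S"
    using piece_eq assms(1,2) unfolding piece_def by auto
  then have "affine_function_on (S \<union> T) h" unfolding affine_function_on_def by blast
  then show False using breaks[OF d_simplex_maximal d_simplex_maximal] assms by blast
qed

lemma piece_le:
  assumes "S \<in> d_simplices \<Gamma>" "x \<in> convex hull A"
  shows "piece S x \<le> h x"
proof -
  obtain p where p: "p \<in> interior S" using d_simplex_interior[OF assms(1)] by blast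
  then obtain e where e: "e > 0" "ball p e \<subseteq> S" using mem_interior by blast
  obtain t where t: "0 < t" "t < 1" and yS: "p + t *\<^sub>R (x - p) \<in> S"
    using step_into_ball[OF e(1), of p x] e(2) by blast
  have pS: "p \<in> S" using p interior_subset by blast
  then have pA: "p \<in> convex hull A" using simplex_in_hull d_simplices_subset[OF assms(1)] by blast
  have "h (p + t *\<^sub>R (x - p)) \<le> (1 - t) * h p + t * h x"
    using convex_onD[OF convex_h _ _ pA assms(2), of t] t by (simp add: algebra_simps)
  then have "(1 - t) * piece S p + t * piece S x \<le> (1 - t) * piece S p + t * h x"
    using piece_eq[OF assms(1) yS] piece_eq[OF assms(1) pS] piece_line by simp
  then show ?thesis using t by simp
qed

text \<open>If $h$ touched the piece of $S$ at a point $x$ outside $S$, then by convexity it would agree with the piece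
  on the convex hull of $S$ and $x$. This hull has inner points outside $S$, where it
  overlaps another $d$-simplex, and $h$ would be affine on the union of both.\<close>

lemma piece_lt:
  assumes "S \<in> d_simplices \<Gamma>" "x \<in> convex hull A" "x \<notin> S"
  shows "piece S x < h x"
proof (rule ccontr)
  assume "\<not> ?thesis"
  then have hx: "h x = piece S x" using piece_le[OF assms(1,2)] by simp
  have SA: "S \<subseteq> convex hull A" using simplex_in_hull d_simplices_subset[OF assms(1)] by blast
  have clS: "closed S" using simplex_convex_compact d_simplices_subset[OF assms(1)] compact_imp_closed by blast
  have cvS: "convex S" using simplex_convex_compact d_simplices_subset[OF assms(1)] by blast
  let ?W = "convex hull (insert x S)"
  have WA: "?W \<subseteq> convex hull A"
    using SA assms(2) by (intro hull_minimal) auto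
  have hW: "h y = piece S y" if yW: "y \<in> ?W" for y
  proof -
    have "S \<noteq> {}" using d_simplex_interior[OF assms(1)] by auto
    then obtain t r s where trs: "0 \<le> t" "0 \<le> r" "t + r = 1" "s \<in> convex hull S"
        "y = t *\<^sub>R x + r *\<^sub>R s"
      using yW unfolding convex_hull_insert[OF \<open>S \<noteq> {}\<close>] by blast
    then have ts: "s \<in> S" "0 \<le> t" "t \<le> 1" "y = s + t *\<^sub>R (x - s)"
      using hull_same[of convex S] cvS by (auto simp: algebra_simps simp flip: scaleR_add_left)
    have "h y \<le> (1 - t) * h s + t * h x"
    proof -
      have "y = (1 - t) *\<^sub>R s + t *\<^sub>R x" using ts(4) by (simp add: algebra_simps)
      then show ?thesis using convex_onD[OF convex_h ts(2,3), of s x] ts(1) SA assms(2) by auto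
    qed
    also have "\<dots> = piece S y" using piece_eq[OF assms(1) ts(1)] hx ts(4) piece_line by simp
    finally show ?thesis using piece_le[OF assms(1), of y] that WA by force
  qed
  have "interior ?W \<noteq> {}"
    using d_simplex_interior[OF assms(1)] interior_mono[of S ?W] hull_subset[of "insert x S" convex] by blast
  then have "x \<in> closure (interior ?W)"
    using convex_closure_interior[OF convex_convex_hull] hull_subset[of "insert x S" convex]
      closure_subset[of ?W] by blast
  then have "- S \<inter> interior ?W \<noteq> {}" (is "?U \<noteq> {}")
    using open_Int_closure_eq_empty[of "- S"] clS assms(3) by blast
  moreover have oU: "open ?U" using clS by blast
  moreover have "?U \<subseteq> convex hull A" using interior_subset WA by blast
  ultimately obtain T where T: "T \<in> d_simplices \<Gamma>" "?U \<inter> interior T \<noteq> {}"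
    using open_meets_d_simplex by blast
  then have "T \<noteq> S" using interior_subset by blast
  obtain q where q: "q \<in> ?U \<inter> interior T" using T(2) by blast
  have "open (?U \<inter> interior T)" using oU by blast
  then obtain e where e: "e > 0" "cball q e \<subseteq> ?U \<inter> interior T" using q open_contains_cball by blast
  have eq: "piece S y = piece T y" if "y \<in> cball q e" for y
  proof -
    have "y \<in> ?W" "y \<in> T" using that e(2) interior_subset by blast+
    then show ?thesis using hW[of y] piece_eq[OF T(1), of y] by simp
  qed
  have "slope S = slope T"
  proof (rule ccontr)
    assume ne: "slope S \<noteq> slope T"
    define z where "z = slope S - slope T"
    define y where "y = q + (e / norm z) *\<^sub>R z"
    have "norm z > 0" using ne z_def by simp
    then have "y \<in> cball q e" unfolding y_def using e(1) by (simp add: dist_norm)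
    then have "piece S y - piece S q = piece T y - piece T q" using eq e(1) by simp
    then have "z \<bullet> (y - q) = 0"
      unfolding piece_def z_def by (simp add: inner_diff_left inner_diff_right)
    then show False using \<open>norm z > 0\<close> e(1) unfolding y_def by simp
  qed
  moreover have "offset S = offset T"
    using eq[of q] e(1) calculation unfolding piece_def by simp
  ultimately show False using piece_distinct[OF assms(1) T(1)] \<open>T \<noteq> S\<close> by blast
qed

lemma verts_subset: "S \<in> d_simplices \<Gamma> \<Longrightarrow> verts S \<subseteq> S"
  unfolding verts_def extreme_point_of_def by blast

text \<open>The intersection of two simplices is a face of both, and the extreme points of a face are the
  extreme points of the simplex that lie in it.\<close>

lemma vertex_in_other_simplex:
  assumes "S \<in> \<Gamma>" "T \<in> \<Gamma>" "v \<in> verts S" "v \<in> T"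
  shows "v \<in> verts T"
proof -
  have "v \<in> S" using assms(3) unfolding verts_def extreme_point_of_def by blast
  then have "v extreme_point_of (S \<inter> T)"
    using extreme_point_of_face[OF complex_facts(4)[OF assms(1,2)], of v] assms(3,4) unfolding verts_def by blast
  then show ?thesis
    using extreme_point_of_face[OF complex_facts(5)[OF assms(1,2)], of v] unfolding verts_def by blast
qed

end

section \<open>Adjacent simplices\<close>

context regular_triangulation_by
begin

text \<open>The barycentre $x$ of the facet opposite $v$ lies in $Q$, and so does the segment from $x$ to $p$, which
  immediately leaves $S$. The simplex that it enters contains the facet. Beyond the facet $h$
  exceeds the piece of $S$, and therefore so does the piece of the neighbour, all the way to $p$.\<close>

lemma neighbour_across_facet:
  assumes S: "S \<in> d_simplices \<Gamma>" and v: "v \<in> verts S" and p: "p \<in> convex hull A"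
    and neg: "bary (verts S) v p < 0"
  obtains T w where "T \<in> d_simplices \<Gamma>" "w \<notin> verts S" "verts T = insert w (verts S - {v})"
    "share_facet S T" "piece S p < piece T p"
proof -
  let ?V = "verts S" and ?G = "verts S - {v}"
  note V = d_simplex_verts(1)[OF S]
  have finV: "finite ?V" using spans_simplex_finite[OF V] .
  have cG: "card ?G = CARD('n)" using V v finV unfolding spans_simplex_def by simp
  then have Gne: "?G \<noteq> {}" by (metis card.empty zero_less_card_finite less_irrefl)
  obtain x where bx: "\<And>u. u \<in> ?V \<Longrightarrow> bary ?V u x = (if u = v then 0 else 1 / real CARD('n))"
    using facet_barycentre[OF V v] by blast
  have xS: "x \<in> S"
    using in_simplex_iff_bary_nonneg[OF V, of x] bx d_simplex_verts(2)[OF S] by auto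
  have SA: "S \<subseteq> convex hull A" using simplex_in_hull[OF d_simplices_subset[OF S]] .
  \<comment> \<open>Simplices that avoid \<open>x\<close> stay away from it, so a point slightly beyond \<open>x\<close> in the direction
    of \<open>p\<close> lies in a simplex that contains \<open>x\<close> as well.\<close>
  let ?C = "\<Union>{T \<in> d_simplices \<Gamma>. x \<notin> T}"
  have "closed ?C"
    using finite_d_simplices simplex_convex_compact(2) d_simplices_subset compact_imp_closed
    by (intro closed_Union) auto
  moreover have "x \<in> - ?C" by blast
  ultimately obtain e where e: "e > 0" "ball x e \<subseteq> - ?C"
    using openE[of "- ?C" x] by (auto simp: open_Compl)
  obtain t where t: "0 < t" "t < 1" and ball: "x + t *\<^sub>R (p - x) \<in> ball x e"
    using step_into_ball[OF e(1), of x p] by blast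
  define y where "y = x + t *\<^sub>R (p - x)"
  have "y \<in> ball x e" using ball y_def by simp
  moreover have "y \<in> convex hull A"
  proof -
    have "y = (1 - t) *\<^sub>R x + t *\<^sub>R p" by (simp add: y_def algebra_simps)
    then show ?thesis using convexD_alt[OF convex_convex_hull, of x A p t] xS SA p t by auto
  qed
  ultimately obtain T where T: "T \<in> d_simplices \<Gamma>" "y \<in> T" "x \<in> T"
    using d_simplices_cover[of y] e(2) by blast
  note W = d_simplex_verts(1)[OF T(1)]
  have by_neg: "bary ?V v y < 0"
    unfolding y_def bary_line using bx[OF v] neg t by (simp add: mult_pos_neg)
  then have yS: "y \<notin> S" using in_simplex_iff_bary_nonneg[OF V, of y] v d_simplex_verts(2)[OF S] by force
  then have ST: "S \<noteq> T" using T(2) by blast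
  have GT: "?G \<subseteq> verts T"
  proof
    fix u assume u: "u \<in> ?G"
    have "(S \<inter> T) face_of (convex hull ?V)"
      using complex_facts(4)[OF d_simplices_subset[OF S] d_simplices_subset[OF T(1)]]
        d_simplex_verts(2)[OF S] by simp
    then have "u \<in> S \<inter> T"
      using face_contains_supporting_vertex[OF V _ , of "S \<inter> T" x u] xS T(3) bx[of u] u by auto
    then show "u \<in> verts T"
      using vertex_in_other_simplex[OF d_simplices_subset[OF S] d_simplices_subset[OF T(1)]] u by blast
  qed
  have "card (verts T - ?G) = 1"
    using card_Diff_subset[OF _ GT] finV cG W unfolding spans_simplex_def by simp
  then obtain w where w: "verts T - ?G = {w}" by (auto simp: card_1_singleton_iff)
  then have VT: "verts T = insert w ?G" using GT by blast
  have "w \<noteq> v"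
  proof
    assume "w = v"
    then have "verts T = verts S" using VT v by auto
    then show False using verts_eq_iff[OF T(1) S] ST by blast
  qed
  then have wS: "w \<notin> verts S" using w by blast
  have "S = convex hull ?V" "T = convex hull (verts T)" using d_simplex_verts(2) S T(1) by auto
  moreover have "convex hull ?G facet_of (convex hull ?V)"
    using facet_of_convex_hull_affine_independent V v Gne unfolding spans_simplex_def by force
  moreover have "verts T - {w} = ?G" using VT w by blast
  then have "convex hull ?G facet_of (convex hull (verts T))"
    using facet_of_convex_hull_affine_independent[of "verts T" "convex hull ?G"] W VT Gne
    unfolding spans_simplex_def by (metis convex_hull_eq_empty insertI1)
  ultimately have "share_facet S T" unfolding share_facet_def using ST by auto
  moreover have "piece S p < piece T p"
  proof -
    have "piece S x = piece T x" using piece_eq[OF S xS] piece_eq[OF T(1,3)] by simp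
    moreover have "piece S y < piece T y"
      using piece_lt[OF S \<open>y \<in> convex hull A\<close> yS] piece_eq[OF T(1,2)] by simp
    ultimately show ?thesis using t unfolding y_def piece_line by simp
  qed
  ultimately show ?thesis using that[OF T(1) wS VT] by blast
qed

lemma share_facet_verts:
  assumes S: "S \<in> d_simplices \<Gamma>" and T: "T \<in> d_simplices \<Gamma>" and "share_facet S T"
  obtains v w where "v \<in> verts S" "w \<notin> verts S" "verts T = insert w (verts S - {v})"
proof -
  note V = d_simplex_verts[OF S] and W = d_simplex_verts[OF T]
  obtain F where F: "F facet_of S" "F facet_of T" and ST: "S \<noteq> T"
    using assms(3) unfolding share_facet_def by blast
  obtain v where v: "v \<in> verts S" "F = convex hull (verts S - {v})"
    using F(1) facet_of_convex_hull_affine_independent[of "verts S" F] V unfolding spans_simplex_def by auto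
  obtain w where w: "w \<in> verts T" "F = convex hull (verts T - {w})"
    using F(2) facet_of_convex_hull_affine_independent[of "verts T" F] W unfolding spans_simplex_def by auto
  have "\<not> affine_dependent (verts S - {v})" "\<not> affine_dependent (verts T - {w})"
    using V(1) W(1) affine_independent_Diff unfolding spans_simplex_def by blast+
  from this[THEN verts_convex_hull] have eq: "verts S - {v} = verts T - {w}"
    using v(2) w(2) by simp
  have "w \<notin> verts S"
  proof
    assume "w \<in> verts S"
    then have "w = v" using eq by blast
    then have "verts S = verts T" using eq v(1) w(1) by blast
    then show False using verts_eq_iff[OF S T] ST by blast
  qed
  moreover have "verts T = insert w (verts S - {v})" using eq w(1) by blast
  ultimately show ?thesis using that v(1) by blast
qed

text \<open>On the same side of the common facet, the two simplices would share points that are interior to \<open>S\<close>, whereas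
  their intersection is a proper face.\<close>

lemma opposite_sides:
  assumes S: "S \<in> d_simplices \<Gamma>" and T: "T \<in> d_simplices \<Gamma>"
    and v: "v \<in> verts S" and w: "w \<notin> verts S" and VT: "verts T = insert w (verts S - {v})"
  shows "bary (verts S) v w < 0"
proof (rule ccontr)
  assume "\<not> ?thesis"
  then have ge: "0 \<le> bary (verts S) v w" by simp
  note V = d_simplex_verts(1)[OF S] and W = d_simplex_verts(1)[OF T]
  have finV: "finite (verts S)" using spans_simplex_finite[OF V] .
  have pos: "0 < bary (verts S) v w"
  proof (rule ccontr)
    assume "\<not> ?thesis"
    then have z: "bary (verts S) v w = 0" using ge by simp
    have s: "(\<Sum>u\<in>verts S - {v}. bary (verts S) u w) = 1"
      "(\<Sum>u\<in>verts S - {v}. bary (verts S) u w *\<^sub>R u) = w"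
      using bary_coordinates[OF V, of w] z v finV by (simp_all add: sum.remove[OF finV v])
    then have "bary (verts T) w w = (\<Sum>u\<in>verts S - {v}. bary (verts S) u w * bary (verts T) w u)"
      using bary_affine_combination[OF s(1), of "verts T" w] by simp
    also have "\<dots> = 0"
      using bary_vertex[OF W, of _ w] VT w by (intro sum.neutral) auto
    finally show False using bary_vertex[OF W, of w w] VT by simp
  qed
  \<comment> \<open>Otherwise the barycentre of the common facet, moved slightly towards \<open>w\<close>, is interior to \<open>S\<close>.\<close>
  obtain x where xG: "x \<in> convex hull (verts S - {v})"
    and bx: "\<And>u. u \<in> verts S \<Longrightarrow> bary (verts S) u x = (if u = v then 0 else 1 / real CARD('n))"
    using facet_barycentre[OF V v] by blast
  have "\<forall>\<^sub>F t in at_right 0. \<forall>u\<in>verts S. 0 < (1 - t) * bary (verts S) u x + t * bary (verts S) u w"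
    using bx pos by (intro eventually_ball_finite[OF finV] ballI eventually_segment_pos) (auto split: if_splits)
  moreover have "\<forall>\<^sub>F t::real in at_right 0. t \<in> {0<..<1}"
    by (rule eventually_at_right_real) simp
  ultimately have "\<forall>\<^sub>F t in at_right 0. t \<in> {0<..<1} \<and>
      (\<forall>u\<in>verts S. 0 < (1 - t) * bary (verts S) u x + t * bary (verts S) u w)"
    by (rule eventually_conj[rotated])
  then have "\<exists>t. t \<in> {0<..<1} \<and>
      (\<forall>u\<in>verts S. 0 < (1 - t) * bary (verts S) u x + t * bary (verts S) u w)"
    by (rule eventually_happens'[OF trivial_limit_at_right_real])
  then obtain t where t: "0 < t" "t < 1"
    "\<And>u. u \<in> verts S \<Longrightarrow> 0 < (1 - t) * bary (verts S) u x + t * bary (verts S) u w"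
    by auto
  define y where "y = x + t *\<^sub>R (w - x)"
  have by_pos: "0 < bary (verts S) u y" if "u \<in> verts S" for u
    unfolding y_def bary_line using t(3)[OF that] .
  then have yS: "y \<in> S" using in_simplex_iff_bary_nonneg[OF V, of y] d_simplex_verts(2)[OF S] by force
  have "x \<in> T" using xG hull_mono[of "verts S - {v}" "verts T" convex] VT d_simplex_verts(2)[OF T] by blast
  moreover have "w \<in> T" using VT verts_subset[OF T] by blast
  moreover have "convex T" using simplex_convex_compact(1)[OF d_simplices_subset[OF T]] .
  moreover have "y = (1 - t) *\<^sub>R x + t *\<^sub>R w" by (simp add: y_def algebra_simps)
  ultimately have yT: "y \<in> T" using convexD_alt[of T x w t] t by auto
  have "(S \<inter> T) face_of (convex hull (verts S))"
    using complex_facts(4)[OF d_simplices_subset[OF S] d_simplices_subset[OF T]]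
      d_simplex_verts(2)[OF S] by simp
  then have "v \<in> S \<inter> T"
    using face_contains_supporting_vertex[OF V _ , of "S \<inter> T" y v] yS yT by_pos[OF v] v by auto
  then have "v \<in> verts T"
    using vertex_in_other_simplex[OF d_simplices_subset[OF S] d_simplices_subset[OF T] v] by blast
  then show False using VT v w by auto
qed

section \<open>A shelling\<close>

text \<open>Ties between two pieces occur only on hyperplanes.\<close>

lemma generic_point:
  obtains p where "p \<in> convex hull A"
    "\<And>S T. S \<in> d_simplices \<Gamma> \<Longrightarrow> T \<in> d_simplices \<Gamma> \<Longrightarrow> S \<noteq> T \<Longrightarrow> piece S p \<noteq> piece T p"
proof -
  let ?P = "{(S, T). S \<in> d_simplices \<Gamma> \<and> T \<in> d_simplices \<Gamma> \<and> S \<noteq> T}"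
  let ?H = "\<lambda>(S, T). {p. (slope S - slope T) \<bullet> p = offset T - offset S}"
  have "finite ?P"
    by (rule finite_subset[of _ "d_simplices \<Gamma> \<times> d_simplices \<Gamma>"]) (auto simp: finite_d_simplices)
  moreover have "negligible (?H z)" if "z \<in> ?P" for z
  proof -
    obtain S T where z: "z = (S, T)" by (cases z)
    then have "slope S - slope T \<noteq> 0 \<or> offset T - offset S \<noteq> 0"
      using piece_distinct[of S T] that by auto
    then show ?thesis unfolding z prod.case by (rule negligible_hyperplane)
  qed
  ultimately have "negligible (\<Union>(?H ` ?P))" by (intro negligible_Union) auto
  then have "\<not> interior (convex hull A) \<subseteq> \<Union>(?H ` ?P)"
    using open_not_negligible[OF open_interior hull_interior] negligible_subset by blast
  then obtain p where p: "p \<in> interior (convex hull A)" "p \<notin> \<Union>(?H ` ?P)" by blast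
  have "piece S p \<noteq> piece T p" if "S \<in> d_simplices \<Gamma>" "T \<in> d_simplices \<Gamma>" "S \<noteq> T" for S T
  proof
    assume "piece S p = piece T p"
    then have "p \<in> ?H (S, T)" by (simp add: piece_def inner_diff_left)
    moreover have "(S, T) \<in> ?P" using that by simp
    ultimately show False using p(2) by blast
  qed
  then show ?thesis using that p(1) interior_subset by blast
qed

text \<open>If $x$ lay in no facet that separates $S$ from $p$, a short step from $x$ towards $p$ would stay in $S$, where no other piece exceeds the piece of $S$; but the piece of $T$ starts with the same
  value at $x$ and is larger at $p$.\<close>

lemma visible_facet:
  assumes S: "S \<in> d_simplices \<Gamma>" and T: "T \<in> d_simplices \<Gamma>" and x: "x \<in> S" "x \<in> T"
    and less: "piece S p < piece T p"
  obtains u where "u \<in> verts S" "bary (verts S) u p < 0" "bary (verts S) u x = 0"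
proof -
  note V = d_simplex_verts(1)[OF S]
  have finV: "finite (verts S)" using spans_simplex_finite[OF V] .
  have "\<exists>u\<in>verts S. bary (verts S) u p < 0 \<and> bary (verts S) u x = 0"
  proof (rule ccontr)
    assume "\<not> ?thesis"
    then have nn: "0 \<le> bary (verts S) u p" if "u \<in> verts S" "bary (verts S) u x = 0" for u
      using that by force
    have xnn: "0 \<le> bary (verts S) u x" if "u \<in> verts S" for u
      using in_simplex_iff_bary_nonneg[OF V, of x] x(1) d_simplex_verts(2)[OF S] that by simp
    have "\<forall>\<^sub>F t in at_right 0. \<forall>u\<in>verts S. 0 \<le> (1 - t) * bary (verts S) u x + t * bary (verts S) u p"
    proof (rule eventually_ball_finite[OF finV], rule ballI)
      fix u assume u: "u \<in> verts S"
      show "\<forall>\<^sub>F t in at_right 0. 0 \<le> (1 - t) * bary (verts S) u x + t * bary (verts S) u p"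
      proof (cases "bary (verts S) u x = 0")
        case True
        have "\<forall>\<^sub>F t::real in at_right 0. 0 < t" by (rule eventually_at_right_less)
        then show ?thesis by eventually_elim (use nn[OF u True] True in simp)
      next
        case False
        then show ?thesis
          using eventually_segment_pos[OF xnn[OF u], of "bary (verts S) u p"]
          by (auto elim: eventually_mono)
      qed
    qed
    moreover have "\<forall>\<^sub>F t::real in at_right 0. 0 < t" by (rule eventually_at_right_less)
    ultimately have "\<forall>\<^sub>F t in at_right 0. 0 < t \<and>
        (\<forall>u\<in>verts S. 0 \<le> (1 - t) * bary (verts S) u x + t * bary (verts S) u p)"
      by (rule eventually_conj[rotated])
    then have "\<exists>t. 0 < t \<and>
        (\<forall>u\<in>verts S. 0 \<le> (1 - t) * bary (verts S) u x + t * bary (verts S) u p)"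
      by (rule eventually_happens'[OF trivial_limit_at_right_real])
    then obtain t :: real where t: "0 < t"
      "\<And>u. u \<in> verts S \<Longrightarrow> 0 \<le> (1 - t) * bary (verts S) u x + t * bary (verts S) u p"
      by blast
    let ?y = "x + t *\<^sub>R (p - x)"
    have yS: "?y \<in> S"
      using in_simplex_iff_bary_nonneg[OF V, of ?y] d_simplex_verts(2)[OF S] t(2) by (simp add: bary_line)
    then have "?y \<in> convex hull A" using simplex_in_hull[OF d_simplices_subset[OF S]] by blast
    then have "piece T ?y \<le> piece S ?y" using piece_le[OF T, of ?y] piece_eq[OF S yS] by simp
    moreover have "piece T x = piece S x" using piece_eq[OF S x(1)] piece_eq[OF T x(2)] by simp
    ultimately have "t * piece T p \<le> t * piece S p" unfolding piece_line by simp
    then show False using less t(1) by simp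
  qed
  then show ?thesis using that by blast
qed

end

section \<open>Balanced triangulations and the dual graph\<close>

definition colour_orientation :: "(real^'n \<Rightarrow> 'n option) \<Rightarrow> (real^'n) set \<Rightarrow> real" where
  "colour_orientation \<gamma> V = orientation (inv_into V \<gamma>)"

lemma colour_orientation_cong:
  assumes "\<And>v. v \<in> V \<Longrightarrow> \<gamma> v = \<gamma>' v"
  shows "colour_orientation \<gamma> V = colour_orientation \<gamma>' V"
proof -
  have "(y \<in> V \<and> \<gamma> y = x) = (y \<in> V \<and> \<gamma>' y = x)" for x y using assms by auto
  then have "inv_into V \<gamma> = inv_into V \<gamma>'" unfolding inv_into_def by simp
  then show ?thesis unfolding colour_orientation_def by simp
qed

lemma colouring_bij:
  fixes \<gamma> :: "real^'n \<Rightarrow> 'n::finite option"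
  assumes "spans_simplex V" "inj_on \<gamma> V"
  shows "bij_betw \<gamma> V UNIV"
proof -
  have "card (\<gamma> ` V) = card (UNIV :: 'n option set)"
    using assms unfolding spans_simplex_def by (simp add: card_image)
  then have "\<gamma> ` V = UNIV" by (intro card_subset_eq) auto
  then show ?thesis using assms(2) by (simp add: bij_betw_def)
qed

lemma colour_orientation_nonzero:
  fixes \<gamma> :: "real^'n \<Rightarrow> 'n::finite option"
  assumes "spans_simplex V" "inj_on \<gamma> V"
  shows "colour_orientation \<gamma> V \<noteq> 0"
  unfolding colour_orientation_def
  by (rule orientation_nonzero[OF assms(1) bij_betw_inv_into[OF colouring_bij[OF assms]]])

text \<open>With exactly $d+1$ colours, the vertices of a facet leave only one colour for the opposite vertex.\<close>

lemma colour_of_new_vertex: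
  fixes \<gamma> :: "real^'n \<Rightarrow> 'n::finite option"
  assumes V: "spans_simplex V" "inj_on \<gamma> V" and W: "inj_on \<gamma> (insert w (V - {v}))" and v: "v \<in> V" and w: "w \<notin> V"
  shows "\<gamma> w = \<gamma> v"
proof -
  obtain u where u: "u \<in> V" "\<gamma> w = \<gamma> u"
    using colouring_bij[OF V] unfolding bij_betw_def by (metis UNIV_I imageE)
  have "u = v"
  proof (rule ccontr)
    assume "u \<noteq> v"
    then have "w = u" using inj_onD[OF W u(2)] u(1) by blast
    then show False using w u(1) by blast
  qed
  then show ?thesis using u(2) by simp
qed

lemma colour_orientation_replace:
  fixes \<gamma> :: "real^'n \<Rightarrow> 'n::finite option"
  assumes V: "spans_simplex V" "inj_on \<gamma> V" and W: "inj_on \<gamma> (insert w (V - {v}))" and v: "v \<in> V" and w: "w \<notin> V"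
  shows "colour_orientation \<gamma> (insert w (V - {v})) = bary V v w * colour_orientation \<gamma> V"
proof -
  let ?f = "inv_into V \<gamma>"
  have gw: "\<gamma> w = \<gamma> v" using colour_of_new_vertex[OF assms] .
  have bij: "bij_betw \<gamma> V UNIV" using colouring_bij[OF V] .
  have "inv_into (insert w (V - {v})) \<gamma> = ?f(\<gamma> v := w)"
  proof
    fix c
    show "inv_into (insert w (V - {v})) \<gamma> c = (?f(\<gamma> v := w)) c"
    proof (cases "c = \<gamma> v")
      case True
      then show ?thesis using inv_into_f_f[OF W, of w] gw by simp
    next
      case False
      obtain u where u: "u \<in> V" "c = \<gamma> u"
        using bij unfolding bij_betw_def by (metis UNIV_I imageE)
      then have "u \<in> insert w (V - {v})" using False by blast
      then show ?thesis using inv_into_f_f[OF W, of u] inv_into_f_f[OF V(2) u(1)] u(2) False by simp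
    qed
  qed
  then show ?thesis
    using orientation_replace[OF V(1) bij_betw_inv_into[OF bij], of "\<gamma> v" w] inv_into_f_f[OF V(2) v]
    unfolding colour_orientation_def by simp
qed

lemma colour_orientation_swap:
  fixes \<gamma> :: "real^'n \<Rightarrow> 'n::finite option"
  assumes V: "spans_simplex V" "inj_on \<gamma> V" and v: "v \<in> V" "v' \<in> V" "v \<noteq> v'"
  shows "colour_orientation (\<gamma>(v := \<gamma> v', v' := \<gamma> v)) V = - colour_orientation \<gamma> V"
proof -
  let ?f = "inv_into V \<gamma>" and ?\<gamma>' = "\<gamma>(v := \<gamma> v', v' := \<gamma> v)"
  have inj': "inj_on ?\<gamma>' V"
    using V(2) v unfolding inj_on_def by (auto split: if_splits)
  have bij: "bij_betw \<gamma> V UNIV" using colouring_bij[OF V] .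
  have ne: "\<gamma> v \<noteq> \<gamma> v'" using inj_onD[OF V(2)] v by blast
  have "inv_into V ?\<gamma>' = ?f(\<gamma> v := ?f (\<gamma> v'), \<gamma> v' := ?f (\<gamma> v))"
  proof
    fix c
    obtain u where u: "u \<in> V" "c = ?\<gamma>' u"
      using colouring_bij[OF V(1) inj'] unfolding bij_betw_def by (metis UNIV_I imageE)
    then have "inv_into V ?\<gamma>' c = u" using inv_into_f_f[OF inj' u(1)] by simp
    moreover have "(?f(\<gamma> v := ?f (\<gamma> v'), \<gamma> v' := ?f (\<gamma> v))) c = u"
    proof (cases "u = v \<or> u = v'")
      case True
      then show ?thesis using u ne v inv_into_f_f[OF V(2)] by auto
    next
      case False
      then have c: "c = \<gamma> u" using u(2) by simp
      then have "c \<noteq> \<gamma> v" "c \<noteq> \<gamma> v'" using False inj_onD[OF V(2)] u(1) v by blast+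
      then show ?thesis using c inv_into_f_f[OF V(2) u(1)] by simp
    qed
    ultimately show "inv_into V ?\<gamma>' c = (?f(\<gamma> v := ?f (\<gamma> v'), \<gamma> v' := ?f (\<gamma> v))) c" by simp
  qed
  then show ?thesis
    using orientation_swap[OF ne, of ?f] unfolding colour_orientation_def by simp
qed

lemma inj_on_transfer_colour:
  assumes "inj_on \<gamma> (insert w (V - {v}))" "w \<notin> V"
  shows "inj_on (\<gamma>(v := \<gamma> w)) V"
proof (rule inj_onI)
  fix x y assume xy: "x \<in> V" "y \<in> V" "(\<gamma>(v := \<gamma> w)) x = (\<gamma>(v := \<gamma> w)) y"
  let ?r = "\<lambda>x. if x = v then w else x"
  have "\<gamma> (?r x) = \<gamma> (?r y)" using xy(3) by auto
  moreover have "?r x \<in> insert w (V - {v})" "?r y \<in> insert w (V - {v})" using xy by auto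
  ultimately have "?r x = ?r y" by (rule inj_onD[OF assms(1)])
  then show "x = y" using xy(1,2) assms(2) by (auto split: if_splits)
qed

context regular_triangulation_by
begin

text \<open>Two vertices of a $d$-simplex span an edge of the triangulation, and every edge is a face of a
  $d$-simplex; being balanced thus means that the colours of each $d$-simplex are distinct.\<close>

lemma balanced_iff_colouring:
  "balanced A \<Gamma> \<longleftrightarrow> (\<exists>\<gamma> :: real^'n \<Rightarrow> 'n option. \<forall>S\<in>d_simplices \<Gamma>. inj_on \<gamma> (verts S))"
proof
  have "card {1..CARD('n) + 1} = card (UNIV :: 'n option set)" by simp
  then obtain e :: "nat \<Rightarrow> 'n option" where e: "bij_betw e {1..CARD('n) + 1} UNIV"
    using finite_same_card_bij[of "{1..CARD('n) + 1}" "UNIV :: 'n option set"] by auto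
  {
    assume "balanced A \<Gamma>"
    then obtain \<gamma> :: "real^'n \<Rightarrow> nat" where \<gamma>: "\<gamma> ` A \<subseteq> {1..CARD('n) + 1}"
      "\<And>a a'. a \<in> A \<Longrightarrow> a' \<in> A \<Longrightarrow> a \<noteq> a' \<Longrightarrow> convex hull {a, a'} \<in> \<Gamma> \<Longrightarrow> \<gamma> a \<noteq> \<gamma> a'"
      unfolding balanced_def by blast
    have "inj_on (e \<circ> \<gamma>) (verts S)" if S: "S \<in> d_simplices \<Gamma>" for S
    proof (rule comp_inj_on)
      show "inj_on \<gamma> (verts S)"
      proof (rule inj_onI, rule ccontr)
        fix a a' assume a: "a \<in> verts S" "a' \<in> verts S" "\<gamma> a = \<gamma> a'" "a \<noteq> a'"
        have "\<not> affine_dependent (verts S)" using d_simplex_verts(1)[OF S] spans_simplex_def by blast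
        then have "convex hull {a, a'} face_of (convex hull verts S)"
          unfolding face_of_convex_hull_affine_independent[OF \<open>\<not> affine_dependent (verts S)\<close>]
          using a(1,2) by (intro exI[of _ "{a, a'}"]) simp
        then have "convex hull {a, a'} \<in> \<Gamma>"
          using complex_facts(3)[OF d_simplices_subset[OF S]] d_simplex_verts(2)[OF S] by simp
        then show False using \<gamma>(2)[of a a'] a d_simplex_verts(3)[OF S] by blast
      qed
      have "\<gamma> ` verts S \<subseteq> {1..CARD('n) + 1}" using \<gamma>(1) d_simplex_verts(3)[OF S] by blast
      then show "inj_on e (\<gamma> ` verts S)" using e inj_on_subset unfolding bij_betw_def by blast
    qed
    then show "\<exists>\<gamma> :: real^'n \<Rightarrow> 'n option. \<forall>S\<in>d_simplices \<Gamma>. inj_on \<gamma> (verts S)" by blast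
  }
  {
    assume "\<exists>\<gamma> :: real^'n \<Rightarrow> 'n option. \<forall>S\<in>d_simplices \<Gamma>. inj_on \<gamma> (verts S)"
    then obtain \<gamma> :: "real^'n \<Rightarrow> 'n option" where \<gamma>: "\<And>S. S \<in> d_simplices \<Gamma> \<Longrightarrow> inj_on \<gamma> (verts S)" by blast
    let ?\<delta> = "inv_into {1..CARD('n) + 1} e \<circ> \<gamma>"
    have be: "bij_betw (inv_into {1..CARD('n) + 1} e) UNIV {1..CARD('n) + 1}" using bij_betw_inv_into[OF e] .
    show "balanced A \<Gamma>"
      unfolding balanced_def
    proof (intro exI[of _ ?\<delta>] conjI ballI impI)
      show "?\<delta> ` A \<subseteq> {1..CARD('n) + 1}" using be unfolding bij_betw_def by fastforce
    next
      fix a a' assume a: "a \<in> A" "a' \<in> A" "a \<noteq> a' \<and> convex hull {a, a'} \<in> \<Gamma>"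
      then obtain T where T: "T \<in> d_simplices \<Gamma>" "convex hull {a, a'} face_of T"
        using face_of_d_simplex[of "convex hull {a, a'}"] by auto
      have "a extreme_point_of (convex hull {a, a'})" "a' extreme_point_of (convex hull {a, a'})"
        using extreme_point_of_convex_hull_affine_independent[OF affine_independent_2] by blast+
      then have "a \<in> verts T" "a' \<in> verts T"
        using extreme_point_of_face[OF T(2)] unfolding verts_def by blast+
      then have "\<gamma> a \<noteq> \<gamma> a'" using inj_onD[OF \<gamma>[OF T(1)]] a(3) by blast
      then show "?\<delta> a \<noteq> ?\<delta> a'" using be unfolding bij_betw_def by (auto dest: injD)
    qed
  }
qed

lemma balanced_imp_bipartite:
  assumes "balanced A \<Gamma>"
  shows "dual_graph_bipartite \<Gamma>"
proof -
  obtain \<gamma> :: "real^'n \<Rightarrow> 'n option" where \<gamma>: "\<And>S. S \<in> d_simplices \<Gamma> \<Longrightarrow> inj_on \<gamma> (verts S)"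
    using assms balanced_iff_colouring by blast
  let ?o = "\<lambda>S. colour_orientation \<gamma> (verts S)"
  have nz: "?o S \<noteq> 0" if "S \<in> d_simplices \<Gamma>" for S
    using colour_orientation_nonzero[OF d_simplex_verts(1)[OF that] \<gamma>[OF that]] .
  have flip: "?o T * ?o S < 0" if S: "S \<in> d_simplices \<Gamma>" and T: "T \<in> d_simplices \<Gamma>" and "share_facet S T" for S T
  proof -
    obtain v w where vw: "v \<in> verts S" "w \<notin> verts S" "verts T = insert w (verts S - {v})"
      using share_facet_verts[OF S T \<open>share_facet S T\<close>] .
    have "?o T = bary (verts S) v w * ?o S"
      using colour_orientation_replace[OF d_simplex_verts(1)[OF S] \<gamma>[OF S] _ vw(1,2)] \<gamma>[OF T] vw(3) by simp
    then have "?o T * ?o S = bary (verts S) v w * (?o S * ?o S)" by simp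
    also have "\<dots> < 0"
      using opposite_sides[OF S T vw] nz[OF S] by (intro mult_neg_pos) (auto simp: zero_less_mult_iff)
    finally show ?thesis .
  qed
  show ?thesis
    unfolding dual_graph_bipartite_def bipartite_graph_def
  proof (intro exI conjI ballI impI)
    show "{S \<in> d_simplices \<Gamma>. 0 < ?o S} \<union> {S \<in> d_simplices \<Gamma>. ?o S < 0} = d_simplices \<Gamma>"
      using nz by force
    show "{S \<in> d_simplices \<Gamma>. 0 < ?o S} \<inter> {S \<in> d_simplices \<Gamma>. ?o S < 0} = {}" by auto
    fix S T assume ST: "S \<in> d_simplices \<Gamma>" "T \<in> d_simplices \<Gamma>" "share_facet S T"
    show "S \<in> {S \<in> d_simplices \<Gamma>. 0 < ?o S} \<and> T \<in> {S \<in> d_simplices \<Gamma>. ?o S < 0} \<or>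
          S \<in> {S \<in> d_simplices \<Gamma>. ?o S < 0} \<and> T \<in> {S \<in> d_simplices \<Gamma>. 0 < ?o S}"
      using flip[OF ST] ST by (auto simp: mult_less_0_iff)
  qed
qed

text \<open>The hypothesis on \<open>U\<close> says that it is an initial segment of the shelling order. The sign \<open>\<sigma>\<close>
  absorbs the choice of the colouring of the first simplex.\<close>

lemma colouring_by_shelling:
  assumes p: "p \<in> convex hull A"
    and generic: "\<And>S T. S \<in> d_simplices \<Gamma> \<Longrightarrow> T \<in> d_simplices \<Gamma> \<Longrightarrow> S \<noteq> T \<Longrightarrow> piece S p \<noteq> piece T p"
    and side: "\<And>S. side S = 1 \<or> side S = (-1 :: real)"
    and alt: "\<And>S T. S \<in> d_simplices \<Gamma> \<Longrightarrow> T \<in> d_simplices \<Gamma> \<Longrightarrow> share_facet S T \<Longrightarrow> side T = - side S"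
    and "U \<subseteq> d_simplices \<Gamma>"
    and "\<And>S T. S \<in> U \<Longrightarrow> T \<in> d_simplices \<Gamma> \<Longrightarrow> piece S p < piece T p \<Longrightarrow> T \<in> U"
  shows "\<exists>(\<gamma> :: real^'n \<Rightarrow> 'n option) \<sigma>. \<forall>S\<in>U. inj_on \<gamma> (verts S) \<and> 0 < \<sigma> * side S * colour_orientation \<gamma> (verts S)"
  using assms(5,6)
proof (induction "card U" arbitrary: U)
  case 0
  then have "U = {}" using finite_d_simplices finite_subset card_0_eq by metis
  then show ?case by simp
next
  case (Suc k)
  have finU: "finite U" using Suc.prems(1) finite_d_simplices finite_subset by blast
  have "U \<noteq> {}" using Suc.hyps(2) by auto
  define S where "S = arg_min_on (\<lambda>S. piece S p) U"
  have SU: "S \<in> U" unfolding S_def using arg_min_if_finite(1)[OF finU \<open>U \<noteq> {}\<close>] .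
  have Smin: "piece S p \<le> piece T p" if "T \<in> U" for T
    unfolding S_def using arg_min_least[OF finU \<open>U \<noteq> {}\<close> that] .
  have S: "S \<in> d_simplices \<Gamma>" using SU Suc.prems(1) by blast
  note V = d_simplex_verts(1)[OF S]
  let ?U = "U - {S}"
  have less: "piece S p < piece T p" if "T \<in> ?U" for T
    using Smin[of T] generic[of S T] that S Suc.prems(1) by force
  have up: "T \<in> ?U" if "T \<in> d_simplices \<Gamma>" "piece S p < piece T p" for T
    using Suc.prems(2)[OF SU that] that(2) by auto
  have k: "k = card ?U" using Suc.hyps(2) SU finU by simp
  have sub: "?U \<subseteq> d_simplices \<Gamma>" using Suc.prems(1) by blast
  have closed_up: "T' \<in> ?U" if "T \<in> ?U" "T' \<in> d_simplices \<Gamma>" "piece T p < piece T' p" for T T'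
    using up[OF that(2)] less[OF that(1)] that(3) by simp
  have "\<exists>(\<gamma> :: real^'n \<Rightarrow> 'n option) \<sigma>.
      \<forall>T\<in>?U. inj_on \<gamma> (verts T) \<and> 0 < \<sigma> * side T * colour_orientation \<gamma> (verts T)"
    by (rule Suc.hyps(1)[OF k sub]) (rule closed_up)
  then obtain \<gamma> :: "real^'n \<Rightarrow> 'n option" and \<sigma> where
    "\<forall>T\<in>?U. inj_on \<gamma> (verts T) \<and> 0 < \<sigma> * side T * colour_orientation \<gamma> (verts T)"
    by (elim exE)
  then have inj: "\<And>T. T \<in> ?U \<Longrightarrow> inj_on \<gamma> (verts T)" and
    sgn: "\<And>T. T \<in> ?U \<Longrightarrow> 0 < \<sigma> * side T * colour_orientation \<gamma> (verts T)"
    by blast+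
  show ?case
  proof (cases "?U = {}")
    case True
    have "card (verts S) = card (UNIV :: 'n option set)" using V unfolding spans_simplex_def by simp
    then obtain \<delta> :: "real^'n \<Rightarrow> 'n option" where "bij_betw \<delta> (verts S) UNIV"
      using finite_same_card_bij[OF spans_simplex_finite[OF V]] by (metis finite)
    then have inj\<delta>: "inj_on \<delta> (verts S)" by (rule bij_betw_imp_inj_on)
    let ?c = "side S * colour_orientation \<delta> (verts S)"
    have "?c \<noteq> 0" using colour_orientation_nonzero[OF V inj\<delta>] side[of S] by auto
    then have "0 < ?c * ?c" using not_real_square_gt_zero by blast
    then have "0 < ?c * side S * colour_orientation \<delta> (verts S)" by (simp only: mult.assoc)
    moreover have "U = {S}" using True SU by blast
    ultimately show ?thesis using inj\<delta> by blast
  next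
    case False
    have "p \<notin> S"
    proof
      assume "p \<in> S"
      obtain T where T: "T \<in> ?U" using False by blast
      then have "T \<in> d_simplices \<Gamma>" using Suc.prems(1) by blast
      then have "piece T p \<le> piece S p" using piece_le[OF _ p, of T] piece_eq[OF S \<open>p \<in> S\<close>] by simp
      then show False using less[OF T] by simp
    qed
    then obtain v1 where v1: "v1 \<in> verts S" "bary (verts S) v1 p < 0"
      using in_simplex_iff_bary_nonneg[OF V, of p] d_simplex_verts(2)[OF S] by force
    obtain T1 w1 where T1: "T1 \<in> d_simplices \<Gamma>" "w1 \<notin> verts S" "verts T1 = insert w1 (verts S - {v1})"
      "share_facet S T1" "piece S p < piece T1 p"
      using neighbour_across_facet[OF S v1(1) p v1(2)] .
    have T1U: "T1 \<in> ?U" using up T1 by blast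
    define \<gamma>1 where "\<gamma>1 = \<gamma>(v1 := \<gamma> w1)"
    have inj1: "inj_on \<gamma>1 (verts S)"
      unfolding \<gamma>1_def using inj_on_transfer_colour inj[OF T1U] T1(2,3) by metis
    have rep: "colour_orientation \<gamma> (verts T) = bary (verts S) v w * colour_orientation (\<gamma>(v := \<gamma> w)) (verts S)"
      "bary (verts S) v w < 0"
      if T: "T \<in> ?U" "w \<notin> verts S" "verts T = insert w (verts S - {v})" "v \<in> verts S" for T v w
    proof -
      have "T \<in> d_simplices \<Gamma>" using T(1) Suc.prems(1) by blast
      then show "bary (verts S) v w < 0" using opposite_sides[OF S _ T(4,2,3)] by blast
      have "v \<notin> verts T" using T(2-4) by auto
      then have agree: "\<gamma> u = (\<gamma>(v := \<gamma> w)) u" if "u \<in> verts T" for u using that by auto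
      have injT: "inj_on \<gamma> (insert w (verts S - {v}))" using inj[OF T(1)] T(3) by simp
      then have "inj_on (\<gamma>(v := \<gamma> w)) (insert w (verts S - {v}))"
        using inj_on_cong[of "verts T" \<gamma> "\<gamma>(v := \<gamma> w)", OF agree] inj[OF T(1)] T(3) by simp
      from colour_orientation_replace[OF V inj_on_transfer_colour[OF injT T(2)] this T(4,2)]
      show "colour_orientation \<gamma> (verts T) = bary (verts S) v w * colour_orientation (\<gamma>(v := \<gamma> w)) (verts S)"
        using colour_orientation_cong[of "verts T" \<gamma> "\<gamma>(v := \<gamma> w)", OF agree] T(3) by simp
    qed
    \<comment> \<open>If \<open>v1\<close> is coloured already, some other visible facet, opposite \<open>v2\<close>, contains it. A wrong colour
      of \<open>v1\<close> can only be that of \<open>v2\<close>. Then the neighbours \<open>T1\<close> and \<open>T2\<close> across the two facets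
      induce colourings of \<open>S\<close> that differ by a transposition, so the orientations of \<open>T1\<close>
      and \<open>T2\<close> are opposite although both are on the other side of the bipartition than \<open>S\<close>.\<close>
    have consistent: "\<gamma> v1 = \<gamma> w1" if T0: "T0 \<in> ?U" "v1 \<in> verts T0" for T0
    proof (rule ccontr)
      assume ne: "\<gamma> v1 \<noteq> \<gamma> w1"
      have T0D: "T0 \<in> d_simplices \<Gamma>" using T0(1) Suc.prems(1) by blast
      have "v1 \<in> S" "v1 \<in> T0" using verts_subset S T0D v1(1) T0(2) by blast+
      then obtain v2 where v2: "v2 \<in> verts S" "bary (verts S) v2 p < 0" "bary (verts S) v2 v1 = 0"
        using visible_facet[OF S T0D _ _ less[OF T0(1)]] by blast
      have v12: "v1 \<noteq> v2" using v2(3) bary_vertex[OF V v1(1), of v2] by auto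
      obtain T2 w2 where T2: "T2 \<in> d_simplices \<Gamma>" "w2 \<notin> verts S" "verts T2 = insert w2 (verts S - {v2})"
        "share_facet S T2" "piece S p < piece T2 p"
        using neighbour_across_facet[OF S v2(1) p v2(2)] .
      have T2U: "T2 \<in> ?U" using up T2 by blast
      note V1 = d_simplex_verts(1)[OF T1(1)] and V2 = d_simplex_verts(1)[OF T2(1)]
      have c1: "\<gamma> v1 = \<gamma> v2"
      proof -
        obtain u where u: "u \<in> verts T1" "\<gamma> v1 = \<gamma> u"
          using colouring_bij[OF V1 inj[OF T1U]] unfolding bij_betw_def by (metis UNIV_I imageE)
        have "u = v2"
        proof (rule ccontr)
          assume "u \<noteq> v2"
          moreover have "u \<noteq> w1" using u(2) ne by auto
          ultimately have "u \<in> verts T2" "v1 \<in> verts T2" "u \<noteq> v1" using u(1) T1(3) T2(3) v1(1) v12 by auto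
          then show False using inj_onD[OF inj[OF T2U] u(2)] by blast
        qed
        then show ?thesis using u(2) by simp
      qed
      have c2: "\<gamma> w2 = \<gamma> w1"
      proof -
        obtain u where u: "u \<in> verts T2" "\<gamma> w1 = \<gamma> u"
          using colouring_bij[OF V2 inj[OF T2U]] unfolding bij_betw_def by (metis UNIV_I imageE)
        have "u = w2"
        proof (rule ccontr)
          assume "u \<noteq> w2"
          moreover have "u \<noteq> v1" using u(2) ne by auto
          ultimately have "u \<in> verts T1" "w1 \<in> verts T1" "u \<noteq> w1" using u(1) T1(2,3) T2(3) by auto
          then show False using inj_onD[OF inj[OF T1U] u(2)] by blast
        qed
        then show ?thesis using u(2) by simp
      qed
      have "\<gamma>(v2 := \<gamma> w2) = \<gamma>1(v1 := \<gamma>1 v2, v2 := \<gamma>1 v1)"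
        unfolding \<gamma>1_def using c1 c2 v12 by (auto simp: fun_eq_iff)
      then have sw: "colour_orientation (\<gamma>(v2 := \<gamma> w2)) (verts S) = - colour_orientation \<gamma>1 (verts S)"
        using colour_orientation_swap[OF V inj1 v1(1) v2(1) v12] by simp
      let ?o = "colour_orientation \<gamma>1 (verts S)"
      let ?b1 = "bary (verts S) v1 w1" and ?b2 = "bary (verts S) v2 w2"
      have b: "?b1 < 0" "?b2 < 0" using rep(2)[OF T1U T1(2,3) v1(1)] rep(2)[OF T2U T2(2,3) v2(1)] by auto
      have s1: "0 < (\<sigma> * side T1) * (?b1 * ?o)"
        using sgn[OF T1U] rep(1)[OF T1U T1(2,3) v1(1)] unfolding \<gamma>1_def by simp
      have s2: "0 < (\<sigma> * side T1) * (?b2 * - ?o)"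
        using sgn[OF T2U] rep(1)[OF T2U T2(2,3) v2(1)] sw alt[OF S T1(1,4)] alt[OF S T2(1,4)] by simp
      show False using s1 s2 b by (auto simp: zero_less_mult_iff mult_less_0_iff)
    qed
    have agree: "\<gamma> u = \<gamma>1 u" if "T \<in> ?U" "u \<in> verts T" for T u
      unfolding \<gamma>1_def using consistent that by auto
    have "inj_on \<gamma>1 (verts T) \<and> 0 < \<sigma> * side T * colour_orientation \<gamma>1 (verts T)" if T: "T \<in> ?U" for T
      using inj[OF T] sgn[OF T] colour_orientation_cong[of "verts T" \<gamma> \<gamma>1, OF agree[OF T]]
        inj_on_cong[of "verts T" \<gamma> \<gamma>1, OF agree[OF T]] by simp
    moreover have "0 < \<sigma> * side S * colour_orientation \<gamma>1 (verts S)"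
    proof -
      let ?b1 = "bary (verts S) v1 w1"
      have "0 < \<sigma> * side T1 * (?b1 * colour_orientation \<gamma>1 (verts S))"
        using sgn[OF T1U] rep(1)[OF T1U T1(2,3) v1(1)] unfolding \<gamma>1_def by simp
      then have "0 < (- ?b1) * (\<sigma> * side S * colour_orientation \<gamma>1 (verts S))"
        using alt[OF S T1(1,4)] by (simp add: mult_ac)
      then show ?thesis using rep(2)[OF T1U T1(2,3) v1(1)] by (simp only: zero_less_mult_pos neg_0_less_iff_less)
    qed
    ultimately show ?thesis using inj1 by (intro exI[of _ \<gamma>1] exI[of _ \<sigma>]) auto
  qed
qed

lemma bipartite_imp_balanced:
  assumes "dual_graph_bipartite \<Gamma>"
  shows "balanced A \<Gamma>"
proof -
  obtain V1 V2 where V: "V1 \<union> V2 = d_simplices \<Gamma>" "V1 \<inter> V2 = {}"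
    "\<And>S T. S \<in> d_simplices \<Gamma> \<Longrightarrow> T \<in> d_simplices \<Gamma> \<Longrightarrow> share_facet S T \<Longrightarrow>
      (S \<in> V1 \<and> T \<in> V2) \<or> (S \<in> V2 \<and> T \<in> V1)"
    using assms unfolding dual_graph_bipartite_def bipartite_graph_def by blast
  define side :: "(real^'n) set \<Rightarrow> real" where "side S = (if S \<in> V1 then 1 else -1)" for S
  obtain p where p: "p \<in> convex hull A"
    "\<And>S T. S \<in> d_simplices \<Gamma> \<Longrightarrow> T \<in> d_simplices \<Gamma> \<Longrightarrow> S \<noteq> T \<Longrightarrow> piece S p \<noteq> piece T p"
    using generic_point by blast
  have "\<exists>(\<gamma> :: real^'n \<Rightarrow> 'n option) \<sigma>. \<forall>S\<in>d_simplices \<Gamma>. inj_on \<gamma> (verts S) \<and> 0 < \<sigma> * side S * colour_orientation \<gamma> (verts S)"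
  proof (rule colouring_by_shelling[OF p])
    show "side S = 1 \<or> side S = -1" for S by (simp add: side_def)
    show "side T = - side S" if "S \<in> d_simplices \<Gamma>" "T \<in> d_simplices \<Gamma>" "share_facet S T" for S T
      using V(3)[OF that] V(2) by (auto simp: side_def)
  qed auto
  then show ?thesis using balanced_iff_colouring by blast
qed

end

section \<open>Exponential sums with complex arguments\<close>

definition cdot :: "real^'n \<Rightarrow> complex^'n \<Rightarrow> complex" where
  "cdot a z = (\<Sum>k\<in>UNIV. of_real (a $ k) * z $ k)"

definition cvec :: "real^'n \<Rightarrow> complex^'n" where
  "cvec x = (\<chi> k. of_real (x $ k))"

definition Re_vec :: "complex^'n \<Rightarrow> real^'n" where
  "Re_vec z = (\<chi> k. Re (z $ k))"

definition cnj_vec :: "complex^'n \<Rightarrow> complex^'n" where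
  "cnj_vec z = (\<chi> k. cnj (z $ k))"

lemma cdot_add_right: "cdot a (z + w) = cdot a z + cdot a w"
  by (simp add: cdot_def distrib_left sum.distrib)

lemma cdot_diff_right: "cdot a (z - w) = cdot a z - cdot a w"
  by (simp add: cdot_def right_diff_distrib sum_subtractf)

lemma cdot_diff_left: "cdot (a - b) z = cdot a z - cdot b z"
  by (simp add: cdot_def left_diff_distrib sum_subtractf)

lemma cdot_cvec: "cdot a (cvec x) = of_real (a \<bullet> x)"
  by (simp add: cdot_def cvec_def inner_vec_def)

lemma Re_cdot: "Re (cdot a z) = a \<bullet> Re_vec z"
  by (simp add: cdot_def Re_vec_def inner_vec_def)

lemma cdot_cnj: "cdot a (cnj_vec z) = cnj (cdot a z)"
  by (simp add: cdot_def cnj_vec_def)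

lemma cvec_add: "cvec (x + y) = cvec x + cvec y"
  by (simp add: cvec_def vec_eq_iff)

lemma cvec_diff: "cvec (x - y) = cvec x - cvec y"
  by (simp add: cvec_def vec_eq_iff)

lemma cvec_eq_iff: "cvec x = cvec y \<longleftrightarrow> x = y"
  by (simp add: cvec_def vec_eq_iff)

lemma cnj_vec_cvec: "cnj_vec (cvec x) = cvec x"
  by (simp add: cvec_def cnj_vec_def vec_eq_iff)

lemma cnj_vec_add: "cnj_vec (z + w) = cnj_vec z + cnj_vec w"
  by (simp add: cnj_vec_def vec_eq_iff)

lemma norm_cnj_vec: "norm (cnj_vec z) = norm z"
  by (simp add: norm_vec_def cnj_vec_def L2_set_def)

lemma norm_cvec: "norm (cvec x) = norm x"
  by (simp add: norm_vec_def cvec_def L2_set_def)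

lemma norm_cdot_le: "norm (cdot a z) \<le> (\<Sum>k\<in>UNIV. \<bar>a $ k\<bar>) * norm z"
proof -
  have "norm (cdot a z) \<le> (\<Sum>k\<in>UNIV. norm (of_real (a $ k) * z $ k))"
    unfolding cdot_def by (rule norm_sum)
  also have "\<dots> \<le> (\<Sum>k\<in>UNIV. \<bar>a $ k\<bar> * norm z)"
    by (intro sum_mono) (auto simp: norm_mult intro!: mult_left_mono Finite_Cartesian_Product.norm_nth_le)
  finally show ?thesis by (simp add: sum_distrib_right)
qed

text \<open>The norm of a vector is at most this constant times the largest modulus of its products with the edges
  of the simplex at one vertex.\<close>

definition grad_bound :: "(real^'n) set \<Rightarrow> real" where
  "grad_bound V = (\<Sum>k\<in>UNIV. \<Sum>v\<in>V. \<bar>bary_grad V v $ k\<bar>)"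

lemma grad_bound_nonneg: "0 \<le> grad_bound V"
  unfolding grad_bound_def by (intro sum_nonneg) auto

lemma cdot_edges_expansion:
  assumes "spans_simplex V"
  shows "(\<Sum>v\<in>V. cdot (v - v0) z * of_real (bary_grad V v $ k)) = z $ k"
proof -
  have "(\<Sum>v\<in>V. cdot (v - v0) z * of_real (bary_grad V v $ k)) =
      (\<Sum>v\<in>V. \<Sum>j\<in>UNIV. of_real ((v - v0) $ j * bary_grad V v $ k) * z $ j)"
    unfolding cdot_def sum_distrib_right by (intro sum.cong refl) simp
  also have "\<dots> = (\<Sum>j\<in>UNIV. of_real (\<Sum>v\<in>V. (v - v0) $ j * bary_grad V v $ k) * z $ j)"
    by (simp only: of_real_sum sum_distrib_right) (rule sum.swap)
  also have "\<dots> = (\<Sum>j\<in>UNIV. of_real (of_bool (j = k)) * z $ j)"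
  proof (rule sum.cong[OF refl])
    fix j
    have "(\<Sum>v\<in>V. (v - v0) $ j * bary_grad V v $ k) =
        (\<Sum>v\<in>V. (v \<bullet> axis j 1) *\<^sub>R bary_grad V v) $ k - v0 $ j * (\<Sum>v\<in>V. bary_grad V v) $ k"
      by (simp only: sum_component vector_minus_component vector_scaleR_component inner_axis
          left_diff_distrib sum_subtractf sum_distrib_left) simp
    also have "\<dots> = of_bool (j = k)"
      using bary_grad_expansion[OF assms] bary_grad_sum[OF assms] by (simp add: axis_def)
    finally show "of_real (\<Sum>v\<in>V. (v - v0) $ j * bary_grad V v $ k) * z $ j = of_real (of_bool (j = k)) * z $ j"
      by simp
  qed
  also have "\<dots> = (\<Sum>j\<in>UNIV. if j = k then z $ j else 0)"
    by (rule sum.cong) auto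
  also have "\<dots> = z $ k" by simp
  finally show ?thesis .
qed

lemma norm_le_grad_bound:
  assumes "\<And>k. z $ k = (\<Sum>v\<in>V. \<theta> v * of_real (bary_grad V v $ k))"
    and "\<And>v. v \<in> V \<Longrightarrow> norm (\<theta> v) \<le> m"
  shows "norm (z :: complex^'n) \<le> grad_bound V * m"
proof -
  have "norm z \<le> (\<Sum>k\<in>UNIV. norm (z $ k))"
    unfolding norm_vec_def by (rule L2_set_le_sum) auto
  also have "\<dots> \<le> (\<Sum>k\<in>UNIV. \<Sum>v\<in>V. m * \<bar>bary_grad V v $ k\<bar>)"
  proof (rule sum_mono)
    fix k
    have "norm (z $ k) \<le> (\<Sum>v\<in>V. norm (\<theta> v * of_real (bary_grad V v $ k)))"
      unfolding assms(1) by (rule norm_sum)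
    also have "\<dots> \<le> (\<Sum>v\<in>V. m * \<bar>bary_grad V v $ k\<bar>)"
      using assms(2) by (intro sum_mono) (auto simp: norm_mult intro!: mult_right_mono)
    finally show "norm (z $ k) \<le> (\<Sum>v\<in>V. m * \<bar>bary_grad V v $ k\<bar>)" .
  qed
  also have "\<dots> = grad_bound V * m"
    unfolding grad_bound_def by (simp add: sum_distrib_left sum_distrib_right mult.commute)
  finally show ?thesis .
qed

lemma norm_le_cdot_edges:
  assumes "spans_simplex V" "\<And>v. v \<in> V \<Longrightarrow> norm (cdot (v - v0) z) \<le> m"
  shows "norm z \<le> grad_bound V * m"
  using norm_le_grad_bound[OF cdot_edges_expansion[OF assms(1), symmetric] assms(2)] .

text \<open>The derivative of $e^z - z$ is at most $1/2$ in modulus on the disc of radius $1/4$.\<close>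

lemma exp_near_identity:
  fixes x y :: complex
  assumes "norm x \<le> 1/4" "norm y \<le> 1/4"
  shows "norm (x - y) \<le> 2 * norm (exp x - exp y)" "norm (exp x - exp y) \<le> 2 * norm (x - y)"
proof -
  have e: "norm (exp z) \<le> 3/2" if "norm z \<le> 1/4" for z :: complex
  proof -
    have "norm (exp z) \<le> exp (norm z)" by (rule norm_exp)
    also have "\<dots> \<le> exp (1/4)" using that by simp
    also have "\<dots> \<le> 1 + 2 * (1/4 :: real)" using exp_bound_lemma[of "1/4 :: real"] by simp
    finally show ?thesis by simp
  qed
  have e1: "norm (exp z - 1) \<le> 1/2" if "z \<in> cball 0 (1/4)" for z :: complex
  proof -
    have "norm (exp z - exp 0) \<le> 3/2 * norm (z - 0)"
      using that e by (intro field_differentiable_bound[of "cball 0 (1/4)" exp exp])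
        (auto intro: DERIV_exp has_field_derivative_at_within)
    then show ?thesis using that by simp
  qed
  have "norm ((exp x - x) - (exp y - y)) \<le> 1/2 * norm (x - y)"
    using assms e1
    by (intro field_differentiable_bound[of "cball 0 (1/4)" "\<lambda>z. exp z - z" "\<lambda>z. exp z - 1"])
      (auto intro!: derivative_eq_intros)
  moreover have "norm (x - y) - norm (exp x - exp y) \<le> norm ((exp x - x) - (exp y - y))"
    using norm_triangle_ineq2[of "x - y" "exp x - exp y"] norm_minus_commute[of "x - y" "exp x - exp y"]
    by (simp add: algebra_simps)
  moreover have "norm (exp x - exp y) - norm (x - y) \<le> norm ((exp x - x) - (exp y - y))"
    using norm_triangle_ineq2[of "exp x - exp y" "x - y"] by (simp add: algebra_simps)
  ultimately show "norm (x - y) \<le> 2 * norm (exp x - exp y)" "norm (exp x - exp y) \<le> 2 * norm (x - y)"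
    by linarith+
qed

lemma weighted_average_ge_some:
  fixes f :: "'a \<Rightarrow> real"
  assumes "finite W" "sum u W = 1" "\<And>w. w \<in> W \<Longrightarrow> 0 \<le> u w"
  obtains w where "w \<in> W" "f w \<le> (\<Sum>w\<in>W. u w * f w)"
proof -
  let ?m = "\<Sum>w\<in>W. u w * f w"
  have "\<exists>w\<in>W. f w \<le> ?m"
  proof (rule ccontr)
    assume "\<not> ?thesis"
    then have gt: "?m < f w" if "w \<in> W" for w using that by force
    have "\<exists>w\<in>W. 0 < u w"
    proof (rule ccontr)
      assume "\<not> ?thesis"
      then have "sum u W \<le> 0" by (intro sum_nonpos) force
      then show False using assms(2) by simp
    qed
    then obtain w0 where "w0 \<in> W" "0 < u w0" by blast
    then have "\<exists>w\<in>W. u w * ?m < u w * f w" using gt by (meson mult_strict_left_mono)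
    moreover have "\<forall>w\<in>W. u w * ?m \<le> u w * f w"
      using gt assms(3) by (auto intro: mult_left_mono less_imp_le)
    ultimately have "(\<Sum>w\<in>W. u w * ?m) < ?m"
      by (intro sum_strict_mono_ex1[OF assms(1)])
    then show False using assms(2) by (simp flip: sum_distrib_right)
  qed
  then show ?thesis using that by blast
qed

section \<open>Polyhedral data of the deformed system\<close>

text \<open>The combinatorial data that the analysis of the system needs: a lifting function \<open>\<nu>\<close> on $A$ whose lower
  hull is made of the cells \<open>\<V>\<close>, given by their vertex sets, and a colouring for which no cell has two vertices
  of the same colour. The cell \<open>V\<close> lies on the graph of the affine function with slope \<open>u V\<close> and
  constant term \<open>k V\<close>.\<close>

locale balanced_lifting =
  fixes A :: "(real^'n) set" and \<V> :: "(real^'n) set set" and \<gamma> :: "real^'n \<Rightarrow> 'n option"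
    and \<nu> :: "real^'n \<Rightarrow> real" and u :: "(real^'n) set \<Rightarrow> real^'n" and k :: "(real^'n) set \<Rightarrow> real"
  assumes finite_A: "finite A" and nonempty_A: "A \<noteq> {}"
    and spans: "\<And>V. V \<in> \<V> \<Longrightarrow> spans_simplex V"
    and subset_A: "\<And>V. V \<in> \<V> \<Longrightarrow> V \<subseteq> A"
    and rainbow: "\<And>V. V \<in> \<V> \<Longrightarrow> inj_on \<gamma> V"
    and lift_on: "\<And>V a. V \<in> \<V> \<Longrightarrow> a \<in> V \<Longrightarrow> \<nu> a = u V \<bullet> a + k V"
    and lift_off: "\<And>V a. V \<in> \<V> \<Longrightarrow> a \<in> A \<Longrightarrow> a \<notin> V \<Longrightarrow> u V \<bullet> a + k V < \<nu> a"
    and covers: "\<And>x. x \<in> convex hull A \<Longrightarrow> \<exists>V\<in>\<V>. x \<in> convex hull V"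
begin

lemma finite_cells: "finite \<V>"
  by (rule finite_subset[of _ "Pow A"]) (use subset_A finite_A in auto)

lemma finite_cell: "V \<in> \<V> \<Longrightarrow> finite V"
  using subset_A finite_A finite_subset by blast

definition excess :: "(real^'n) set \<Rightarrow> real^'n \<Rightarrow> real" where
  "excess V a = \<nu> a - (u V \<bullet> a + k V)"

lemma excess_on: "V \<in> \<V> \<Longrightarrow> a \<in> V \<Longrightarrow> excess V a = 0"
  using lift_on by (simp add: excess_def)

lemma excess_off: "V \<in> \<V> \<Longrightarrow> a \<in> A \<Longrightarrow> a \<notin> V \<Longrightarrow> 0 < excess V a"
  using lift_off by (simp add: excess_def)

lemma excess_nonneg: "V \<in> \<V> \<Longrightarrow> a \<in> A \<Longrightarrow> 0 \<le> excess V a"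
  using excess_on excess_off by (cases "a \<in> V") force+

text \<open>Compare the average of $\nu(a) - \langle y, a\rangle$ over $B$ with the weighted average over the vertices of
  a cell that represents the barycentre of $B$. The linear terms cancel, and the difference is the mean excess
  of $B$ over the cell. It is positive, because $B$ is not contained in the cell, and independent of $y$.\<close>

lemma gap_for_set:
  assumes B: "B \<subseteq> A" "B \<noteq> {}" "\<And>V. V \<in> \<V> \<Longrightarrow> \<not> B \<subseteq> V"
  shows "\<exists>\<delta>>0. \<forall>y. \<exists>b\<in>B. \<exists>a\<in>A. \<nu> a - y \<bullet> a + \<delta> \<le> \<nu> b - y \<bullet> b"
proof -
  have finB: "finite B" using B(1) finite_A finite_subset by blast
  define x where "x = (\<Sum>b\<in>B. (1 / real (card B)) *\<^sub>R b)"
  have one: "(\<Sum>b\<in>B. 1 / real (card B)) = 1" using finB B(2) by simp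
  have "x \<in> convex hull A"
    unfolding x_def using B(1) by (intro convex_sum[OF finB convex_convex_hull one]) (auto intro: hull_inc)
  then obtain V where V: "V \<in> \<V>" "x \<in> convex hull V" using covers by blast
  note sV = spans[OF V(1)]
  define \<delta> where "\<delta> = (\<Sum>b\<in>B. (1 / real (card B)) * excess V b)"
  have "\<delta> > 0"
  proof -
    obtain b0 where "b0 \<in> B" "b0 \<notin> V" using B(3)[OF V(1)] by blast
    moreover have "0 < real (card B)" using finB B(2) by (simp add: card_gt_0_iff)
    ultimately show ?thesis
      unfolding \<delta>_def using B(1) excess_off[OF V(1), of b0] excess_nonneg[OF V(1)]
      by (intro sum_pos2[OF finB, of b0]) auto
  qed
  moreover have "\<exists>b\<in>B. \<exists>a\<in>A. \<nu> a - y \<bullet> a + \<delta> \<le> \<nu> b - y \<bullet> b" for y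
  proof -
    let ?m = "(u V - y) \<bullet> x + k V"
    have F: "\<nu> a - y \<bullet> a = excess V a + ((u V - y) \<bullet> a + k V)" for a
      by (simp add: excess_def inner_diff_left)
    have mean: "(\<Sum>w\<in>W. c w * ((u V - y) \<bullet> w + k V)) = (u V - y) \<bullet> (\<Sum>w\<in>W. c w *\<^sub>R w) + k V"
      if "sum c W = 1" for c W
    proof -
      have "(\<Sum>w\<in>W. c w * ((u V - y) \<bullet> w + k V)) =
          (\<Sum>w\<in>W. (u V - y) \<bullet> (c w *\<^sub>R w)) + sum c W * k V"
        by (simp only: distrib_left sum.distrib inner_scaleR_right sum_distrib_right)
      then show ?thesis using that by (simp only: inner_sum_right mult_1)
    qed
    have "(\<Sum>v\<in>V. bary V v x * (\<nu> v - y \<bullet> v)) = (\<Sum>v\<in>V. bary V v x * ((u V - y) \<bullet> v + k V))"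
      using F excess_on[OF V(1)] by (intro sum.cong) auto
    also have "\<dots> = ?m"
      using mean[OF bary_coordinates(1)[OF sV]] bary_coordinates(2)[OF sV, of x] by simp
    finally have "(\<Sum>v\<in>V. bary V v x * (\<nu> v - y \<bullet> v)) = ?m" .
    moreover have "0 \<le> bary V v x" if "v \<in> V" for v
      using in_simplex_iff_bary_nonneg[OF sV, of x] V(2) that by blast
    ultimately obtain v where v: "v \<in> V" "\<nu> v - y \<bullet> v \<le> ?m"
      using weighted_average_ge_some[OF finite_cell[OF V(1)] bary_coordinates(1)[OF sV, of x], of "\<lambda>v. \<nu> v - y \<bullet> v"]
      by metis
    have "(\<Sum>b\<in>B. (1 / real (card B)) * - (\<nu> b - y \<bullet> b)) =
        - (\<Sum>b\<in>B. (1 / real (card B)) * (excess V b + ((u V - y) \<bullet> b + k V)))"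
      unfolding F by (simp only: mult_minus_right sum_negf)
    also have "\<dots> = - (\<delta> + ?m)"
      unfolding \<delta>_def x_def mean[OF one, symmetric] by (simp only: distrib_left sum.distrib)
    finally have "(\<Sum>b\<in>B. (1 / real (card B)) * - (\<nu> b - y \<bullet> b)) = - (\<delta> + ?m)" .
    then obtain b where b: "b \<in> B" "- (\<nu> b - y \<bullet> b) \<le> - (\<delta> + ?m)"
      using weighted_average_ge_some[OF finB one, of "\<lambda>b. - (\<nu> b - y \<bullet> b)"] by auto
    have "\<nu> v - y \<bullet> v + \<delta> \<le> \<nu> b - y \<bullet> b" using v(2) b(2) by linarith
    then show ?thesis using v(1) b(1) subset_A[OF V(1)] by blast
  qed
  ultimately show ?thesis by blast
qed

lemma gap:
  obtains \<delta> where "\<delta> > 0"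
    "\<And>B y. B \<subseteq> A \<Longrightarrow> B \<noteq> {} \<Longrightarrow> (\<And>V. V \<in> \<V> \<Longrightarrow> \<not> B \<subseteq> V) \<Longrightarrow>
      \<exists>b\<in>B. \<exists>a\<in>A. \<nu> a - y \<bullet> a + \<delta> \<le> \<nu> b - y \<bullet> b"
proof -
  define \<B> where "\<B> = {B. B \<subseteq> A \<and> B \<noteq> {} \<and> (\<forall>V\<in>\<V>. \<not> B \<subseteq> V)}"
  have fin: "finite \<B>" unfolding \<B>_def using finite_A by simp
  have "\<forall>B\<in>\<B>. \<exists>\<delta>>0. \<forall>y. \<exists>b\<in>B. \<exists>a\<in>A. \<nu> a - y \<bullet> a + \<delta> \<le> \<nu> b - y \<bullet> b"
  proof
    fix B assume "B \<in> \<B>"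
    then show "\<exists>\<delta>>0. \<forall>y. \<exists>b\<in>B. \<exists>a\<in>A. \<nu> a - y \<bullet> a + \<delta> \<le> \<nu> b - y \<bullet> b"
      by (intro gap_for_set) (auto simp: \<B>_def)
  qed
  from bchoice[OF this] obtain d where
    "\<forall>B\<in>\<B>. 0 < d B \<and> (\<forall>y. \<exists>b\<in>B. \<exists>a\<in>A. \<nu> a - y \<bullet> a + d B \<le> \<nu> b - y \<bullet> b)"
    by (elim exE) (rule that)
  then have d: "\<And>B. B \<in> \<B> \<Longrightarrow> 0 < d B"
    "\<And>B y. B \<in> \<B> \<Longrightarrow> \<exists>b\<in>B. \<exists>a\<in>A. \<nu> a - y \<bullet> a + d B \<le> \<nu> b - y \<bullet> b"
    by blast+
  define \<delta> where "\<delta> = Min (insert 1 (d ` \<B>))"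
  have "\<delta> > 0" unfolding \<delta>_def using fin d(1) by auto
  moreover have "\<exists>b\<in>B. \<exists>a\<in>A. \<nu> a - y \<bullet> a + \<delta> \<le> \<nu> b - y \<bullet> b"
    if B: "B \<subseteq> A" "B \<noteq> {}" "\<And>V. V \<in> \<V> \<Longrightarrow> \<not> B \<subseteq> V" for B y
  proof -
    have mem: "B \<in> \<B>" using B unfolding \<B>_def by blast
    then have "\<delta> \<le> d B" unfolding \<delta>_def using fin by auto
    moreover obtain b a where "b \<in> B" "a \<in> A" "\<nu> a - y \<bullet> a + d B \<le> \<nu> b - y \<bullet> b"
      using d(2)[OF mem] by blast
    ultimately have "\<nu> a - y \<bullet> a + \<delta> \<le> \<nu> b - y \<bullet> b" by linarith
    then show ?thesis using \<open>b \<in> B\<close> \<open>a \<in> A\<close> by blast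
  qed
  ultimately show ?thesis using that by blast
qed

section \<open>Solutions in logarithmic coordinates\<close>

text \<open>In logarithmic coordinates, with $X_j = e^{z_j}$, this is the monomial $e^{-\tau\nu(a)} X^a$.\<close>

definition mono_term :: "real \<Rightarrow> complex^'n \<Rightarrow> real^'n \<Rightarrow> complex" where
  "mono_term \<tau> z a = exp (of_real (- \<tau> * \<nu> a) + cdot a z)"

definition colour_sum :: "real \<Rightarrow> complex^'n \<Rightarrow> 'n option \<Rightarrow> complex" where
  "colour_sum \<tau> z c = (\<Sum>a | a \<in> A \<and> \<gamma> a = c. mono_term \<tau> z a)"

definition log_solution :: "real \<Rightarrow> complex^'n \<Rightarrow> bool" where
  "log_solution \<tau> z \<longleftrightarrow> (\<forall>c c'. colour_sum \<tau> z c = colour_sum \<tau> z c')"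

lemma norm_mono_term: "norm (mono_term \<tau> z a) = exp (- \<tau> * \<nu> a + a \<bullet> Re_vec z)"
  by (simp add: mono_term_def Re_cdot)

text \<open>Around $\tau u_V$ the monomials at the vertices of $V$ have the same coefficient, and the coefficients of the
  other ones are smaller by an exponential factor.\<close>

lemma mono_term_shift:
  "mono_term \<tau> (cvec (\<tau> *\<^sub>R u V) + \<zeta>) a =
     of_real (exp (- \<tau> * k V)) * (of_real (exp (- \<tau> * excess V a)) * exp (cdot a \<zeta>))"
proof -
  have "of_real (- \<tau> * \<nu> a) + cdot a (cvec (\<tau> *\<^sub>R u V) + \<zeta>) =
      of_real (- \<tau> * k V) + (of_real (- \<tau> * excess V a) + cdot a \<zeta>)"
    by (simp add: cdot_add_right cdot_cvec excess_def inner_commute algebra_simps)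
  then show ?thesis unfolding mono_term_def by (simp only: exp_add exp_of_real)
qed

lemma colour_class_split:
  assumes "V \<in> \<V>" "v \<in> V"
  shows "(\<Sum>a | a \<in> A \<and> \<gamma> a = \<gamma> v. f a) = f v + (\<Sum>a | a \<in> A - V \<and> \<gamma> a = \<gamma> v. f a)"
proof -
  have eq: "{a. a \<in> A \<and> \<gamma> a = \<gamma> v} = insert v {a. a \<in> A - V \<and> \<gamma> a = \<gamma> v}"
    using subset_A[OF assms(1)] assms(2) inj_onD[OF rainbow[OF assms(1)], of _ v] by blast
  show ?thesis
    unfolding eq by (subst sum.insert) (use finite_A assms(2) in auto)
qed

lemma colours_of_cell:
  assumes "V \<in> \<V>"
  obtains v where "v \<in> V" "\<gamma> v = c"
  using colouring_bij[OF spans[OF assms] rainbow[OF assms]] unfolding bij_betw_def by (metis UNIV_I imageE)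

lemma eventually_exp_small:
  assumes "0 < d" "0 < \<epsilon>"
  shows "\<forall>\<^sub>F \<tau> in at_top. exp (- \<tau> * d) < (\<epsilon> :: real)"
proof -
  have "\<forall>\<^sub>F \<tau> in at_top. - ln \<epsilon> / d < \<tau>" by (rule eventually_gt_at_top)
  then show ?thesis
  proof eventually_elim
    case (elim \<tau>)
    then have "- \<tau> * d < ln \<epsilon>" using assms(1) by (simp add: field_simps)
    then have "exp (- \<tau> * d) < exp (ln \<epsilon>)" by (simp only: exp_less_mono)
    then show ?case using assms(2) by simp
  qed
qed

lemma eventually_excess_small:
  assumes "V \<in> \<V>" "0 < \<epsilon>"
  shows "\<forall>\<^sub>F \<tau> in at_top. \<forall>a\<in>A - V. exp (- \<tau> * excess V a) < \<epsilon>"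
  using finite_A excess_off[OF assms(1)] assms(2)
  by (intro eventually_ball_finite ballI eventually_exp_small) auto

text \<open>The terms of maximal order belong to the vertices of a single cell $V$. They have pairwise different colours
  and cannot cancel, so each colour sum is its term at $V$ up to an error that is small compared with the largest term.\<close>

lemma localisation:
  assumes "0 < \<eta>"
  shows "\<forall>\<^sub>F \<tau> in at_top. \<forall>z. log_solution \<tau> z \<longrightarrow>
    (\<exists>V\<in>\<V>. \<exists>a0\<in>V. \<forall>v\<in>V. norm (exp (cdot (v - a0) (z - cvec (\<tau> *\<^sub>R u V))) - 1) < \<eta>)"
proof -
  obtain \<delta> where \<delta>: "\<delta> > 0"
    "\<And>B y. B \<subseteq> A \<Longrightarrow> B \<noteq> {} \<Longrightarrow> (\<And>V. V \<in> \<V> \<Longrightarrow> \<not> B \<subseteq> V) \<Longrightarrow>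
      \<exists>b\<in>B. \<exists>a\<in>A. \<nu> a - y \<bullet> a + \<delta> \<le> \<nu> b - y \<bullet> b"
    using gap by blast
  let ?N = "real (card A)"
  have N: "0 < ?N" using finite_A nonempty_A by (simp add: card_gt_0_iff)
  have "\<forall>\<^sub>F \<tau> in at_top. exp (- \<tau> * \<delta>) < \<eta> / (2 * ?N)"
    using \<delta>(1) assms N by (intro eventually_exp_small) auto
  moreover have "\<forall>\<^sub>F \<tau>::real in at_top. 0 < \<tau>" by (rule eventually_gt_at_top)
  ultimately show ?thesis
  proof eventually_elim
    case (elim \<tau>)
    show ?case
    proof (intro allI impI)
      fix z assume sol: "log_solution \<tau> z"
      define y where "y = (1 / \<tau>) *\<^sub>R Re_vec z"
      define F where "F a = \<nu> a - y \<bullet> a" for a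
      have nrm: "norm (mono_term \<tau> z a) = exp (- \<tau> * F a)" for a
        unfolding norm_mono_term F_def y_def using elim(2) by (simp add: inner_commute right_diff_distrib)
      define m where "m = arg_min_on F A"
      have mA: "m \<in> A" unfolding m_def using arg_min_if_finite(1)[OF finite_A nonempty_A] .
      have mmin: "F m \<le> F a" if "a \<in> A" for a
        unfolding m_def using arg_min_least[OF finite_A nonempty_A that] .
      let ?B = "{a \<in> A. F a < F m + \<delta>}"
      have "\<exists>V\<in>\<V>. ?B \<subseteq> V"
      proof (rule ccontr)
        assume "\<not> ?thesis"
        moreover have "?B \<subseteq> A" by blast
        moreover have "?B \<noteq> {}" using mA \<delta>(1) by auto
        ultimately obtain b a where "b \<in> ?B" "a \<in> A" "F a + \<delta> \<le> F b"
          using \<delta>(2)[of ?B y] unfolding F_def by blast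
        then show False using mmin[of a] by simp
      qed
      then obtain V where V: "V \<in> \<V>" "?B \<subseteq> V" by blast
      have mV: "m \<in> V" using V(2) mA \<delta>(1) by auto
      let ?M = "exp (- \<tau> * F m)"
      let ?R = "\<lambda>v. \<Sum>a | a \<in> A - V \<and> \<gamma> a = \<gamma> v. mono_term \<tau> z a"
      have R: "norm (?R v) \<le> ?N * (?M * exp (- \<tau> * \<delta>))" for v
      proof -
        have "norm (?R v) \<le> (\<Sum>a | a \<in> A - V \<and> \<gamma> a = \<gamma> v. ?M * exp (- \<tau> * \<delta>))"
        proof (rule sum_norm_le)
          fix a assume a: "a \<in> {a. a \<in> A - V \<and> \<gamma> a = \<gamma> v}"
          then have "F m + \<delta> \<le> F a" using V(2) by force
          then have "- \<tau> * F a \<le> - \<tau> * F m + - \<tau> * \<delta>"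
            using mult_left_mono[of "F m + \<delta>" "F a" \<tau>] elim(2) by (simp add: distrib_left)
          then show "norm (mono_term \<tau> z a) \<le> ?M * exp (- \<tau> * \<delta>)"
            unfolding nrm exp_add[symmetric] by (simp only: exp_le_cancel_iff)
        qed
        also have "\<dots> = real (card {a. a \<in> A - V \<and> \<gamma> a = \<gamma> v}) * (?M * exp (- \<tau> * \<delta>))" by simp
        also have "\<dots> \<le> ?N * (?M * exp (- \<tau> * \<delta>))"
          using finite_A by (intro mult_right_mono) (auto intro!: card_mono)
        finally show ?thesis .
      qed
      have "norm (exp (cdot (v - m) (z - cvec (\<tau> *\<^sub>R u V))) - 1) < \<eta>" if v: "v \<in> V" for v
      proof -
        have "mono_term \<tau> z v + ?R v = mono_term \<tau> z m + ?R m"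
          using sol[unfolded log_solution_def, rule_format, of "\<gamma> v" "\<gamma> m"]
          unfolding colour_sum_def colour_class_split[OF V(1) v] colour_class_split[OF V(1) mV] .
        then have "mono_term \<tau> z v - mono_term \<tau> z m = ?R m - ?R v"
          by (simp add: algebra_simps)
        then have "norm (mono_term \<tau> z v - mono_term \<tau> z m) \<le> norm (?R m) + norm (?R v)"
          using norm_triangle_ineq4[of "?R m" "?R v"] by simp
        also have "\<dots> \<le> 2 * (?N * (?M * exp (- \<tau> * \<delta>)))" using R[of m] R[of v] by linarith
        also have "\<dots> = (2 * ?N * exp (- \<tau> * \<delta>)) * ?M" by (simp add: mult_ac)
        also have "\<dots> < \<eta> * ?M"
          using elim(1) N by (intro mult_strict_right_mono) (auto simp: field_simps)
        finally have lt: "norm (mono_term \<tau> z v - mono_term \<tau> z m) < \<eta> * ?M" .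
        have "of_real (- \<tau> * \<nu> v) + cdot v z =
          cdot (v - m) (z - cvec (\<tau> *\<^sub>R u V)) + (of_real (- \<tau> * \<nu> m) + cdot m z)"
          using lift_on[OF V(1) v] lift_on[OF V(1) mV]
          by (simp add: cdot_diff_right cdot_diff_left cdot_cvec inner_commute algebra_simps)
        then have "mono_term \<tau> z v = exp (cdot (v - m) (z - cvec (\<tau> *\<^sub>R u V))) * mono_term \<tau> z m"
          unfolding mono_term_def by (simp only: exp_add)
        then have "mono_term \<tau> z v - mono_term \<tau> z m =
            (exp (cdot (v - m) (z - cvec (\<tau> *\<^sub>R u V))) - 1) * mono_term \<tau> z m"
          by (simp add: algebra_simps)
        then have "norm (exp (cdot (v - m) (z - cvec (\<tau> *\<^sub>R u V))) - 1) * ?M < \<eta> * ?M"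
          using lt by (simp add: norm_mult nrm)
        then show ?thesis by (simp only: mult_less_cancel_right) simp
      qed
      then show "\<exists>V\<in>\<V>. \<exists>a0\<in>V. \<forall>v\<in>V. norm (exp (cdot (v - a0) (z - cvec (\<tau> *\<^sub>R u V))) - 1) < \<eta>"
        using V(1) mV by blast
    qed
  qed
qed

section \<open>Solutions near a cell\<close>

text \<open>The contribution to a colour sum of the points that are not vertices of $V$, normalised by the monomial at $v_0$.\<close>

definition remainder :: "real \<Rightarrow> (real^'n) set \<Rightarrow> real^'n \<Rightarrow> complex^'n \<Rightarrow> 'n option \<Rightarrow> complex" where
  "remainder \<tau> V v0 \<zeta> c =
     (\<Sum>a | a \<in> A - V \<and> \<gamma> a = c. of_real (exp (- \<tau> * excess V a)) * exp (cdot (a - v0) \<zeta>))"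

lemma shifted_colour_sum:
  assumes "V \<in> \<V>" "v \<in> V"
  shows "colour_sum \<tau> (cvec (\<tau> *\<^sub>R u V) + \<zeta>) (\<gamma> v) =
    of_real (exp (- \<tau> * k V)) * exp (cdot v0 \<zeta>) *
      (exp (cdot (v - v0) \<zeta>) + remainder \<tau> V v0 \<zeta> (\<gamma> v))"
proof -
  have e: "exp (cdot a \<zeta>) = exp (cdot v0 \<zeta>) * exp (cdot (a - v0) \<zeta>)" for a
    by (simp add: cdot_diff_left flip: exp_add)
  have "colour_sum \<tau> (cvec (\<tau> *\<^sub>R u V) + \<zeta>) (\<gamma> v) =
      of_real (exp (- \<tau> * k V)) * exp (cdot v \<zeta>) +
      (\<Sum>a | a \<in> A - V \<and> \<gamma> a = \<gamma> v. of_real (exp (- \<tau> * k V)) *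
          (of_real (exp (- \<tau> * excess V a)) * exp (cdot a \<zeta>)))"
    unfolding colour_sum_def colour_class_split[OF assms] mono_term_shift
    using excess_on[OF assms] by simp
  also have "\<dots> = of_real (exp (- \<tau> * k V)) * exp (cdot v0 \<zeta>) * exp (cdot (v - v0) \<zeta>) +
      (\<Sum>a | a \<in> A - V \<and> \<gamma> a = \<gamma> v. of_real (exp (- \<tau> * k V)) * exp (cdot v0 \<zeta>) *
          (of_real (exp (- \<tau> * excess V a)) * exp (cdot (a - v0) \<zeta>)))"
    by (subst (1 2) e) (simp only: mult_ac)
  finally show ?thesis
    unfolding remainder_def by (simp only: distrib_left sum_distrib_left)
qed

lemma log_solution_shifted:
  assumes "V \<in> \<V>" "v0 \<in> V" "log_solution \<tau> (cvec (\<tau> *\<^sub>R u V) + \<zeta>)" "v \<in> V"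
  shows "exp (cdot (v - v0) \<zeta>) + remainder \<tau> V v0 \<zeta> (\<gamma> v) = 1 + remainder \<tau> V v0 \<zeta> (\<gamma> v0)"
proof -
  have "colour_sum \<tau> (cvec (\<tau> *\<^sub>R u V) + \<zeta>) (\<gamma> v) = colour_sum \<tau> (cvec (\<tau> *\<^sub>R u V) + \<zeta>) (\<gamma> v0)"
    using assms(3) unfolding log_solution_def by blast
  then have "exp (cdot (v - v0) \<zeta>) + remainder \<tau> V v0 \<zeta> (\<gamma> v) =
      exp (cdot (v0 - v0) \<zeta>) + remainder \<tau> V v0 \<zeta> (\<gamma> v0)"
    unfolding shifted_colour_sum[OF assms(1,4), of _ _ v0] shifted_colour_sum[OF assms(1,2), of _ _ v0]
    by simp
  moreover have "cdot (v0 - v0) \<zeta> = 0" by (simp add: cdot_def)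
  ultimately show ?thesis by simp
qed

definition spread :: real where
  "spread = (\<Sum>a\<in>A. \<Sum>b\<in>A. \<Sum>j\<in>UNIV. \<bar>(a - b) $ j\<bar>)"

lemma spread_nonneg: "0 \<le> spread"
  unfolding spread_def by (intro sum_nonneg) auto

lemma norm_cdot_edge_le:
  assumes "a \<in> A" "b \<in> A"
  shows "norm (cdot (a - b) \<zeta>) \<le> spread * norm \<zeta>"
proof -
  have "(\<Sum>j\<in>UNIV. \<bar>(a - b) $ j\<bar>) \<le> (\<Sum>b\<in>A. \<Sum>j\<in>UNIV. \<bar>(a - b) $ j\<bar>)"
    using finite_A assms(2) by (intro member_le_sum[of b A "\<lambda>b. \<Sum>j\<in>UNIV. \<bar>(a - b) $ j\<bar>"]) (auto intro: sum_nonneg)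
  also have "\<dots> \<le> spread"
    unfolding spread_def using finite_A assms(1)
    by (intro member_le_sum[of a A "\<lambda>a. \<Sum>b\<in>A. \<Sum>j\<in>UNIV. \<bar>(a - b) $ j\<bar>"]) (auto intro!: sum_nonneg)
  finally show ?thesis
    using norm_cdot_le[of "a - b" \<zeta>] mult_right_mono[of _ spread "norm \<zeta>"] by (meson norm_ge_zero order_trans)
qed

text \<open>Within this radius all products with edges are at most $1/4$, so that \<open>exp_near_identity\<close> applies.\<close>

definition unique_radius :: real where
  "unique_radius = 1 / (4 * (spread + 1))"

lemma unique_radius_pos: "0 < unique_radius"
  unfolding unique_radius_def using spread_nonneg by simp

lemma cdot_edge_small:
  assumes "a \<in> A" "b \<in> A" "norm \<zeta> \<le> unique_radius"
  shows "norm (cdot (a - b) \<zeta>) \<le> 1/4"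
proof -
  have "norm (cdot (a - b) \<zeta>) \<le> spread * unique_radius"
    using norm_cdot_edge_le[OF assms(1,2), of \<zeta>] mult_left_mono[OF assms(3) spread_nonneg] by linarith
  also have "\<dots> \<le> 1/4"
    unfolding unique_radius_def using spread_nonneg by (simp add: field_simps)
  finally show ?thesis .
qed

text \<open>For two solutions, the difference of the main terms equals a difference of remainders. The former is
  comparable with the distance of the solutions, the latter has a small Lipschitz constant.\<close>

lemma local_uniqueness:
  assumes V: "V \<in> \<V>"
  shows "\<forall>\<^sub>F \<tau> in at_top. \<forall>\<zeta> \<xi>. norm \<zeta> \<le> unique_radius \<longrightarrow> norm \<xi> \<le> unique_radius \<longrightarrow>
    log_solution \<tau> (cvec (\<tau> *\<^sub>R u V) + \<zeta>) \<longrightarrow> log_solution \<tau> (cvec (\<tau> *\<^sub>R u V) + \<xi>) \<longrightarrow> \<zeta> = \<xi>"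
proof -
  obtain v0 where v0: "v0 \<in> V" using spans_simplex_nonempty[OF spans[OF V]] by blast
  note VA = subset_A[OF V]
  let ?N = "real (card A)" and ?G = "grad_bound V"
  \<comment> \<open>A factor $2$ each comes from the two remainders, from the Lipschitz constant of the exponential function
    and from its inverse.\<close>
  define C where "C = ?G * (8 * ?N * spread)"
  have C: "0 \<le> C" unfolding C_def using grad_bound_nonneg spread_nonneg by (intro mult_nonneg_nonneg) auto
  define \<epsilon> where "\<epsilon> = 1 / (C + 1)"
  have \<epsilon>: "0 < \<epsilon>" "C * \<epsilon> < 1" unfolding \<epsilon>_def using C by (simp_all add: field_simps)
  show ?thesis
    using eventually_excess_small[OF V \<epsilon>(1)]
  proof eventually_elim
    case (elim \<tau>)
    show ?case
    proof (intro allI impI)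
      fix \<zeta> \<xi> assume small: "norm \<zeta> \<le> unique_radius" "norm \<xi> \<le> unique_radius"
        and sol: "log_solution \<tau> (cvec (\<tau> *\<^sub>R u V) + \<zeta>)" "log_solution \<tau> (cvec (\<tau> *\<^sub>R u V) + \<xi>)"
      let ?R = "remainder \<tau> V v0" and ?D = "norm (\<zeta> - \<xi>)"
      have lip: "norm (?R \<zeta> c - ?R \<xi> c) \<le> ?N * (\<epsilon> * (2 * (spread * ?D)))" for c
      proof -
        let ?S = "{a. a \<in> A - V \<and> \<gamma> a = c}"
        have "norm (?R \<zeta> c - ?R \<xi> c) = norm (\<Sum>a\<in>?S. of_real (exp (- \<tau> * excess V a)) *
            (exp (cdot (a - v0) \<zeta>) - exp (cdot (a - v0) \<xi>)))"
          unfolding remainder_def by (simp only: right_diff_distrib sum_subtractf)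
        also have "\<dots> \<le> (\<Sum>a\<in>?S. \<epsilon> * (2 * (spread * ?D)))"
        proof (rule sum_norm_le)
          fix a assume a: "a \<in> ?S"
          have aA: "a \<in> A" "v0 \<in> A" using a v0 VA by auto
          have "norm (exp (cdot (a - v0) \<zeta>) - exp (cdot (a - v0) \<xi>)) \<le> 2 * norm (cdot (a - v0) \<zeta> - cdot (a - v0) \<xi>)"
            using exp_near_identity(2) cdot_edge_small[OF aA] small by blast
          also have "\<dots> \<le> 2 * (spread * ?D)"
            unfolding cdot_diff_right[symmetric] using norm_cdot_edge_le[OF aA] by simp
          finally have b: "norm (exp (cdot (a - v0) \<zeta>) - exp (cdot (a - v0) \<xi>)) \<le> 2 * (spread * ?D)" .
          have "exp (- \<tau> * excess V a) \<le> \<epsilon>" using elim a by force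
          then show "norm (of_real (exp (- \<tau> * excess V a)) * (exp (cdot (a - v0) \<zeta>) - exp (cdot (a - v0) \<xi>)))
              \<le> \<epsilon> * (2 * (spread * ?D))"
            unfolding norm_mult using b \<epsilon>(1) by (intro mult_mono) auto
        qed
        also have "\<dots> = real (card ?S) * (\<epsilon> * (2 * (spread * ?D)))" by simp
        also have "\<dots> \<le> ?N * (\<epsilon> * (2 * (spread * ?D)))"
          using finite_A \<epsilon>(1) spread_nonneg by (intro mult_right_mono) (auto intro!: card_mono)
        finally show ?thesis .
      qed
      have "norm (cdot (v - v0) (\<zeta> - \<xi>)) \<le> 8 * ?N * spread * \<epsilon> * ?D" if v: "v \<in> V" for v
      proof -
        have vA: "v \<in> A" "v0 \<in> A" using v v0 VA by auto
        have "exp (cdot (v - v0) \<zeta>) - exp (cdot (v - v0) \<xi>) =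
            (?R \<zeta> (\<gamma> v0) - ?R \<xi> (\<gamma> v0)) - (?R \<zeta> (\<gamma> v) - ?R \<xi> (\<gamma> v))"
          using log_solution_shifted[OF V v0 sol(1) v] log_solution_shifted[OF V v0 sol(2) v]
          by (simp add: algebra_simps)
        then have "norm (exp (cdot (v - v0) \<zeta>) - exp (cdot (v - v0) \<xi>)) \<le>
            norm (?R \<zeta> (\<gamma> v0) - ?R \<xi> (\<gamma> v0)) + norm (?R \<zeta> (\<gamma> v) - ?R \<xi> (\<gamma> v))"
          using norm_triangle_ineq4 by metis
        then have "norm (exp (cdot (v - v0) \<zeta>) - exp (cdot (v - v0) \<xi>)) \<le> 2 * (?N * (\<epsilon> * (2 * (spread * ?D))))"
          using lip[of "\<gamma> v0"] lip[of "\<gamma> v"] by linarith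
        moreover have "norm (cdot (v - v0) \<zeta> - cdot (v - v0) \<xi>) \<le>
            2 * norm (exp (cdot (v - v0) \<zeta>) - exp (cdot (v - v0) \<xi>))"
          using exp_near_identity(1) cdot_edge_small[OF vA] small by blast
        ultimately have "norm (cdot (v - v0) (\<zeta> - \<xi>)) \<le> 2 * (2 * (?N * (\<epsilon> * (2 * (spread * ?D)))))"
          unfolding cdot_diff_right by linarith
        then show ?thesis by (simp add: mult_ac)
      qed
      then have "?D \<le> ?G * (8 * ?N * spread * \<epsilon> * ?D)"
        by (rule norm_le_cdot_edges[OF spans[OF V]])
      then have "?D \<le> (C * \<epsilon>) * ?D" unfolding C_def by (simp add: mult_ac)
      then have "(1 - C * \<epsilon>) * ?D \<le> 0" by (simp add: left_diff_distrib)
      then have "?D \<le> 0" using \<epsilon>(2) by (simp add: mult_le_0_iff)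
      then show "\<zeta> = \<xi>" by simp
    qed
  qed
qed

lemma log_solution_cnj:
  assumes "log_solution \<tau> z"
  shows "log_solution \<tau> (cnj_vec z)"
proof -
  have "mono_term \<tau> (cnj_vec z) a = cnj (mono_term \<tau> z a)" for a
    unfolding mono_term_def cdot_cnj by (simp add: exp_cnj)
  then have "colour_sum \<tau> (cnj_vec z) c = cnj (colour_sum \<tau> z c)" for c
    unfolding colour_sum_def by simp
  then show ?thesis using assms unfolding log_solution_def by simp
qed

text \<open>The coefficients are real, so the complex conjugate of the only nearby solution is a nearby solution.\<close>

lemma local_solutions_real:
  assumes V: "V \<in> \<V>"
  shows "\<forall>\<^sub>F \<tau> in at_top. \<forall>\<zeta>. norm \<zeta> \<le> unique_radius \<longrightarrow>
    log_solution \<tau> (cvec (\<tau> *\<^sub>R u V) + \<zeta>) \<longrightarrow> cnj_vec \<zeta> = \<zeta>"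
  using local_uniqueness[OF V]
proof eventually_elim
  case (elim \<tau>)
  show ?case
  proof (intro allI impI)
    fix \<zeta> assume z: "norm \<zeta> \<le> unique_radius" "log_solution \<tau> (cvec (\<tau> *\<^sub>R u V) + \<zeta>)"
    have "log_solution \<tau> (cvec (\<tau> *\<^sub>R u V) + cnj_vec \<zeta>)"
      using log_solution_cnj[OF z(2)] unfolding cnj_vec_add cnj_vec_cvec .
    moreover have "norm (cnj_vec \<zeta>) \<le> unique_radius" using z(1) by (simp add: norm_cnj_vec)
    ultimately show "cnj_vec \<zeta> = \<zeta>" using elim z by blast
  qed
qed

definition log_remainder :: "real \<Rightarrow> (real^'n) set \<Rightarrow> real^'n \<Rightarrow> real^'n \<Rightarrow> real" where
  "log_remainder \<tau> V v x =
     ln (1 + (\<Sum>a | a \<in> A - V \<and> \<gamma> a = \<gamma> v. exp (- \<tau> * excess V a + (a - v) \<bullet> x)))"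

lemma shifted_colour_sum_real:
  assumes V: "V \<in> \<V>" and v: "v \<in> V"
  shows "colour_sum \<tau> (cvec (\<tau> *\<^sub>R u V + x)) (\<gamma> v) =
    of_real (exp (- \<tau> * k V) * exp (v \<bullet> x + log_remainder \<tau> V v x))"
proof -
  let ?S = "\<Sum>a | a \<in> A - V \<and> \<gamma> a = \<gamma> v. exp (- \<tau> * excess V a + (a - v) \<bullet> x)"
  have "0 \<le> ?S" by (intro sum_nonneg) simp
  then have E: "exp (v \<bullet> x + log_remainder \<tau> V v x) = exp (v \<bullet> x) * (1 + ?S)"
    unfolding log_remainder_def exp_add by simp
  have "cdot (v - v) (cvec x) = 0" by (simp add: cdot_def)
  moreover have "remainder \<tau> V v (cvec x) (\<gamma> v) = of_real ?S"
    unfolding remainder_def cdot_cvec of_real_sum by (intro sum.cong refl) (simp only: exp_add of_real_mult exp_of_real)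
  ultimately show ?thesis
    unfolding cvec_add shifted_colour_sum[OF V v, of _ _ v] E cdot_cvec
    by (simp add: exp_of_real mult.assoc)
qed

text \<open>Taking logarithms of the colour sums, a real solution $x$ satisfies $\langle v, x\rangle + E_v(x) = s$ for
  all vertices $v$ and some $s$, with small functions $E_v \ge 0$. The vector $-\sum_v E_v(x) g_v$, where $g_v$ are the
  gradients of the barycentric coordinates, has the right products with the edges, so a fixed point of this
  expression is a solution, and it maps a small ball into itself.\<close>

lemma local_existence:
  assumes V: "V \<in> \<V>" and r: "0 < r"
  shows "\<forall>\<^sub>F \<tau> in at_top. \<exists>x. norm x \<le> r \<and> log_solution \<tau> (cvec (\<tau> *\<^sub>R u V + x))"
proof -
  note VA = subset_A[OF V] and sV = spans[OF V] and finV = finite_cell[OF V]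
  let ?N = "real (card A)"
  define G where "G = (\<Sum>v\<in>V. norm (bary_grad V v))"
  have G: "0 \<le> G" unfolding G_def by (intro sum_nonneg) simp
  define L where "L = exp (spread * r)"
  have L: "0 < L" unfolding L_def by simp
  \<comment> \<open>Small enough for the fixed point map to preserve the ball of radius \<open>r\<close>.\<close>
  define \<epsilon> where "\<epsilon> = r / (?N * L * G + 1)"
  have den: "0 < ?N * L * G + 1" using G L by (simp add: add_nonneg_pos)
  have \<epsilon>: "0 < \<epsilon>" unfolding \<epsilon>_def using r den by simp
  have \<epsilon>_le: "(?N * (\<epsilon> * L)) * G \<le> r"
  proof -
    have "(?N * (\<epsilon> * L)) * G = r * ((?N * L * G) / (?N * L * G + 1))" unfolding \<epsilon>_def by simp
    also have "\<dots> \<le> r * 1" using r den by (intro mult_left_mono) (auto simp: divide_le_eq_1)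
    finally show ?thesis by simp
  qed
  show ?thesis
    using eventually_excess_small[OF V \<epsilon>]
  proof eventually_elim
    case (elim \<tau>)
    let ?E = "log_remainder \<tau> V"
    have E: "0 \<le> ?E v x" "?E v x \<le> ?N * (\<epsilon> * L)" if v: "v \<in> V" and x: "norm x \<le> r" for v x
    proof -
      let ?I = "{a. a \<in> A - V \<and> \<gamma> a = \<gamma> v}"
      let ?S = "\<Sum>a\<in>?I. exp (- \<tau> * excess V a + (a - v) \<bullet> x)"
      have S0: "0 \<le> ?S" by (intro sum_nonneg) simp
      then show "0 \<le> ?E v x" unfolding log_remainder_def by simp
      have "?E v x \<le> ?S" unfolding log_remainder_def using S0 by (rule ln_add_one_self_le_self)
      also have "\<dots> \<le> (\<Sum>a\<in>?I. \<epsilon> * L)"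
      proof (rule sum_mono)
        fix a assume a: "a \<in> ?I"
        have "a \<in> A" "v \<in> A" using a v VA by auto
        then have "\<bar>(a - v) \<bullet> x\<bar> \<le> spread * norm x"
          using norm_cdot_edge_le[of a v "cvec x"] by (simp add: cdot_cvec norm_cvec)
        also have "\<dots> \<le> spread * r" using x spread_nonneg by (rule mult_left_mono)
        finally have "exp ((a - v) \<bullet> x) \<le> L" unfolding L_def by simp
        moreover have "exp (- \<tau> * excess V a) \<le> \<epsilon>" using elim a by force
        ultimately show "exp (- \<tau> * excess V a + (a - v) \<bullet> x) \<le> \<epsilon> * L"
          unfolding exp_add using \<epsilon> by (intro mult_mono) auto
      qed
      also have "\<dots> = real (card ?I) * (\<epsilon> * L)" by simp
      also have "\<dots> \<le> ?N * (\<epsilon> * L)"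
        using finite_A \<epsilon> L by (intro mult_right_mono) (auto intro!: card_mono)
      finally show "?E v x \<le> ?N * (\<epsilon> * L)" .
    qed
    define \<phi> where "\<phi> x = - (\<Sum>v\<in>V. ?E v x *\<^sub>R bary_grad V v)" for x
    have "continuous_on (cball 0 r) \<phi>"
    proof -
      have "0 < 1 + (\<Sum>a | a \<in> A - V \<and> \<gamma> a = \<gamma> v. exp (- \<tau> * excess V a + (a - v) \<bullet> x))" for v x
        by (intro add_pos_nonneg sum_nonneg) auto
      then have "continuous_on (cball 0 r) (?E v)" for v
        unfolding log_remainder_def by (intro continuous_intros) (simp add: less_imp_neq[symmetric])
      then show ?thesis unfolding \<phi>_def by (intro continuous_intros)
    qed
    moreover have "\<phi> \<in> cball 0 r \<rightarrow> cball 0 r"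
    proof
      fix x :: "real^'n" assume "x \<in> cball 0 r"
      then have x: "norm x \<le> r" by simp
      have "norm (\<phi> x) \<le> (\<Sum>v\<in>V. norm (?E v x *\<^sub>R bary_grad V v))"
        unfolding \<phi>_def norm_minus_cancel by (rule norm_sum)
      also have "\<dots> \<le> (\<Sum>v\<in>V. (?N * (\<epsilon> * L)) * norm (bary_grad V v))"
        using E[OF _ x] by (intro sum_mono) (auto intro!: mult_right_mono)
      also have "\<dots> = (?N * (\<epsilon> * L)) * G" unfolding G_def by (simp add: sum_distrib_left)
      finally show "\<phi> x \<in> cball 0 r" using \<epsilon>_le by simp
    qed
    ultimately obtain x where x: "x \<in> cball 0 r" "\<phi> x = x"
      using brouwer_ball[OF r, of 0 \<phi>] by blast
    obtain v0 where v0: "v0 \<in> V" using spans_simplex_nonempty[OF sV] by blast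
    have eq: "v \<bullet> x + ?E v x = v0 \<bullet> x + ?E v0 x" if v: "v \<in> V" for v
    proof -
      have "(v - v0) \<bullet> x = - (\<Sum>w\<in>V. ?E w x * (bary_grad V w \<bullet> (v - v0)))"
        by (subst x(2)[symmetric])
          (simp only: \<phi>_def inner_minus_right inner_sum_right inner_scaleR_right inner_commute[of "v - v0"])
      also have "\<dots> = - (\<Sum>w\<in>V. ?E w x * of_bool (v = w) - ?E w x * of_bool (v0 = w))"
        unfolding bary_grad_edge[OF sV v v0] right_diff_distrib ..
      also have "\<dots> = - (\<Sum>w\<in>V. (if v = w then ?E w x else 0) - (if v0 = w then ?E w x else 0))"
        by (intro arg_cong[of _ _ uminus] sum.cong) auto
      also have "\<dots> = - (?E v x - ?E v0 x)"
        using finV v v0 by (simp add: sum_subtractf sum.delta')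
      finally show ?thesis by (simp add: inner_diff_left)
    qed
    have "colour_sum \<tau> (cvec (\<tau> *\<^sub>R u V + x)) c = of_real (exp (- \<tau> * k V) * exp (v0 \<bullet> x + ?E v0 x))" for c
    proof -
      obtain v where "v \<in> V" "\<gamma> v = c" using colours_of_cell[OF V] .
      then show ?thesis using shifted_colour_sum_real[OF V, of v \<tau> x] eq[of v] by simp
    qed
    then have "log_solution \<tau> (cvec (\<tau> *\<^sub>R u V + x))" unfolding log_solution_def by simp
    then show ?case using x(1) by auto
  qed
qed

section \<open>The global solution set\<close>

lemma localisation_log:
  assumes "0 < r"
  shows "\<forall>\<^sub>F \<tau> in at_top. \<forall>z. log_solution \<tau> z \<longrightarrow>
    (\<exists>V\<in>\<V>. \<exists>a0\<in>V. \<forall>v\<in>V. norm (Ln (exp (cdot (v - a0) (z - cvec (\<tau> *\<^sub>R u V))))) \<le> r)"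
proof -
  have log_le: "norm (Ln q) \<le> r" if "norm (q - 1) < min (1/2) (r/2)" for q :: complex
    using norm_Ln_le[of "q - 1"] that by simp
  have "\<forall>\<^sub>F \<tau> in at_top. \<forall>z. log_solution \<tau> z \<longrightarrow>
    (\<exists>V\<in>\<V>. \<exists>a0\<in>V. \<forall>v\<in>V. norm (exp (cdot (v - a0) (z - cvec (\<tau> *\<^sub>R u V))) - 1) < min (1/2) (r/2))"
    using assms by (intro localisation) simp
  then show ?thesis
  proof eventually_elim
    case (elim \<tau>)
    show ?case
    proof (intro allI impI)
      fix z assume "log_solution \<tau> z"
      then obtain V a0 where V: "V \<in> \<V>" "a0 \<in> V"
        "\<forall>v\<in>V. norm (exp (cdot (v - a0) (z - cvec (\<tau> *\<^sub>R u V))) - 1) < min (1/2) (r/2)"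
        using elim by blast
      have "\<forall>v\<in>V. norm (Ln (exp (cdot (v - a0) (z - cvec (\<tau> *\<^sub>R u V))))) \<le> r"
        using V(3) by (intro ballI log_le) blast
      then show "\<exists>V\<in>\<V>. \<exists>a0\<in>V. \<forall>v\<in>V. norm (Ln (exp (cdot (v - a0) (z - cvec (\<tau> *\<^sub>R u V))))) \<le> r"
        using V(1,2) by blast
    qed
  qed
qed

lemma localisation_radius:
  assumes "0 < r"
  obtains \<rho> where "0 < \<rho>" "\<And>V. V \<in> \<V> \<Longrightarrow> grad_bound V * \<rho> \<le> r"
proof -
  define G where "G = (\<Sum>V\<in>\<V>. grad_bound V)"
  have G: "0 \<le> G" unfolding G_def using grad_bound_nonneg by (intro sum_nonneg) auto
  have "grad_bound V * (r / (G + 1)) \<le> r" if "V \<in> \<V>" for V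
  proof -
    have "grad_bound V \<le> G"
      unfolding G_def using that finite_cells grad_bound_nonneg by (intro member_le_sum) auto
    then have "grad_bound V * (r / (G + 1)) \<le> (G + 1) * (r / (G + 1))"
      using assms G by (intro mult_right_mono) auto
    then show ?thesis using G by simp
  qed
  moreover have "0 < r / (G + 1)" using assms G by simp
  ultimately show ?thesis using that by blast
qed

lemma real_solutions_near_cells:
  assumes "0 < r"
  shows "\<forall>\<^sub>F \<tau> in at_top. \<forall>y. log_solution \<tau> (cvec y) \<longrightarrow> (\<exists>V\<in>\<V>. norm (y - \<tau> *\<^sub>R u V) \<le> r)"
proof -
  obtain \<rho> where \<rho>: "0 < \<rho>" "\<And>V. V \<in> \<V> \<Longrightarrow> grad_bound V * \<rho> \<le> r"
    by (rule localisation_radius[OF assms]) blast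
  show ?thesis
    using localisation_log[OF \<rho>(1)]
  proof eventually_elim
    case (elim \<tau>)
    show ?case
    proof (intro allI impI)
      fix y :: "real^'n" assume "log_solution \<tau> (cvec y)"
      then obtain V a0 where V: "V \<in> \<V>" "a0 \<in> V"
        "\<And>v. v \<in> V \<Longrightarrow> norm (Ln (exp (cdot (v - a0) (cvec y - cvec (\<tau> *\<^sub>R u V))))) \<le> \<rho>"
        using elim by blast
      have "norm (cdot (v - a0) (cvec (y - \<tau> *\<^sub>R u V))) \<le> \<rho>" if "v \<in> V" for v
        using V(3)[OF that] unfolding cvec_diff[symmetric] cdot_cvec by simp
      then have "norm (cvec (y - \<tau> *\<^sub>R u V)) \<le> grad_bound V * \<rho>"
        by (rule norm_le_cdot_edges[OF spans[OF V(1)]])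
      then have "norm (y - \<tau> *\<^sub>R u V) \<le> r" using \<rho>(2)[OF V(1)] unfolding norm_cvec by linarith
      then show "\<exists>V\<in>\<V>. norm (y - \<tau> *\<^sub>R u V) \<le> r" using V(1) by blast
    qed
  qed
qed

text \<open>A cell is the set of minimisers of its excess, which is determined by the slope up to a constant.\<close>

lemma cell_slopes_distinct:
  assumes "V \<in> \<V>" "W \<in> \<V>" "u V = u W"
  shows "V = W"
proof -
  have le: "k V' \<le> k W'" if V'W': "V' \<in> \<V>" "W' \<in> \<V>" "u V' = u W'" for V' W'
  proof -
    obtain w where w: "w \<in> W'" using spans_simplex_nonempty[OF spans[OF V'W'(2)]] by blast
    then have "0 \<le> excess V' w" using excess_nonneg[OF V'W'(1)] subset_A[OF V'W'(2)] by blast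
    then show ?thesis using lift_on[OF V'W'(2) w] V'W'(3) unfolding excess_def by simp
  qed
  have "k V = k W" using le[OF assms] le[OF assms(2,1)] assms(3) by simp
  then have eq: "excess V a = excess W a" for a using assms(3) unfolding excess_def by simp
  have "a \<in> U \<longleftrightarrow> a \<in> A \<and> excess U a = 0" if "U \<in> \<V>" for U a
    using subset_A[OF that] excess_on[OF that, of a] excess_off[OF that, of a] by (cases "a \<in> U") auto
  from this[OF assms(1)] this[OF assms(2)] have "a \<in> V \<longleftrightarrow> a \<in> W" for a
    unfolding eq by simp
  then show ?thesis by blast
qed

lemma eventually_cells_separated:
  "\<forall>\<^sub>F \<tau> in at_top. \<forall>V\<in>\<V>. \<forall>W\<in>\<V>. V \<noteq> W \<longrightarrow> 2 * unique_radius < norm (\<tau> *\<^sub>R u V - \<tau> *\<^sub>R u W)"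
proof (intro eventually_ball_finite[OF finite_cells] ballI)
  fix V W assume VW: "V \<in> \<V>" "W \<in> \<V>"
  show "\<forall>\<^sub>F \<tau> in at_top. V \<noteq> W \<longrightarrow> 2 * unique_radius < norm (\<tau> *\<^sub>R u V - \<tau> *\<^sub>R u W)"
  proof (cases "V = W")
    case False
    then have d: "0 < norm (u V - u W)" using cell_slopes_distinct[OF VW] by auto
    have "\<forall>\<^sub>F \<tau> in at_top. max 0 (2 * unique_radius / norm (u V - u W)) < \<tau>" by (rule eventually_gt_at_top)
    then show ?thesis
    proof eventually_elim
      case (elim \<tau>)
      then have "2 * unique_radius < \<tau> * norm (u V - u W)" using d by (simp add: divide_less_eq)
      also have "\<dots> = norm (\<tau> *\<^sub>R u V - \<tau> *\<^sub>R u W)" using elim by (simp flip: scaleR_diff_right)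
      finally show ?case by simp
    qed
  qed simp
qed

text \<open>The centres $\tau u_V$ drift apart while the radius of uniqueness stays fixed, so the balls around them become disjoint.\<close>

lemma card_real_solutions:
  "\<forall>\<^sub>F \<tau> in at_top. finite {y. log_solution \<tau> (cvec y)} \<and> card {y. log_solution \<tau> (cvec y)} = card \<V>"
proof -
  have "\<forall>\<^sub>F \<tau> in at_top. \<forall>V\<in>\<V>. \<exists>x. norm x \<le> unique_radius \<and> log_solution \<tau> (cvec (\<tau> *\<^sub>R u V + x))"
    by (intro eventually_ball_finite[OF finite_cells] ballI local_existence unique_radius_pos)
  moreover have "\<forall>\<^sub>F \<tau> in at_top. \<forall>V\<in>\<V>. \<forall>\<zeta> \<xi>. norm \<zeta> \<le> unique_radius \<longrightarrow> norm \<xi> \<le> unique_radius \<longrightarrow>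
    log_solution \<tau> (cvec (\<tau> *\<^sub>R u V) + \<zeta>) \<longrightarrow> log_solution \<tau> (cvec (\<tau> *\<^sub>R u V) + \<xi>) \<longrightarrow> \<zeta> = \<xi>"
    by (intro eventually_ball_finite[OF finite_cells] ballI local_uniqueness)
  ultimately show ?thesis
    using real_solutions_near_cells[OF unique_radius_pos] eventually_cells_separated
  proof eventually_elim
    case (elim \<tau>)
    obtain x where x: "\<And>V. V \<in> \<V> \<Longrightarrow> norm (x V) \<le> unique_radius"
      "\<And>V. V \<in> \<V> \<Longrightarrow> log_solution \<tau> (cvec (\<tau> *\<^sub>R u V + x V))"
      using bchoice[OF elim(1)] by auto
    define Y where "Y V = \<tau> *\<^sub>R u V + x V" for V
    have "{y. log_solution \<tau> (cvec y)} = Y ` \<V>"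
    proof
      show "Y ` \<V> \<subseteq> {y. log_solution \<tau> (cvec y)}" using x(2) unfolding Y_def by blast
      show "{y. log_solution \<tau> (cvec y)} \<subseteq> Y ` \<V>"
      proof
        fix y assume "y \<in> {y. log_solution \<tau> (cvec y)}"
        then have y: "log_solution \<tau> (cvec y)" by simp
        then obtain V where V: "V \<in> \<V>" "norm (y - \<tau> *\<^sub>R u V) \<le> unique_radius" using elim(3) by blast
        have y': "log_solution \<tau> (cvec (\<tau> *\<^sub>R u V) + cvec (y - \<tau> *\<^sub>R u V))"
          unfolding cvec_add[symmetric] using y by simp
        have "cvec (y - \<tau> *\<^sub>R u V) = cvec (x V)"
          using elim(2) V y' x[OF V(1)] unfolding cvec_add by (metis norm_cvec)
        then have "y = Y V" unfolding cvec_eq_iff Y_def by (simp add: algebra_simps)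
        then show "y \<in> Y ` \<V>" using V(1) by blast
      qed
    qed
    moreover have "inj_on Y \<V>"
    proof (rule inj_onI, rule ccontr)
      fix V W assume VW: "V \<in> \<V>" "W \<in> \<V>" "Y V = Y W" "V \<noteq> W"
      have "\<tau> *\<^sub>R u V - \<tau> *\<^sub>R u W = x W - x V" using VW(3) unfolding Y_def by (simp add: algebra_simps)
      then have "norm (\<tau> *\<^sub>R u V - \<tau> *\<^sub>R u W) \<le> norm (x W) + norm (x V)"
        using norm_triangle_ineq4[of "x W" "x V"] by simp
      also have "\<dots> \<le> 2 * unique_radius" using x(1)[OF VW(1)] x(1)[OF VW(2)] by simp
      finally show False using elim(4) VW by force
    qed
    ultimately show ?case using finite_cells by (simp add: card_image)
  qed
qed

lemma log_solution_periodic: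
  assumes int: "\<forall>a\<in>A. \<forall>j. a $ j \<in> \<int>"
    and z': "\<And>j. z' $ j = z $ j + of_real (of_int (2 * n j) * pi) * \<i>"
    and sol: "log_solution \<tau> z"
  shows "log_solution \<tau> z'"
proof -
  have "mono_term \<tau> z' a = mono_term \<tau> z a" if a: "a \<in> A" for a
  proof -
    define m where "m j = \<lfloor>a $ j\<rfloor>" for j
    have m: "a $ j = of_int (m j)" for j
      using int a unfolding m_def by simp
    have "cdot a z' = cdot a z + of_real (of_int (2 * (\<Sum>j\<in>UNIV. m j * n j)) * pi) * \<i>"
      unfolding cdot_def z' distrib_left sum.distrib m
      by (simp add: sum_distrib_left sum_distrib_right mult_ac)
    then have "exp (cdot a z') = exp (cdot a z)" unfolding exp_eq by blast
    then show ?thesis unfolding mono_term_def exp_add by simp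
  qed
  then have "colour_sum \<tau> z' c = colour_sum \<tau> z c" for c
    unfolding colour_sum_def by (intro sum.cong) auto
  then show ?thesis using sol unfolding log_solution_def by simp
qed

text \<open>The products of the edges with $z - \tau u_V$ are small only modulo $2\pi i$. Replacing them by
  principal logarithms changes $z$ by an integral combination of the gradients of the barycentric
  coordinates, times $2\pi i$.\<close>

lemma complex_solutions_near_cells:
  assumes "0 < r" and int: "\<forall>V\<in>\<V>. \<forall>v\<in>V. \<forall>j. bary_grad V v $ j \<in> \<int>"
  shows "\<forall>\<^sub>F \<tau> in at_top. \<forall>z. log_solution \<tau> z \<longrightarrow>
    (\<exists>V\<in>\<V>. \<exists>\<zeta> n. norm \<zeta> \<le> r \<and> (\<forall>j. (cvec (\<tau> *\<^sub>R u V) + \<zeta>) $ j = z $ j + of_real (of_int (2 * n j) * pi) * \<i>))"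
proof -
  obtain \<rho> where \<rho>: "0 < \<rho>" "\<And>V. V \<in> \<V> \<Longrightarrow> grad_bound V * \<rho> \<le> r"
    by (rule localisation_radius[OF assms(1)]) blast
  show ?thesis
    using localisation_log[OF \<rho>(1)]
  proof eventually_elim
    case (elim \<tau>)
    show ?case
    proof (intro allI impI)
      fix z :: "complex^'n" assume "log_solution \<tau> z"
      then obtain V a0 where V: "V \<in> \<V>" "a0 \<in> V"
        "\<And>v. v \<in> V \<Longrightarrow> norm (Ln (exp (cdot (v - a0) (z - cvec (\<tau> *\<^sub>R u V))))) \<le> \<rho>"
        using elim by blast
      let ?w = "z - cvec (\<tau> *\<^sub>R u V)"
      define \<theta> where "\<theta> v = Ln (exp (cdot (v - a0) ?w))" for v
      define \<zeta> :: "complex^'n" where "\<zeta> = (\<chi> j. \<Sum>v\<in>V. \<theta> v * of_real (bary_grad V v $ j))"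
      have "norm \<zeta> \<le> grad_bound V * \<rho>"
        by (rule norm_le_grad_bound[where \<theta> = \<theta>]) (use V(3) in \<open>auto simp: \<zeta>_def \<theta>_def\<close>)
      then have small: "norm \<zeta> \<le> r" using \<rho>(2)[OF V(1)] by linarith
      have "\<exists>m::int. \<theta> v = cdot (v - a0) ?w + of_real (of_int (2 * m) * pi) * \<i>" for v
      proof -
        have "exp (\<theta> v) = exp (cdot (v - a0) ?w)" unfolding \<theta>_def by (rule exp_Ln) simp
        then show ?thesis unfolding exp_eq .
      qed
      then obtain m where m: "\<And>v. \<theta> v = cdot (v - a0) ?w + of_real (of_int (2 * m v) * pi) * \<i>" by metis
      have "\<exists>n::int. (cvec (\<tau> *\<^sub>R u V) + \<zeta>) $ j = z $ j + of_real (of_int (2 * n) * pi) * \<i>" for j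
      proof -
        define g where "g v = \<lfloor>bary_grad V v $ j\<rfloor>" for v
        have g: "bary_grad V v $ j = of_int (g v)" if "v \<in> V" for v
          using int V(1) that unfolding g_def by simp
        have "\<zeta> $ j = (\<Sum>v\<in>V. cdot (v - a0) ?w * of_real (bary_grad V v $ j)) +
            (\<Sum>v\<in>V. of_real (of_int (2 * m v) * pi) * \<i> * of_real (bary_grad V v $ j))"
          unfolding \<zeta>_def vec_lambda_beta m distrib_right sum.distrib ..
        also have "(\<Sum>v\<in>V. cdot (v - a0) ?w * of_real (bary_grad V v $ j)) = ?w $ j"
          by (rule cdot_edges_expansion[OF spans[OF V(1)]])
        also have "(\<Sum>v\<in>V. of_real (of_int (2 * m v) * pi) * \<i> * of_real (bary_grad V v $ j)) =
            of_real (of_int (2 * (\<Sum>v\<in>V. m v * g v)) * pi) * \<i>"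
          using g by (simp add: sum_distrib_left sum_distrib_right mult_ac)
        finally have "(cvec (\<tau> *\<^sub>R u V) + \<zeta>) $ j = z $ j + of_real (of_int (2 * (\<Sum>v\<in>V. m v * g v)) * pi) * \<i>"
          by simp
        then show ?thesis by blast
      qed
      then obtain n where "\<And>j. (cvec (\<tau> *\<^sub>R u V) + \<zeta>) $ j = z $ j + of_real (of_int (2 * n j) * pi) * \<i>"
        by metis
      then show "\<exists>V\<in>\<V>. \<exists>\<zeta> n. norm \<zeta> \<le> r \<and> (\<forall>j. (cvec (\<tau> *\<^sub>R u V) + \<zeta>) $ j = z $ j + of_real (of_int (2 * n j) * pi) * \<i>)"
        using V(1) small by blast
    qed
  qed
qed

lemma unimodular_solutions_positive:
  assumes int: "\<forall>a\<in>A. \<forall>j. a $ j \<in> \<int>"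
    and unimod: "\<forall>V\<in>\<V>. \<forall>v\<in>V. \<forall>j. bary_grad V v $ j \<in> \<int>"
  shows "\<forall>\<^sub>F \<tau> in at_top. \<forall>z. log_solution \<tau> z \<longrightarrow> (\<forall>j. \<exists>t::real. exp (z $ j) = of_real (exp t))"
proof -
  have "\<forall>\<^sub>F \<tau> in at_top. \<forall>V\<in>\<V>. \<forall>\<zeta>. norm \<zeta> \<le> unique_radius \<longrightarrow>
    log_solution \<tau> (cvec (\<tau> *\<^sub>R u V) + \<zeta>) \<longrightarrow> cnj_vec \<zeta> = \<zeta>"
    by (intro eventually_ball_finite[OF finite_cells] ballI local_solutions_real)
  then show ?thesis
    using complex_solutions_near_cells[OF unique_radius_pos unimod]
  proof eventually_elim
    case (elim \<tau>)
    show ?case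
    proof (intro allI impI)
      fix z j assume sol: "log_solution \<tau> z"
      then obtain V \<zeta> n where V: "V \<in> \<V>" "norm \<zeta> \<le> unique_radius"
        "\<And>j. (cvec (\<tau> *\<^sub>R u V) + \<zeta>) $ j = z $ j + of_real (of_int (2 * n j) * pi) * \<i>"
        using elim(2) by blast
      have "log_solution \<tau> (cvec (\<tau> *\<^sub>R u V) + \<zeta>)"
        using log_solution_periodic[OF int V(3) sol] .
      then have "cnj_vec \<zeta> = \<zeta>" using elim(1) V(1,2) by blast
      then have "cnj (\<zeta> $ j) = \<zeta> $ j" by (simp add: cnj_vec_def vec_eq_iff)
      then have "\<zeta> $ j \<in> \<real>" by (simp add: Reals_cnj_iff)
      then obtain s :: real where s: "\<zeta> $ j = of_real s" by (auto elim: Reals_cases)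
      have "exp ((cvec (\<tau> *\<^sub>R u V) + \<zeta>) $ j) = exp (z $ j)"
        unfolding exp_eq using V(3) by blast
      then have "exp (z $ j) = exp ((cvec (\<tau> *\<^sub>R u V) + \<zeta>) $ j)" by simp
      also have "\<dots> = of_real (exp ((\<tau> *\<^sub>R u V) $ j + s))"
        by (simp add: s cvec_def exp_of_real flip: of_real_add of_real_mult)
      finally show "\<exists>t::real. exp (z $ j) = of_real (exp t)" by blast
    qed
  qed
qed

end

section \<open>The polynomial system\<close>

text \<open>The columns of this matrix are $e_i + (1,\dots,1)$ for $i = 1,\dots,d$ and $-(d+1)\,(1,\dots,1)$: the
  vertices of a simplex with barycentre $0$, and hence with the sum of all columns as the only linear relation up to
  scaling, in a position in which no entry vanishes.\<close>

definition colour_weight :: "'n::finite option \<Rightarrow> 'n \<Rightarrow> real" where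
  "colour_weight c j = (case c of None \<Rightarrow> - (real CARD('n) + 1) | Some i \<Rightarrow> 1 + of_bool (i = j))"

lemma colour_weight_nonzero: "colour_weight c j \<noteq> 0"
  by (auto simp: colour_weight_def split: option.split)

text \<open>All equations contain the same multiple of \<open>s None\<close> and the same sum over the other colours, which makes the
  values \<open>s (Some j)\<close> equal to each other; their common value is then \<open>s None\<close>.\<close>

lemma colour_weight_relations:
  fixes s :: "'n::finite option \<Rightarrow> complex"
  shows "(\<forall>j. (\<Sum>c\<in>UNIV. of_real (colour_weight c j) * s c) = 0) \<longleftrightarrow> (\<forall>c c'. s c = s c')"
proof -
  let ?S = "\<Sum>i\<in>UNIV. s (Some i)" and ?d = "of_nat CARD('n) :: complex"
  have E: "(\<Sum>c\<in>UNIV. of_real (colour_weight c j) * s c) = s (Some j) + ?S - (?d + 1) * s None" for j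
  proof -
    have "(\<Sum>c\<in>UNIV. of_real (colour_weight c j) * s c) =
        - (?d + 1) * s None + (\<Sum>i\<in>UNIV. (1 + of_real (of_bool (i = j))) * s (Some i))"
      by (simp add: UNIV_option_conv sum.reindex colour_weight_def)
    also have "(\<Sum>i\<in>UNIV. (1 + of_real (of_bool (i = j))) * s (Some i)) = ?S + (\<Sum>i\<in>UNIV. if i = j then s (Some i) else 0)"
      unfolding sum.distrib[symmetric] by (intro sum.cong) (auto simp: distrib_right)
    finally show ?thesis by (simp add: algebra_simps)
  qed
  show ?thesis
  proof
    assume zero: "\<forall>j. (\<Sum>c\<in>UNIV. of_real (colour_weight c j) * s c) = 0"
    define p where "p = (?d + 1) * s None - ?S"
    have eq: "s (Some j) = p" for j
    proof -
      have "s (Some j) + ?S - (?d + 1) * s None = 0" using E[of j] zero by (simp only:)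
      then have "s (Some j) - p = 0" unfolding p_def by (simp only: diff_diff_eq2)
      then show ?thesis by simp
    qed
    then have "?S = ?d * p" by simp
    then have "p + ?d * p = (?d + 1) * s None" unfolding p_def by (simp add: algebra_simps)
    then have "(?d + 1) * (p - s None) = 0" by (simp add: algebra_simps)
    moreover have "?d + 1 \<noteq> 0" by (metis add.commute of_nat_Suc of_nat_neq_0)
    ultimately have "p = s None" by simp
    then have *: "s c = s None" for c using eq by (cases c) simp_all
    show "\<forall>c c'. s c = s c'" using trans[OF * *[symmetric]] by blast
  next
    assume "\<forall>c c'. s c = s c'"
    then have "s (Some j) = s None" for j by blast
    then show "\<forall>j. (\<Sum>c\<in>UNIV. of_real (colour_weight c j) * s c) = 0"
      unfolding E by (simp add: algebra_simps)
  qed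
qed

context balanced_lifting
begin

definition coefficient :: "real \<Rightarrow> 'n \<Rightarrow> real^'n \<Rightarrow> real" where
  "coefficient \<tau> j a = (if a \<in> A then exp (- \<tau> * \<nu> a) * colour_weight (\<gamma> a) j else 0)"

definition system :: "real \<Rightarrow> 'n real_system" where
  "system \<tau> j = Poly_Mapping.Abs_poly_mapping (coefficient \<tau> j)"

lemma lookup_system: "Poly_Mapping.lookup (system \<tau> j) = coefficient \<tau> j"
proof -
  have "finite {a. coefficient \<tau> j a \<noteq> 0}"
    by (rule finite_subset[OF _ finite_A]) (auto simp: coefficient_def)
  then show ?thesis unfolding system_def by (simp add: Abs_poly_mapping_inverse)
qed

lemma keys_system: "Poly_Mapping.keys (system \<tau> j) = A"
  by (auto simp: in_keys_iff lookup_system coefficient_def colour_weight_nonzero split: if_splits)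

lemma has_support_system: "has_support (system \<tau>) A"
  unfolding has_support_def keys_system by simp

lemma system_equations:
  "(\<forall>j. (\<Sum>a\<in>A. of_real (coefficient \<tau> j a) * exp (cdot a z)) = 0) \<longleftrightarrow> log_solution \<tau> z"
proof -
  have "(\<Sum>a\<in>A. of_real (coefficient \<tau> j a) * exp (cdot a z)) =
      (\<Sum>c\<in>UNIV. of_real (colour_weight c j) * colour_sum \<tau> z c)" for j
  proof -
    have "(\<Sum>a\<in>A. of_real (coefficient \<tau> j a) * exp (cdot a z)) =
        (\<Sum>a\<in>A. of_real (colour_weight (\<gamma> a) j) * mono_term \<tau> z a)"
      unfolding mono_term_def exp_add exp_of_real by (intro sum.cong refl) (simp add: coefficient_def)
    also have "\<dots> = (\<Sum>c\<in>UNIV. \<Sum>a | a \<in> A \<and> \<gamma> a = c. of_real (colour_weight (\<gamma> a) j) * mono_term \<tau> z a)"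
      by (rule sum.group[symmetric]) (use finite_A in auto)
    also have "\<dots> = (\<Sum>c\<in>UNIV. of_real (colour_weight c j) * colour_sum \<tau> z c)"
      unfolding colour_sum_def sum_distrib_left by (intro sum.cong) auto
    finally show ?thesis .
  qed
  then show ?thesis unfolding log_solution_def by (simp only: colour_weight_relations)
qed

definition ln_vec :: "real^'n \<Rightarrow> real^'n" where "ln_vec x = (\<chi> j. ln (x $ j))"

definition exp_vec :: "real^'n \<Rightarrow> real^'n" where "exp_vec y = (\<chi> j. exp (y $ j))"

lemma eval_pos_system:
  assumes "\<And>j. 0 < x $ j"
  shows "(\<forall>j. eval_pos (system \<tau> j) x = 0) \<longleftrightarrow> log_solution \<tau> (cvec (ln_vec x))"
proof -
  have "(\<Prod>j\<in>UNIV. (x $ j) powr (a $ j)) = exp (a \<bullet> ln_vec x)" for a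
    using assms by (simp add: powr_def inner_vec_def ln_vec_def exp_sum less_imp_neq[symmetric])
  then have "of_real (eval_pos (system \<tau> j) x) =
      (\<Sum>a\<in>A. of_real (coefficient \<tau> j a) * exp (cdot a (cvec (ln_vec x))))" for j
    unfolding eval_pos_def keys_system lookup_system cdot_cvec by (simp add: exp_of_real)
  then show ?thesis unfolding system_equations[symmetric] by (metis of_real_eq_0_iff)
qed

lemma positive_solutions_system:
  "positive_solutions (system \<tau>) = exp_vec ` {y. log_solution \<tau> (cvec y)}"
proof
  show "positive_solutions (system \<tau>) \<subseteq> exp_vec ` {y. log_solution \<tau> (cvec y)}"
  proof
    fix x assume "x \<in> positive_solutions (system \<tau>)"
    then have x: "\<And>j. 0 < x $ j" "\<forall>j. eval_pos (system \<tau> j) x = 0"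
      unfolding positive_solutions_def by blast+
    then have "log_solution \<tau> (cvec (ln_vec x))" using eval_pos_system by blast
    moreover have "x = exp_vec (ln_vec x)" using x(1) by (simp add: exp_vec_def ln_vec_def vec_eq_iff)
    ultimately show "x \<in> exp_vec ` {y. log_solution \<tau> (cvec y)}" by blast
  qed
  show "exp_vec ` {y. log_solution \<tau> (cvec y)} \<subseteq> positive_solutions (system \<tau>)"
  proof clarify
    fix y assume y: "log_solution \<tau> (cvec y)"
    have pos: "0 < exp_vec y $ j" for j by (simp add: exp_vec_def)
    have "ln_vec (exp_vec y) = y" by (simp add: exp_vec_def ln_vec_def vec_eq_iff)
    then show "exp_vec y \<in> positive_solutions (system \<tau>)"
      using eval_pos_system[OF pos, of \<tau>] pos y unfolding positive_solutions_def by simp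
  qed
qed

lemma card_positive_solutions:
  "\<forall>\<^sub>F \<tau> in at_top. finite (positive_solutions (system \<tau>)) \<and> card (positive_solutions (system \<tau>)) = card \<V>"
  using card_real_solutions
proof eventually_elim
  case (elim \<tau>)
  have "inj exp_vec" by (rule injI) (simp add: exp_vec_def vec_eq_iff)
  then show ?case unfolding positive_solutions_system
    using elim by (simp add: card_image inj_on_subset[OF _ subset_UNIV])
qed

lemma torus_solution_log:
  assumes int: "\<forall>a\<in>A. \<forall>j. a $ j \<in> \<int>" and z: "z \<in> torus_solutions (system \<tau>)"
  shows "log_solution \<tau> (\<chi> j. Ln (z $ j))"
proof -
  have nz: "z $ j \<noteq> 0" and eq: "eval_torus (system \<tau> j) z = 0" for j
    using z unfolding torus_solutions_def by auto
  have "(\<Prod>j\<in>UNIV. (z $ j) powi \<lfloor>a $ j\<rfloor>) = exp (cdot a (\<chi> j. Ln (z $ j)))" if a: "a \<in> A" for a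
  proof -
    have "(z $ j) powi \<lfloor>a $ j\<rfloor> = exp (of_real (a $ j) * Ln (z $ j))" for j
    proof -
      have "(z $ j) powi \<lfloor>a $ j\<rfloor> = exp (Ln (z $ j)) powi \<lfloor>a $ j\<rfloor>" using nz by simp
      also have "\<dots> = exp (of_int \<lfloor>a $ j\<rfloor> * Ln (z $ j))" by (rule exp_power_int)
      also have "(of_int \<lfloor>a $ j\<rfloor> :: complex) = of_real (a $ j)"
        using int a by (metis Ints_cases floor_of_int of_real_of_int_eq)
      finally show ?thesis .
    qed
    then show ?thesis unfolding cdot_def by (simp add: exp_sum)
  qed
  then have "eval_torus (system \<tau> j) z =
      (\<Sum>a\<in>A. of_real (coefficient \<tau> j a) * exp (cdot a (\<chi> j. Ln (z $ j))))" for j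
    unfolding eval_torus_def keys_system lookup_system by simp
  then show ?thesis using eq system_equations by metis
qed

lemma maximally_positive_system:
  assumes int: "\<forall>a\<in>A. \<forall>j. a $ j \<in> \<int>"
    and unimod: "\<forall>V\<in>\<V>. \<forall>v\<in>V. \<forall>j. bary_grad V v $ j \<in> \<int>"
  shows "\<forall>\<^sub>F \<tau> in at_top. maximally_positive (system \<tau>)"
  using unimodular_solutions_positive[OF assms]
proof eventually_elim
  case (elim \<tau>)
  show ?case
    unfolding maximally_positive_def
  proof (intro ballI impI allI)
    fix z j assume z: "z \<in> torus_solutions (system \<tau>)"
    then have nz: "z $ j \<noteq> 0" unfolding torus_solutions_def by blast
    obtain t :: real where "exp (Ln (z $ j)) = of_real (exp t)"
      using elim torus_solution_log[OF int z] by force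
    then have "z $ j = of_real (exp t)" using nz by simp
    then show "z $ j \<in> \<real> \<and> 0 < Re (z $ j)" by simp
  qed
qed

end

section \<open>Unimodular simplices\<close>

text \<open>The determinant formula \<open>content_simplex\<close> for the volume of a simplex concerns spaces whose index type is
  well-ordered. A copy of the index type, ordered by an arbitrary enumeration, transports it to every finite index
  type.\<close>

typedef 'n ordered_copy = "UNIV :: 'n set"
  morphisms original copy by simp

lemma copy_original [simp]: "copy (original x) = x" "original (copy y) = y"
  by (simp_all add: original_inverse copy_inverse)

lemma all_copy: "(\<forall>i. P i) \<longleftrightarrow> (\<forall>j. P (copy j))"
proof (intro iffI allI)
  fix i assume "\<forall>j. P (copy j)"
  then have "P (copy (original i))" ..
  then show "P i" by simp
qed simp

lemma bij_original: "bij original"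
  by (rule bij_betw_byWitness[where f' = copy]) auto

instance ordered_copy :: (finite) finite
proof
  show "finite (UNIV :: 'a ordered_copy set)"
  proof -
    have "finite (range (copy :: 'a \<Rightarrow> 'a ordered_copy))" by simp
    moreover have "range (copy :: 'a \<Rightarrow> 'a ordered_copy) = UNIV"
      by (rule surjI[of copy original]) simp
    ultimately show ?thesis by simp
  qed
qed

definition copy_rank :: "'n::finite ordered_copy \<Rightarrow> nat" where
  "copy_rank = (SOME f. inj f)"

lemma inj_copy_rank: "inj (copy_rank :: 'n::finite ordered_copy \<Rightarrow> nat)"
proof -
  have "\<exists>f :: 'n ordered_copy \<Rightarrow> nat. inj f"
    using finite_imp_inj_to_nat_seg[of "UNIV :: 'n ordered_copy set"] by auto
  from someI_ex[OF this] show ?thesis unfolding copy_rank_def .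
qed

instantiation ordered_copy :: (finite) wellorder
begin

definition "x \<le> y \<longleftrightarrow> copy_rank x \<le> copy_rank y" for x y :: "'a ordered_copy"
definition "x < y \<longleftrightarrow> copy_rank x < copy_rank y" for x y :: "'a ordered_copy"

instance
proof
  fix x y z :: "'a ordered_copy"
  show "(x < y) = (x \<le> y \<and> \<not> y \<le> x)" "x \<le> x" "x \<le> y \<or> y \<le> x"
    by (auto simp: less_eq_ordered_copy_def less_ordered_copy_def)
  show "x \<le> y \<Longrightarrow> y \<le> z \<Longrightarrow> x \<le> z" by (simp add: less_eq_ordered_copy_def)
  show "x \<le> y \<Longrightarrow> y \<le> x \<Longrightarrow> x = y"
    unfolding less_eq_ordered_copy_def by (rule injD[OF inj_copy_rank]) (rule le_antisym)
next
  fix P :: "'a ordered_copy \<Rightarrow> bool" and a :: "'a ordered_copy"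
  assume step: "\<And>x. (\<And>y. y < x \<Longrightarrow> P y) \<Longrightarrow> P x"
  show "P a"
  proof (induction a rule: measure_induct_rule[of copy_rank])
    case (less x)
    have "P y" if "y < x" for y
      using that unfolding less_ordered_copy_def by (rule less.IH)
    then show ?case by (rule step)
  qed
qed

end

definition copy_vec :: "real^'n \<Rightarrow> real^('n ordered_copy)" where
  "copy_vec x = (\<chi> i. x $ original i)"

lemma linear_copy_vec: "linear copy_vec"
  by (rule linearI) (simp_all add: copy_vec_def vec_eq_iff)

lemma inj_copy_vec: "inj copy_vec"
proof (rule injI)
  fix x y :: "real^'n" assume "copy_vec x = copy_vec y"
  then have "copy_vec x $ copy i = copy_vec y $ copy i" for i by simp
  then have "x $ i = y $ i" for i unfolding copy_vec_def by simp
  then show "x = y" by (simp add: vec_eq_iff)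
qed

lemma continuous_copy_vec: "continuous_on UNIV copy_vec"
  by (rule linear_continuous_on[OF linear_conv_bounded_linear[THEN iffD1, OF linear_copy_vec]])

lemma measurable_copy_vec: "copy_vec \<in> borel_measurable lborel"
  using borel_measurable_continuous_onI[OF continuous_copy_vec] by simp

lemma inner_copy_vec: "copy_vec x \<bullet> copy_vec y = x \<bullet> y"
  unfolding inner_vec_def copy_vec_def
  using sum.reindex_bij_betw[OF bij_original, of "\<lambda>i. x $ i * y $ i"] by simp

lemma prod_Basis_cart: "(\<Prod>b\<in>(Basis :: (real^'n) set). f b) = (\<Prod>i\<in>UNIV. f (axis i 1))"
proof -
  have B: "(Basis :: (real^'n) set) = range (\<lambda>i. axis i 1)" by (auto simp: Basis_vec_def)
  have "inj (\<lambda>i. axis i (1::real) :: real^'n)" by (rule injI) (simp add: axis_eq_axis)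
  from prod.reindex[OF this, of f] show ?thesis
    unfolding B comp_def .
qed

lemma distr_copy_vec: "distr lborel borel (copy_vec :: real^'n::finite \<Rightarrow> _) = lborel"
proof (rule lborel_eqI[symmetric])
  fix l u :: "real^('n ordered_copy)"
  assume le: "\<And>b. b \<in> Basis \<Longrightarrow> l \<bullet> b \<le> u \<bullet> b"
  define l' u' :: "real^'n" where "l' = (\<chi> i. l $ copy i)" and "u' = (\<chi> i. u $ copy i)"
  have le': "l $ i \<le> u $ i" for i
  proof -
    have "axis i 1 \<in> (Basis :: (real^('n ordered_copy)) set)" by (auto simp: Basis_vec_def)
    from le[OF this] show ?thesis by (simp add: inner_axis)
  qed
  have "copy_vec -` box l u = box l' u'"
  proof -
    have "copy_vec x \<in> box l u \<longleftrightarrow> x \<in> box l' u'" for x :: "real^'n"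
      unfolding mem_box_cart all_copy[of "\<lambda>i. l $ i < copy_vec x $ i \<and> copy_vec x $ i < u $ i"]
      by (simp add: copy_vec_def l'_def u'_def)
    then show ?thesis by blast
  qed
  then have "emeasure (distr lborel borel copy_vec) (box l u) = emeasure lborel (box l' u')"
    using emeasure_distr[OF measurable_copy_vec, of "box l u"] by simp
  also have "\<dots> = (\<Prod>b\<in>Basis. (u' - l') \<bullet> b)"
    by (rule emeasure_lborel_box) (use le' in \<open>auto simp: Basis_vec_def inner_axis l'_def u'_def\<close>)
  also have "(\<Prod>b\<in>Basis. (u' - l') \<bullet> b) = (\<Prod>b\<in>Basis. (u - l) \<bullet> b)"
    unfolding prod_Basis_cart
    using prod.reindex_bij_betw[OF bij_original, of "\<lambda>i. (u' - l') \<bullet> axis i 1"]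
    by (simp add: inner_axis l'_def u'_def)
  finally show "emeasure (distr lborel borel copy_vec) (box l u) = (\<Prod>b\<in>Basis. (u - l) \<bullet> b)" .
qed simp

lemma content_copy_vec:
  fixes S :: "(real^'n) set"
  assumes "compact S"
  shows "measure lborel (copy_vec ` S) = measure lborel S"
proof -
  have "compact (copy_vec ` S)"
    using compact_continuous_image[OF continuous_on_subset[OF continuous_copy_vec subset_UNIV] assms] .
  then have "copy_vec ` S \<in> sets borel" by (simp add: compact_imp_closed)
  then have "measure (distr lborel borel copy_vec) (copy_vec ` S) = measure lborel (copy_vec -` (copy_vec ` S))"
    using measure_distr[OF measurable_copy_vec] by simp
  then show ?thesis unfolding distr_copy_vec using inj_vimage_image_eq[OF inj_copy_vec, of S] by simp
qed

lemma det_integral: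
  fixes M :: "real^'m^'m"
  assumes "\<And>i j. M $ i $ j \<in> \<int>"
  shows "det M \<in> \<int>"
proof -
  have "of_int (sign p) * (\<Prod>i\<in>UNIV. M $ i $ p i) \<in> \<int>" for p
    by (intro Ints_mult Ints_of_int Ints_prod assms)
  then show ?thesis unfolding det_def by (rule Ints_sum)
qed

text \<open>By the volume formula, the matrix of the edges at a vertex is integral with determinant $\pm 1$. The gradients
  solve linear systems with this matrix and an integral right-hand side, so Cramer's rule applies.\<close>

lemma unimodular_bary_grad_integral:
  fixes V :: "(real^'n) set"
  assumes V: "spans_simplex V" and int: "\<And>a j. a \<in> V \<Longrightarrow> a $ j \<in> \<int>"
    and vol: "normalized_volume (convex hull V) = 1"
  shows "bary_grad V v $ j \<in> \<int>"
proof -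
  obtain v0 where v0: "v0 \<in> V" using spans_simplex_nonempty[OF V] by blast
  have finV: "finite V" using spans_simplex_finite[OF V] .
  let ?X = "copy_vec ` V"
  have "CARD('n ordered_copy) = CARD('n)" using bij_betw_same_card[OF bij_original] .
  then have cX: "card ?X = Suc CARD('n ordered_copy)"
    using V card_image[OF inj_on_subset[OF inj_copy_vec subset_UNIV], of V] unfolding spans_simplex_def by simp
  have "card (UNIV :: 'n ordered_copy set) = card (V - {v0})"
    using v0 V finV \<open>CARD('n ordered_copy) = CARD('n)\<close> unfolding spans_simplex_def by simp
  then obtain w :: "'n ordered_copy \<Rightarrow> real^'n" where w: "bij_betw w UNIV (V - {v0})"
    using finite_same_card_bij[of "UNIV :: 'n ordered_copy set" "V - {v0}"] finV by auto
  have wV: "w i \<in> V" for i using w unfolding bij_betw_def by blast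
  have "bij_betw (copy_vec \<circ> w) UNIV (?X - {copy_vec v0})"
  proof -
    have "bij_betw copy_vec (V - {v0}) (copy_vec ` (V - {v0}))"
      using inj_on_subset[OF inj_copy_vec subset_UNIV] by (simp add: bij_betw_def)
    moreover have "copy_vec ` (V - {v0}) = ?X - {copy_vec v0}"
      using inj_copy_vec by (auto dest: injD)
    ultimately show ?thesis using bij_betw_trans[OF w] by simp
  qed
  from content_simplex[OF finite_imageI[OF finV] cX imageI[OF v0] this]
  have "measure lborel (convex hull ?X) =
      \<bar>det (\<chi> i j. (copy_vec (w j) - copy_vec v0) $ i)\<bar> / fact CARD('n)"
    using \<open>CARD('n ordered_copy) = CARD('n)\<close> by simp
  moreover have "convex hull ?X = copy_vec ` (convex hull V)"
    by (rule convex_hull_linear_image[OF linear_copy_vec, symmetric])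
  moreover have "measure lborel (copy_vec ` (convex hull V)) = measure lborel (convex hull V)"
    by (intro content_copy_vec finite_imp_compact_convex_hull finV)
  ultimately have abs1: "\<bar>det (\<chi> i j. (copy_vec (w j) - copy_vec v0) $ i)\<bar> = 1" (is "\<bar>det ?M\<bar> = 1")
    using vol unfolding normalized_volume_def by (simp add: field_simps)
  define M where "M = transpose ?M"
  have M1: "det M = 1 \<or> det M = -1" using abs1 unfolding M_def det_transpose by linarith
  have Mint: "M $ i $ k \<in> \<int>" for i k
    using int[OF wV] int[OF v0] unfolding M_def transpose_def copy_vec_def by (auto intro: Ints_diff)
  define b :: "real^('n ordered_copy)" where "b = (\<chi> i. bary_grad V v \<bullet> (w i - v0))"
  have bint: "b $ i \<in> \<int>" for i
    unfolding b_def using bary_grad_edge[OF V wV v0] by simp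
  have "M *v copy_vec (bary_grad V v) = b"
  proof -
    have "(M *v copy_vec (bary_grad V v)) $ i = copy_vec (w i - v0) \<bullet> copy_vec (bary_grad V v)" for i
      unfolding M_def matrix_vector_mult_def transpose_def inner_vec_def
      by (simp add: linear_diff[OF linear_copy_vec])
    then show ?thesis unfolding inner_copy_vec b_def by (simp add: vec_eq_iff inner_commute)
  qed
  then have "copy_vec (bary_grad V v) = (\<chi> k. det (\<chi> i j. if j = k then b $ i else M $ i $ j) / det M)"
    using cramer[of M "copy_vec (bary_grad V v)" b] M1 by auto
  then have "copy_vec (bary_grad V v) $ copy j = det (\<chi> i l. if l = copy j then b $ i else M $ i $ l) / det M"
    by simp
  moreover define D where "D = det (\<chi> i l. if l = copy j then b $ i else M $ i $ l)"
  ultimately have eq: "bary_grad V v $ j = D / det M" by (simp add: copy_vec_def)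
  have "D \<in> \<int>"
    unfolding D_def by (rule det_integral) (simp add: Mint bint)
  from M1 show ?thesis
  proof
    assume "det M = 1"
    then show ?thesis unfolding eq using \<open>D \<in> \<int>\<close> by simp
  next
    assume "det M = -1"
    then show ?thesis unfolding eq using \<open>D \<in> \<int>\<close> by simp
  qed
qed

section \<open>Regular triangulations as balanced liftings\<close>

context regular_triangulation_by
begin

text \<open>Points of $A$ that are not vertices of the triangulation, although $h$ may be affine around them, are
  lifted off the graph of $h$, so that they do not contribute to the leading terms.\<close>

definition height :: "real^'n \<Rightarrow> real" where
  "height a = (if a \<in> (\<Union>S\<in>d_simplices \<Gamma>. verts S) then h a else h a + 1)"

definition slope_of :: "(real^'n) set \<Rightarrow> real^'n" where "slope_of V = slope (convex hull V)"
definition offset_of :: "(real^'n) set \<Rightarrow> real" where "offset_of V = offset (convex hull V)"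

lemma balanced_lifting_of_colouring:
  fixes \<gamma> :: "real^'n \<Rightarrow> 'n option"
  assumes \<gamma>: "\<And>S. S \<in> d_simplices \<Gamma> \<Longrightarrow> inj_on \<gamma> (verts S)"
  shows "balanced_lifting A (verts ` d_simplices \<Gamma>) \<gamma> height slope_of offset_of"
proof
  show "finite A" by (rule finite_A)
  show "A \<noteq> {}" using full unfolding full_dimensional_def by auto
  fix V assume "V \<in> verts ` d_simplices \<Gamma>"
  then obtain S where S: "S \<in> d_simplices \<Gamma>" "V = verts S" by blast
  show "spans_simplex V" "V \<subseteq> A" using d_simplex_verts[OF S(1)] S(2) by auto
  show "inj_on \<gamma> V" using \<gamma> S by blast
  have conv: "convex hull V = S" using d_simplex_verts(2) S by blast
  then have piece: "slope_of V \<bullet> a + offset_of V = piece S a" for a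
    unfolding slope_of_def offset_of_def piece_def by simp
  show "height a = slope_of V \<bullet> a + offset_of V" if "a \<in> V" for a
  proof -
    have "a \<in> S" using that S verts_subset by blast
    then show ?thesis using that S piece_eq[OF S(1)] unfolding piece height_def by auto
  qed
  show "slope_of V \<bullet> a + offset_of V < height a" if a: "a \<in> A" "a \<notin> V" for a
  proof (cases "a \<in> S")
    case False
    have "a \<in> convex hull A" using a(1) by (rule hull_inc)
    then have "piece S a < h a" using piece_lt[OF S(1) _ False] by blast
    then show ?thesis unfolding piece height_def by auto
  next
    case True
    \<comment> \<open>A vertex of another simplex that lies in \<open>S\<close> would be a vertex of \<open>S\<close>.\<close>
    have "a \<notin> verts T" if "T \<in> d_simplices \<Gamma>" for T
      using vertex_in_other_simplex[of T S a] d_simplices_subset that S True a(2) by blast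
    then have "height a = h a + 1" unfolding height_def by auto
    then show ?thesis using piece_eq[OF S(1) True] unfolding piece by simp
  qed
next
  fix x assume "x \<in> convex hull A"
  then obtain T where "T \<in> d_simplices \<Gamma>" "x \<in> T" using d_simplices_cover by blast
  then show "\<exists>V\<in>verts ` d_simplices \<Gamma>. x \<in> convex hull V" using d_simplex_verts(2) by auto
qed

lemma card_cells: "card (verts ` d_simplices \<Gamma>) = card (d_simplices \<Gamma>)"
  by (rule card_image, rule inj_onI) (simp add: verts_eq_iff)

lemma unimodular_cells:
  assumes "unimodular A \<Gamma>" "V \<in> verts ` d_simplices \<Gamma>"
  shows "bary_grad V v $ j \<in> \<int>"
proof -
  obtain S where S: "S \<in> d_simplices \<Gamma>" "V = verts S" using assms(2) by blast
  show ?thesis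
  proof (rule unimodular_bary_grad_integral)
    show "spans_simplex V" using d_simplex_verts(1) S by blast
    show "a $ j \<in> \<int>" if "a \<in> V" for a j
      using assms(1) d_simplex_verts(3)[OF S(1)] S(2) that
      unfolding unimodular_def integral_configuration_def by blast
    show "normalized_volume (convex hull V) = 1"
      using assms(1) d_simplex_verts(2)[OF S(1)] S unfolding unimodular_def by simp
  qed
qed

lemma systems_of_balanced:
  assumes "balanced A \<Gamma>"
  shows "\<exists>f :: 'n real_system. has_support f A \<and> finite (positive_solutions f) \<and>
      card (positive_solutions f) = card (d_simplices \<Gamma>)"
    and "unimodular A \<Gamma> \<Longrightarrow> \<exists>f :: 'n real_system. has_support f A \<and> maximally_positive f"
proof -
  from assms[unfolded balanced_iff_colouring]
  obtain \<gamma> :: "real^'n \<Rightarrow> 'n option" where \<gamma>: "\<forall>S\<in>d_simplices \<Gamma>. inj_on \<gamma> (verts S)"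
    by (elim exE)
  interpret B: balanced_lifting A "verts ` d_simplices \<Gamma>" \<gamma> height slope_of offset_of
    by (rule balanced_lifting_of_colouring[OF \<gamma>[rule_format]])
  obtain \<tau> where "finite (positive_solutions (B.system \<tau>))"
    "card (positive_solutions (B.system \<tau>)) = card (verts ` d_simplices \<Gamma>)"
    using eventually_happens[OF B.card_positive_solutions] by auto
  then show "\<exists>f :: 'n real_system. has_support f A \<and> finite (positive_solutions f) \<and>
      card (positive_solutions f) = card (d_simplices \<Gamma>)"
    using B.has_support_system card_cells by metis
  assume uni: "unimodular A \<Gamma>"
  have "\<forall>a\<in>A. \<forall>j. a $ j \<in> \<int>"
    using uni unfolding unimodular_def integral_configuration_def by blast
  moreover have "\<forall>V\<in>verts ` d_simplices \<Gamma>. \<forall>v\<in>V. \<forall>j. bary_grad V v $ j \<in> \<int>"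
    using unimodular_cells[OF uni] by blast
  ultimately have "\<exists>\<tau>. maximally_positive (B.system \<tau>)"
    using eventually_happens[OF B.maximally_positive_system] by auto
  then show "\<exists>f :: 'n real_system. has_support f A \<and> maximally_positive f"
    using B.has_support_system by blast
qed

end

theorem theorem3p7:
  fixes A :: "(real^'n) set" and \<Gamma> :: "(real^'n) set set"
  assumes "finite A"
    and "full_dimensional A"
    and "regular_triangulation A \<Gamma>"
  shows "(balanced A \<Gamma> \<longleftrightarrow> dual_graph_bipartite \<Gamma>) \<and>
    (balanced A \<Gamma> \<longrightarrow>
      (\<exists>f :: 'n real_system. has_support f A \<and>
         finite (positive_solutions f) \<and>
         card (d_simplices \<Gamma>) \<le> card (positive_solutions f)) \<and>
      (integral_configuration A \<and> unimodular A \<Gamma> \<longrightarrow>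
        (\<exists>f :: 'n real_system. has_support f A \<and> maximally_positive f)))"
proof -
  note regular = assms(3)[unfolded regular_triangulation_def]
  note tri = conjunct1[OF regular]
  from conjunct2[OF regular] obtain h where h: "convex_on (convex hull A) h \<and>
      (\<forall>S\<in>\<Gamma>. affine_function_on S h) \<and>
      (\<forall>S\<in>maximal_simplices \<Gamma>. \<forall>T\<in>maximal_simplices \<Gamma>.
         S \<noteq> T \<longrightarrow> \<not> affine_function_on (S \<union> T) h)"
    by (elim exE)
  interpret regular_triangulation_by A \<Gamma> h
    by (rule regular_triangulation_by.intro) (use assms(1,2) tri h in blast)+
  have equiv: "balanced A \<Gamma> \<longleftrightarrow> dual_graph_bipartite \<Gamma>"
    using balanced_imp_bipartite bipartite_imp_balanced by blast
  show ?thesis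
  proof (intro conjI impI)
    show "balanced A \<Gamma> \<longleftrightarrow> dual_graph_bipartite \<Gamma>" by (rule equiv)
    assume bal: "balanced A \<Gamma>"
    show "\<exists>f :: 'n real_system. has_support f A \<and> finite (positive_solutions f) \<and>
        card (d_simplices \<Gamma>) \<le> card (positive_solutions f)"
      using systems_of_balanced(1)[OF bal] by force
    show "\<exists>f :: 'n real_system. has_support f A \<and> maximally_positive f"
      if "integral_configuration A \<and> unimodular A \<Gamma>"
      using systems_of_balanced(2)[OF bal] that by blast
  qed
qed

end
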